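(* Let $d\in\{2,3\}$, $N_d=d(d+1)/2$, and let $\rho$, $\bm C$, the mesh $\Omega_h$, the space $V_h(\Omega_h)$, the matrices $\bm A_i,\bm A_n$, the jumps and averages, and the boundary parts $\Gamma_v,\Gamma_\sigma,\Gamma_{\rm abc}$ be as defined in the context. Let $\tau_{\bm v},\tau_{\bm\sigma}\ge 0$ be constant on each face (single-valued on shared faces). Suppose that $(\bm v,\bm\sigma)(t)\in V_h(\Omega_h)^d\times V_h(\Omega_h)^{N_d}$ is differentiable in $t$ and satisfies the DG formulation with zero body force: for all $\bm w\in V_h(\Omega_h)^d$ and $\bm q\in V_h(\Omega_h)^{N_d}$, $$\sum_{D^k}\Big(\rho\frac{\partial\bm v}{\partial t},\bm w\Big)_{L^2(D^k)}=\sum_{D^k}\Big[\Big(\sum_{i=1}^d\bm A_i^T\frac{\partial\bm\sigma}{\partial\bm x_i},\bm w\Big)_{L^2(D^k)}+\Big\langle\tfrac12\bm A_n^T[\![\bm\sigma]\!]+\tfrac{\tau_{\bm v}}2\bm A_n^T\bm A_n[\![\bm v]\!],\bm w\Big\rangle_{L^2(\partial D^k)}\Big],$$ $$\sum_{D^k}\Big(\bm C^{-1}\frac{\partial\bm\sigma}{\partial t},\bm q\Big)_{L^2(D^k)}=\sum_{D^k}\Big[\Big(\sum_{i=1}^d\bm A_i\frac{\partial\bm v}{\partial\bm x_i},\bm q\Big)_{L^2(D^k)}+\Big\langle\tfrac12\bm A_n[\![\bm v]\!]+\tfrac{\tau_{\bm\sigma}}2\bm A_n\bm A_n^T[\![\bm\sigma]\!],\bm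 q\Big\rangle_{L^2(\partial D^k)}\Big],$$ with the boundary conventions for homogeneous velocity, homogeneous traction and absorbing conditions given in the context. Then $$\begin{aligned}\sum_{D^k}\frac12\frac{\partial}{\partial t}\Big((\rho\bm v,\bm v)_{L^2(D^k)}+(\bm C^{-1}\bm\sigma,\bm\sigma)_{L^2(D^k)}\Big)=&-\sum_{f\in\Gamma_h\setminus\partial\Omega}\int_f\Big(\tfrac{\tau_{\bm v}}2\big|\bm A_n[\![\bm v]\!]\big|^2+\tfrac{\tau_{\bm\sigma}}2\big|\bm A_n^T[\![\bm\sigma]\!]\big|^2\Big)d\bm x\\&-\sum_{f\in\Gamma_v}\int_f\tau_{\bm v}\big|\bm A_n\bm v^-\big|^2d\bm x-\sum_{f\in\Gamma_\sigma}\int_f\tau_{\bm\sigma}\big|\bm A_n^T\bm\sigma^-\big|^2d\bm x\\&-\sum_{f\in\Gamma_{\rm abc}}\int_f\Big(\tfrac{\tau_{\bm v}}2\big|\bm A_n\bm v^-\big|^2+\tfrac{\tau_{\bm\sigma}}2\big|\bm A_n^T\bm\sigma^-\big|^2\Big)d\bm x\;\le\;0.\end{aligned}$$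
   Context: Coefficients. $\rho(\bm x)$ is scalar and $\bm C(\bm x)\in\mathbb R^{N_d\times N_d}$ is symmetric, both independent of time, with $0<\rho_{\min}\le\rho\le\rho_{\max}<\infty$ and $0<c_{\min}\le\bm u^T\bm C(\bm x)\bm u\le c_{\max}<\infty$, $0<\tilde c_{\min}\le\bm u^T\bm C^{-1}(\bm x)\bm u\le\tilde c_{\max}<\infty$ for all $\bm x$ and all unit vectors $\bm u\in\mathbb R^{N_d}$. Matrices. The $\bm A_i\in\mathbb R^{N_d\times d}$ are constant. For a unit normal $\bm n$, $\bm A_n=\sum_{i=1}^d\bm n_i\bm A_i$ (this determines the $\bm A_i$), where for $d=2$: $\bm A_n=\begin{pmatrix} n_x & 0 \\ 0 & n_y \\ n_y & n_x \end{pmatrix}$, and for $d=3$: $\bm A_n=\begin{pmatrix} n_x & 0 & 0 \\ 0 & n_y & 0 \\ 0 & 0 & n_z \\ 0 & n_z & n_y \\ n_z & 0 & n_x \\ n_y & n_x & 0 \end{pmatrix}$. Here $\bm v\in\mathbb R^d$ is velocity and $\bm\sigma$ lists the entries of the symmetric stress tensor: $(\sigma_{xx},\sigma_{yy},\sigma_{xy})$ for $d=2$, $(\sigma_{xx},\sigma_{yy},\sigma_{zz},\sigma_{yz},\sigma_{xz},\sigma_{xy})$ for $d=3$. Mesh and space. $\Omega\subset\mathbb R^d$ is a Lipschitz domain exactly triangulated by a (conforming) mesh $\Omega_h$ of elements $D^k$, each the image of a reference simplex $\widehat D$ under a (smooth, invertible) map $\bm\Phi^k$. $V_h(D^k)$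 is the set of functions $u$ on $D^k$ with $u\circ\bm\Phi^k\in P^N(\widehat D)$ (polynomials of total degree at most $N$), and $V_h(\Omega_h)=\bigoplus_k V_h(D^k)$. $(\cdot,\cdot)_{L^2(D^k)}$ and $\langle\cdot,\cdot\rangle_{L^2(\partial D^k)}$ are the vector $L^2$ inner products on $D^k$ and $\partial D^k$; all integrals are exact. In $\partial D^k$ terms $\bm n$ is the outward unit normal of $D^k$. $\Gamma_h$ is the set of unique faces of the mesh. Jumps. On a face $f$ of $D^k$, $u^-$ is the trace from $D^k$ and $u^+$ the trace from the neighbor; $[\![u]\!]=u^+-u^-$, and the average of $u$ is $\tfrac12(u^++u^-)$, componentwise for vectors. The boundary faces are partitioned into $\Gamma_v$ (velocity), $\Gamma_\sigma$ (traction) and $\Gamma_{\rm abc}$ (absorbing), and on them the jumps are defined by: on $\Gamma_v$, $[\![\bm v]\!]=-2\bm v^-$ and $\bm A_n^T[\![\bm\sigma]\!]=0$; on $\Gamma_\sigma$, $\bm A_n^T[\![\bm\sigma]\!]=-2\bm A_n^T\bm\sigma^-$ and $[\![\bm v]\!]=0$; on $\Gamma_{\rm abc}$, $\bm A_n^T[\![\bm\sigma]\!]=-\bm A_n^T\bm\sigma^-$ and $[\![\bm v]\!]=-\bm v^-$. *)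

theory Defs
  imports "HOL-Analysis.Analysis"
begin

section \<open>Smooth maps, surface integrals, outward normals\<close>

text \<open>Used for open \<open>U\<close> only.\<close>

primrec Ck_on :: "nat \<Rightarrow> ('a::real_normed_vector \<Rightarrow> 'b::real_normed_vector) \<Rightarrow> 'a set \<Rightarrow> bool" where
  "Ck_on 0 f U \<longleftrightarrow> continuous_on U f"
| "Ck_on (Suc m) f U \<longleftrightarrow> f differentiable_on U \<and> (\<forall>h. Ck_on m (\<lambda>x. frechet_derivative f (at x) h) U)"

text \<open>Smoothness up to the boundary of a closed set \<open>S\<close> means smoothness on an open
  neighbourhood of \<open>S\<close>. Between spaces of equal dimension the derivative is then invertible,
  i.e. the map is a diffeomorphism onto its image.\<close>

definition smooth_embedding ::
  "('a::real_normed_vector \<Rightarrow> 'b::real_normed_vector) \<Rightarrow> 'a set \<Rightarrow> bool" where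
  "smooth_embedding g S \<longleftrightarrow>
     (\<exists>U. open U \<and> S \<subseteq> U \<and> (\<forall>m. Ck_on m g U)) \<and> inj_on g S \<and>
     (\<forall>x\<in>S. inj (frechet_derivative g (at x)))"

definition ref_simplex :: "'a::euclidean_space set" where
  "ref_simplex = convex hull (insert 0 Basis)"

definition ref_faces :: "'a::euclidean_space set set" where
  "ref_faces = (\<lambda>p. convex hull (insert 0 Basis - {p})) ` insert 0 Basis"

text \<open>The integral of \<open>g\<close> over a smooth simplicial hypersurface patch \<open>f\<close>, with respect to the
  surface measure, computed in some smooth parametrization \<open>\<gamma>\<close> over the standard simplex of
  dimension one less (the dimension is that of the type argument), with the Gram determinant as
  area element. By change of variables the value does not depend on \<open>\<gamma>\<close>, so it depends on the
  set \<open>f\<close> only.\<close>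

definition surface_integral ::
  "'e::finite itself \<Rightarrow> (real^'d) set \<Rightarrow> (real^'d \<Rightarrow> real) \<Rightarrow> real" where
  "surface_integral _ f g =
     (let \<gamma> = (SOME \<gamma> :: real^'e \<Rightarrow> real^'d. smooth_embedding \<gamma> ref_simplex \<and> \<gamma> ` ref_simplex = f);
          J = (\<lambda>s. matrix (frechet_derivative \<gamma> (at s)))
      in LINT s:ref_simplex|lebesgue. g (\<gamma> s) * sqrt (det (transpose (J s) ** J s)))"

text \<open>\<open>n\<close> is the outward unit normal of \<open>D\<close> at a boundary point \<open>x\<close> if, up to
  \<open>o(norm (y - x))\<close>, the set \<open>D\<close> coincides near \<open>x\<close> with the half-space
  \<open>(y - x) \<bullet> n \<le> 0\<close>. Such an \<open>n\<close> exists at relatively interior points of the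
  faces of an element, hence almost everywhere on its boundary.\<close>

definition is_outward_normal :: "'a::euclidean_space set \<Rightarrow> 'a \<Rightarrow> 'a \<Rightarrow> bool" where
  "is_outward_normal D x n \<longleftrightarrow> norm n = 1 \<and>
     (\<forall>\<epsilon>>0. \<forall>\<^sub>F y in at x.
        (y \<in> D \<longrightarrow> (y - x) \<bullet> n \<le> \<epsilon> * norm (y - x)) \<and>
        ((y - x) \<bullet> n \<le> - \<epsilon> * norm (y - x) \<longrightarrow> y \<in> D))"

definition outward_normal :: "'a::euclidean_space set \<Rightarrow> 'a \<Rightarrow> 'a" where
  "outward_normal D x = (THE n. is_outward_normal D x n)"

lemma is_outward_normal_unique:
  assumes m: "is_outward_normal D x m" and n: "is_outward_normal D x n"
  shows "m = n"
proof -
  have key: "w \<bullet> n \<le> 0" if w: "w \<bullet> m < 0" for w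
  proof (rule ccontr)
    assume "\<not> w \<bullet> n \<le> 0"
    then have wn: "w \<bullet> n > 0" by simp
    have w0: "norm w > 0" using w by auto
    define \<epsilon> where "\<epsilon> = min (- (w \<bullet> m)) ((w \<bullet> n) / 2) / norm w"
    have \<epsilon>: "\<epsilon> > 0" using w wn w0 by (simp add: \<epsilon>_def)
    have e1: "\<epsilon> * norm w \<le> - (w \<bullet> m)" and e2: "\<epsilon> * norm w < w \<bullet> n"
      using wn w0 by (auto simp: \<epsilon>_def)
    have "filterlim (\<lambda>t. x + t *\<^sub>R w) (at x) (at_right 0)"
      unfolding filterlim_at
    proof
      show "((\<lambda>t. x + t *\<^sub>R w) \<longlongrightarrow> x) (at_right 0)"
        by (rule tendsto_eq_intros refl tendsto_ident_at | simp)+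
      show "\<forall>\<^sub>F t in at_right (0::real). x + t *\<^sub>R w \<in> UNIV \<and> x + t *\<^sub>R w \<noteq> x"
        using w0 by (auto simp: eventually_at_filter)
    qed
    then have "\<forall>\<^sub>F t in at_right 0. P (x + t *\<^sub>R w)" if "\<forall>\<^sub>F y in at x. P y" for P
      using that by (auto simp: filterlim_iff)
    from this[OF eventually_conj] m n \<epsilon>
    have "\<forall>\<^sub>F t in at_right 0.
        ((t *\<^sub>R w) \<bullet> m \<le> - \<epsilon> * norm (t *\<^sub>R w) \<longrightarrow> x + t *\<^sub>R w \<in> D) \<and>
        (x + t *\<^sub>R w \<in> D \<longrightarrow> (t *\<^sub>R w) \<bullet> n \<le> \<epsilon> * norm (t *\<^sub>R w))"
      unfolding is_outward_normal_def by (force elim: eventually_mono)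
    then have "\<forall>\<^sub>F t in at_right (0::real). False"
      using eventually_at_right_less[of 0]
    proof eventually_elim
      case (elim t)
      have "t * (w \<bullet> m) \<le> t * (- (\<epsilon> * norm w))"
        using elim e1 by (intro mult_left_mono) auto
      moreover have "t * (\<epsilon> * norm w) < t * (w \<bullet> n)"
        using elim e2 by (intro mult_strict_left_mono) auto
      ultimately have "(t *\<^sub>R w) \<bullet> m \<le> - \<epsilon> * norm (t *\<^sub>R w)"
        "\<not> (t *\<^sub>R w) \<bullet> n \<le> \<epsilon> * norm (t *\<^sub>R w)"
        using elim by (simp_all add: mult.left_commute)
      with elim show False by blast
    qed
    then show False by simp
  qed
  have nm: "norm m = 1" "norm n = 1" using assms by (auto simp: is_outward_normal_def)
  then have mm: "m \<bullet> m = 1" "n \<bullet> n = 1" by (simp_all add: dot_square_norm)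
  show ?thesis
  proof (rule ccontr)
    assume "m \<noteq> n"
    then have "0 < (m - n) \<bullet> (m - n)" by simp
    then have c: "m \<bullet> n < 1" using mm by (simp add: inner_diff inner_commute)
    show False
    proof (cases "m \<bullet> n = - 1")
      case True
      then have "(m + n) \<bullet> (m + n) = 0" using mm by (simp add: inner_add inner_commute)
      then have "n = - m" by (simp add: eq_neg_iff_add_eq_0 add.commute)
      with key[of "- m"] mm show False by simp
    next
      case False
      have "\<bar>m \<bullet> n\<bar> \<le> 1" using Cauchy_Schwarz_ineq2[of m n] nm by simp
      with c False have a: "\<bar>m \<bullet> n\<bar> < 1" by linarith
      then have "(n - m) \<bullet> m < 0" using mm by (simp add: inner_diff inner_commute)
      from key[OF this] a mm show False by (simp add: inner_diff)
    qed
  qed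
qed

section \<open>Domain and mesh\<close>

text \<open>Locally, in suitable rotated coordinates, \<open>\<Omega>\<close> is the strict epigraph of a Lipschitz
  function \<open>h\<close> of the coordinates orthogonal to \<open>e\<close>.\<close>

definition lipschitz_domain :: "'a::euclidean_space set \<Rightarrow> bool" where
  "lipschitz_domain \<Omega> \<longleftrightarrow> open \<Omega> \<and> connected \<Omega> \<and> bounded \<Omega> \<and> \<Omega> \<noteq> {} \<and>
     (\<forall>x\<in>frontier \<Omega>. \<exists>e h r L. norm e = 1 \<and> r > 0 \<and> L-lipschitz_on UNIV h \<and>
        \<Omega> \<inter> ball x r = {y \<in> ball x r. h (y - (y \<bullet> e) *\<^sub>R e) < y \<bullet> e})"

record ('k, 'd) dg_mesh =
  elems :: "'k set"
  emap :: "'k \<Rightarrow> real^'d \<Rightarrow> real^'d"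
  vel_faces :: "(real^'d) set set"
  trac_faces :: "(real^'d) set set"
  abc_faces :: "(real^'d) set set"

definition elem :: "('k, 'd::finite) dg_mesh \<Rightarrow> 'k \<Rightarrow> (real^'d) set" where
  "elem M k = emap M k ` ref_simplex"

definition elem_faces :: "('k, 'd::finite) dg_mesh \<Rightarrow> 'k \<Rightarrow> (real^'d) set set" where
  "elem_faces M k = (`) (emap M k) ` ref_faces"

definition mesh_faces :: "('k, 'd::finite) dg_mesh \<Rightarrow> (real^'d) set set" where
  "mesh_faces M = (\<Union>k\<in>elems M. elem_faces M k)"

definition boundary_faces :: "('k, 'd::finite) dg_mesh \<Rightarrow> (real^'d) set \<Rightarrow> (real^'d) set set" where
  "boundary_faces M \<Omega> = {f \<in> mesh_faces M. f \<subseteq> frontier \<Omega>}"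

text \<open>Conformity in Ciarlet's form: each face of an element lies on the boundary of the domain
  or is also a face of another element.\<close>

definition conforming_mesh :: "('k, 'd::finite) dg_mesh \<Rightarrow> (real^'d) set \<Rightarrow> bool" where
  "conforming_mesh M \<Omega> \<longleftrightarrow>
     finite (elems M) \<and>
     (\<forall>k\<in>elems M. smooth_embedding (emap M k) ref_simplex) \<and>
     (\<Union>k\<in>elems M. elem M k) = closure \<Omega> \<and>
     (\<forall>k\<in>elems M. \<forall>l\<in>elems M. k \<noteq> l \<longrightarrow> interior (elem M k) \<inter> interior (elem M l) = {}) \<and>
     (\<forall>k\<in>elems M. \<forall>f\<in>elem_faces M k.
        f \<subseteq> frontier \<Omega> \<or> (\<exists>l\<in>elems M. l \<noteq> k \<and> f \<in> elem_faces M l))"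

definition boundary_partition :: "('k, 'd::finite) dg_mesh \<Rightarrow> (real^'d) set \<Rightarrow> bool" where
  "boundary_partition M \<Omega> \<longleftrightarrow>
     vel_faces M \<union> trac_faces M \<union> abc_faces M = boundary_faces M \<Omega> \<and>
     vel_faces M \<inter> trac_faces M = {} \<and> vel_faces M \<inter> abc_faces M = {} \<and>
     trac_faces M \<inter> abc_faces M = {}"

definition neighbor :: "('k, 'd::finite) dg_mesh \<Rightarrow> 'k \<Rightarrow> (real^'d) set \<Rightarrow> 'k" where
  "neighbor M k f = (THE l. l \<in> elems M \<and> l \<noteq> k \<and> f \<in> elem_faces M l)"

text \<open>The side of a face called "minus" in integrals over unique faces: the only adjacent element
  for a boundary face, an arbitrary one of the two adjacent elements for an interior face.\<close>

definition minus_elem :: "('k, 'd::finite) dg_mesh \<Rightarrow> (real^'d) set \<Rightarrow> 'k" where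
  "minus_elem M f = (SOME k. k \<in> elems M \<and> f \<in> elem_faces M k)"

definition normal :: "('k, 'd::finite) dg_mesh \<Rightarrow> 'k \<Rightarrow> real^'d \<Rightarrow> real^'d" where
  "normal M k x = outward_normal (elem M k) x"

section \<open>Discontinuous polynomial spaces and inner products\<close>

definition poly_space :: "nat \<Rightarrow> (real^'d \<Rightarrow> real) set" where
  "poly_space N = {p. \<exists>c. \<forall>x. p x =
     (\<Sum>\<alpha> | (\<Sum>i\<in>UNIV. \<alpha> i) \<le> N. c \<alpha> * (\<Prod>i\<in>UNIV. (x $ i) ^ \<alpha> i))}"

text \<open>A discontinuous function is a family of functions, one for each element; the values of
  \<open>u k\<close> outside the closed element \<open>k\<close> play no role. In particular \<open>u k x\<close> for \<open>x\<close> on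
  a face of \<open>k\<close> is the trace from \<open>k\<close>.\<close>

definition dg_space :: "('k, 'd::finite) dg_mesh \<Rightarrow> nat \<Rightarrow> ('k \<Rightarrow> real^'d \<Rightarrow> real^'m) set" where
  "dg_space M N = {u. \<forall>k\<in>elems M. \<forall>i. \<exists>p\<in>poly_space N.
     \<forall>x\<in>ref_simplex. u k (emap M k x) $ i = p x}"

definition L2_inner ::
  "(real^'d) set \<Rightarrow> (real^'d \<Rightarrow> real^'m) \<Rightarrow> (real^'d \<Rightarrow> real^'m) \<Rightarrow> real" where
  "L2_inner D u w = (LINT x:D|lebesgue. u x \<bullet> w x)"

text \<open>The boundary inner product; the first argument may depend on the face and not only on the
  point.\<close>

definition bdry_inner :: "'e::finite itself \<Rightarrow> ('k, 'd::finite) dg_mesh \<Rightarrow> 'k \<Rightarrow>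
    ((real^'d) set \<Rightarrow> real^'d \<Rightarrow> real^'m) \<Rightarrow> (real^'d \<Rightarrow> real^'m) \<Rightarrow> real" where
  "bdry_inner E M k u w = (\<Sum>f\<in>elem_faces M k. surface_integral E f (\<lambda>x. u f x \<bullet> w x))"

definition partial :: "(real^'d) set \<Rightarrow> 'd \<Rightarrow> (real^'d \<Rightarrow> real^'m) \<Rightarrow> real^'d \<Rightarrow> real^'m" where
  "partial D i u x = frechet_derivative u (at x within D) (axis i 1)"

section \<open>Elastic matrices and jumps\<close>

text \<open>\<open>ax\<close> numbers the coordinates \<open>x, y, z\<close> and \<open>vg\<close> the stress components, both
  starting from 0.\<close>

definition A_normal :: "('d::finite \<Rightarrow> nat) \<Rightarrow> ('n::finite \<Rightarrow> nat) \<Rightarrow> real^'d \<Rightarrow> real^'d^'n" where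
  "A_normal ax vg n =
     (let nx = n $ inv ax 0; ny = n $ inv ax 1; nz = n $ inv ax 2 in
      \<chi> r c. (if CARD('d) = 2
              then [[nx, 0],
                    [0, ny],
                    [ny, nx]]
              else [[nx, 0, 0],
                    [0, ny, 0],
                    [0, 0, nz],
                    [0, nz, ny],
                    [nz, 0, nx],
                    [ny, nx, 0]]) ! vg r ! ax c)"

definition A_coord :: "('d::finite \<Rightarrow> nat) \<Rightarrow> ('n::finite \<Rightarrow> nat) \<Rightarrow> 'd \<Rightarrow> real^'d^'n" where
  "A_coord ax vg i = A_normal ax vg (axis i 1)"

lemma A_normal_eq_sum:
  fixes ax :: "'d::finite \<Rightarrow> nat" and vg :: "'n::finite \<Rightarrow> nat"
  assumes d: "CARD('d) = 2 \<or> CARD('d) = 3"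
    and nd: "CARD('n) = CARD('d) * (CARD('d) + 1) div 2"
    and ax: "bij_betw ax UNIV {..<CARD('d)}"
    and vg: "bij_betw vg UNIV {..<CARD('n)}"
  shows "A_normal ax vg n = (\<Sum>i\<in>UNIV. n $ i *\<^sub>R A_coord ax vg i)"
proof -
  have lin: "A_normal ax vg n $ r $ c = (\<Sum>i\<in>UNIV. n $ i * (A_normal ax vg (axis i 1) $ r $ c))"
    for r c
  proof -
    have S: "(\<Sum>i\<in>UNIV. n $ i * axis i 1 $ j) = n $ j" for j
      by (simp add: axis_def if_distrib cong: if_cong)
    have ac: "ax c < CARD('d)" and rr: "vg r < CARD('n)"
      using ax vg by (auto simp: bij_betw_def)
    from d show ?thesis
    proof
      assume d2: "CARD('d) = 2"
      have "vg r = 0 \<or> vg r = 1 \<or> vg r = 2" "ax c = 0 \<or> ax c = 1" using ac rr d2 nd by auto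
      then show ?thesis by (auto simp: A_normal_def Let_def d2 S)
    next
      assume d3: "CARD('d) = 3"
      have "vg r = 0 \<or> vg r = 1 \<or> vg r = 2 \<or> vg r = 3 \<or> vg r = 4 \<or> vg r = 5"
        "ax c = 0 \<or> ax c = 1 \<or> ax c = 2" using ac rr d3 nd by auto
      then show ?thesis by (auto simp: A_normal_def Let_def d3 S)
    qed
  qed
  show ?thesis by (simp add: vec_eq_iff A_coord_def lin)
qed

text \<open>Jumps at the point \<open>x\<close> of the face \<open>f\<close>, seen from the element \<open>k\<close>. On boundary
  faces only the product of \<open>A\<^sub>n\<^sup>T\<close> with the stress jump is specified, so this
  product is the defined quantity; \<open>A n\<close> stands for \<open>A\<^sub>n\<close>.\<close>

definition vel_jump ::
  "('k, 'd::finite) dg_mesh \<Rightarrow> ('k \<Rightarrow> real^'d \<Rightarrow> real^'d) \<Rightarrow> 'k \<Rightarrow> (real^'d) set \<Rightarrow> real^'d \<Rightarrow> real^'d" where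
  "vel_jump M v k f x =
     (if f \<in> vel_faces M then - 2 *\<^sub>R v k x
      else if f \<in> trac_faces M then 0
      else if f \<in> abc_faces M then - v k x
      else v (neighbor M k f) x - v k x)"

definition trac_jump ::
  "('k, 'd::finite) dg_mesh \<Rightarrow> (real^'d \<Rightarrow> real^'d^'n) \<Rightarrow> ('k \<Rightarrow> real^'d \<Rightarrow> real^'n) \<Rightarrow>
   'k \<Rightarrow> (real^'d) set \<Rightarrow> real^'d \<Rightarrow> real^'d" where
  "trac_jump M A \<sigma> k f x =
     (let An = A (normal M k x) in
      if f \<in> vel_faces M then 0
      else if f \<in> trac_faces M then - 2 *\<^sub>R (transpose An *v \<sigma> k x)
      else if f \<in> abc_faces M then - (transpose An *v \<sigma> k x)
      else transpose An *v (\<sigma> (neighbor M k f) x - \<sigma> k x))"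

end

theory Submission
  imports Defs
begin

text \<open>Testing with \<open>w = v\<close> and \<open>q = \<sigma>\<close> and adding, the volume terms combine into the divergence of the
  field \<open>F\<^sub>i = \<sigma> \<bullet> A\<^sub>i v\<close>, so that only face terms \<open>\<sigma> \<bullet> A\<^sub>n v\<close> remain; on an interior face the
  two sides carry opposite normals, the central fluxes cancel and the penalties leave the negative
  squares, and on boundary faces the prescribed jumps do the same.

  The divergence theorem on a curved simplex is obtained by pulling back to the reference simplex: the
  components of the Piola transform are the determinants of the Jacobian with one column replaced
  by the field, their divergence is computed from the symmetry of second derivatives, and the
  reference simplex is handled by Fubini and the fundamental theorem of calculus. The outward
  normal of a face is proportional to \<open>B\<^sup>-\<^sup>T \<nu>\<close> (\<open>B\<close> the Jacobian, \<open>\<nu>\<close> the reference normal), and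
  \<open>\<bar>B\<^sup>-\<^sup>T \<nu>\<bar> \<bar>det B\<bar>\<close> is the Gram area element.

  At most two elements share a face, because elements with disjoint interiors have opposite normals;
  two of them cannot meet at a boundary face, because a Lipschitz domain leaves out a cone.\<close>

section \<open>Change of variables over a finite index type\<close>

text \<open>Several definitions shape the work. \<open>surface_integral\<close> uses an arbitrarily
  chosen parametrization, so independence of that choice must be established before a face integral
  can be evaluated. The normal is a definite description, available only at relatively interior
  points of a face, and \<open>partial\<close> is a derivative within the closed element, evaluated
  only at interior points; identities are therefore proved off null sets and then integrated. The
  integral of a non-integrable function is 0, so splitting or merging integrals always costs an
  integrability proof, supplied by continuity on compact sets up to those null sets. Finally, the
  coefficients are merely measurable and the time derivatives are pointwise, with no dominating
  function at hand: the energy can be differentiated because a polynomial of bounded degree depends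
  linearly on finitely many nodal values, which makes each element energy a quadratic form with
  time-independent coefficients.\<close>

lemma lborel_distr_basis:
  fixes h :: "'a::euclidean_space \<Rightarrow> 'b::euclidean_space"
  assumes h: "bij_betw h Basis Basis"
  shows "distr lborel borel (\<lambda>x. \<Sum>b\<in>Basis. (x \<bullet> b) *\<^sub>R h b) = lborel"
proof (rule lborel_eqI[symmetric])
  let ?T = "\<lambda>x. \<Sum>b\<in>Basis. (x \<bullet> b) *\<^sub>R h b"
  have inj: "inj_on h Basis" and im: "h ` Basis = Basis" using h by (auto simp: bij_betw_def)
  have T: "?T x \<bullet> h b = x \<bullet> b" if b: "b \<in> Basis" for x b
  proof -
    have "?T x \<bullet> h b = (\<Sum>c\<in>Basis. (x \<bullet> c) * (h c \<bullet> h b))" by (simp add: inner_sum_left)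
    also have "\<dots> = (\<Sum>c\<in>Basis. if c = b then x \<bullet> c else 0)"
    proof (intro sum.cong refl)
      fix c :: 'a assume c: "c \<in> Basis"
      have "h c \<in> Basis" "h b \<in> Basis" using im b c by auto
      then show "(x \<bullet> c) * (h c \<bullet> h b) = (if c = b then x \<bullet> c else 0)"
        using inj b c by (auto simp: inner_Basis inj_on_eq_iff)
    qed
    finally show ?thesis using b by simp
  qed
  have cT: "continuous_on UNIV ?T" by (intro continuous_intros)
  then have mT[measurable]: "?T \<in> borel_measurable borel"
    by (rule borel_measurable_continuous_onI)
  fix l u :: 'b assume le: "\<And>b. b \<in> Basis \<Longrightarrow> l \<bullet> b \<le> u \<bullet> b"
  \<comment> \<open>\<open>p\<close> carries a corner of a box in the target back to the source; the
    preimage of a box is the box between the carried corners, with the same side lengths in another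
    order.\<close>
  define p where "p y = (\<Sum>b\<in>Basis. (y \<bullet> h b) *\<^sub>R b)" for y
  have p: "p y \<bullet> b = y \<bullet> h b" if "b \<in> Basis" for y b
    using that by (simp add: p_def inner_sum_left inner_Basis if_distrib cong: if_cong)
  have "(?T -` box l u) = box (p l) (p u)"
  proof (intro set_eqI)
    fix x
    have "?T x \<in> box l u \<longleftrightarrow> (\<forall>b\<in>Basis. l \<bullet> h b < ?T x \<bullet> h b \<and> ?T x \<bullet> h b < u \<bullet> h b)"
      unfolding mem_box by (subst im[symmetric]) blast
    then show "x \<in> ?T -` box l u \<longleftrightarrow> x \<in> box (p l) (p u)"
      by (simp add: mem_box T p del: im)
  qed
  then have "emeasure (distr lborel borel ?T) (box l u) = emeasure lborel (box (p l) (p u))"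
    by (subst emeasure_distr) auto
  also have "\<dots> = (\<Prod>b\<in>Basis. (p u - p l) \<bullet> b)"
    using le im by (subst emeasure_lborel_box) (auto simp: p)
  also have "(\<Prod>b\<in>Basis. (p u - p l) \<bullet> b) = (\<Prod>b\<in>Basis. (u - l) \<bullet> h b)"
    by (intro prod.cong) (auto simp: p inner_diff_left)
  also have "\<dots> = (\<Prod>b\<in>Basis. (u - l) \<bullet> b)"
    using prod.reindex_bij_betw[OF h, of "\<lambda>b. (u - l) \<bullet> b"] by simp
  finally show "emeasure (distr lborel borel ?T) (box l u) = (\<Prod>b\<in>Basis. (u - l) \<bullet> b)" .
qed simp

text \<open>A Borel map that pushes Lebesgue measure to Lebesgue measure pulls null sets back to
  null sets, so it stays measurable after completion on both sides.\<close>

lemma lebesgue_distr_basis: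
  fixes h :: "'a::euclidean_space \<Rightarrow> 'b::euclidean_space"
  assumes h: "bij_betw h Basis Basis"
  defines "T \<equiv> \<lambda>x. \<Sum>b\<in>Basis. (x \<bullet> b) *\<^sub>R h b"
  shows "T \<in> lebesgue \<rightarrow>\<^sub>M lebesgue" "distr lebesgue lebesgue T = lebesgue"
proof -
  have cT: "continuous_on UNIV T" unfolding T_def by (intro continuous_intros)
  then have mT: "T \<in> lborel \<rightarrow>\<^sub>M lborel"
    by (simp add: borel_measurable_continuous_onI)
  then have mT': "T \<in> lebesgue \<rightarrow>\<^sub>M lborel" by (rule measurable_completion)
  have "distr lborel lborel T = distr lborel borel T" by (rule distr_cong) auto
  then have e: "distr lebesgue lborel T = lborel"
    using lborel_distr_basis[OF h] distr_completion[OF mT] by (simp add: T_def)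
  have "completion (distr lebesgue lborel T) = distr lebesgue (completion lborel) T"
    by (rule completion.completion_distr_eq[OF mT']) (simp add: e)
  then show "distr lebesgue lebesgue T = lebesgue" by (simp add: e)
  show "T \<in> lebesgue \<rightarrow>\<^sub>M lebesgue"
    by (rule completion.measurable_completion2[OF mT']) (simp add: e)
qed

lemma integral_lebesgue_basis:
  fixes h :: "'a::euclidean_space \<Rightarrow> 'b::euclidean_space" and f :: "'b \<Rightarrow> real"
  assumes h: "bij_betw h Basis Basis" and f: "integrable lebesgue f"
  defines "T \<equiv> \<lambda>x. \<Sum>b\<in>Basis. (x \<bullet> b) *\<^sub>R h b"
  shows "integrable lebesgue (\<lambda>x. f (T x))" "(LINT x|lebesgue. f (T x)) = (LINT y|lebesgue. f y)"
proof -
  note T = lebesgue_distr_basis[OF h, folded T_def]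
  have f': "integrable (distr lebesgue lebesgue T) f" using f T by simp
  show "integrable lebesgue (\<lambda>x. f (T x))" by (rule integrable_distr[OF T(1) f'])
  have "(LINT y|distr lebesgue lebesgue T. f y) = (LINT x|lebesgue. f (T x))"
    using f by (intro integral_distr[OF T(1)]) auto
  then show "(LINT x|lebesgue. f (T x)) = (LINT y|lebesgue. f y)" by (simp add: T)
qed

section \<open>Relabelling the coordinates of a vector\<close>

definition reindex :: "('w::finite \<Rightarrow> 'm::finite) \<Rightarrow> real^'m \<Rightarrow> real^'w" where
  "reindex b x = (\<chi> i. x $ b i)"

lemma reindex_eq_basis:
  assumes b: "bij (b :: 'w::finite \<Rightarrow> 'm::finite)"
  shows "reindex b = (\<lambda>x. \<Sum>c\<in>Basis. (x \<bullet> c) *\<^sub>R (\<chi> i. c $ b i))"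
proof (rule ext)
  fix x :: "real^'m"
  have "x = (\<Sum>c\<in>Basis. (x \<bullet> c) *\<^sub>R c)" by (simp add: euclidean_representation)
  then have "x $ b i = (\<Sum>c\<in>Basis. (x \<bullet> c) *\<^sub>R c) $ b i" for i by simp
  then show "reindex b x = (\<Sum>c\<in>Basis. (x \<bullet> c) *\<^sub>R (\<chi> i. c $ b i))"
    by (simp add: reindex_def vec_eq_iff)
qed

lemma bij_betw_Basis_reindex:
  assumes b: "bij (b :: 'w::finite \<Rightarrow> 'm::finite)"
  shows "bij_betw (\<lambda>c::real^'m. (\<chi> i. c $ b i)::real^'w) Basis Basis"
proof -
  have ax: "(\<chi> i. (axis j 1 :: real^'m) $ b i) = axis (inv b j) (1::real)" for j
    using b by (auto simp: vec_eq_iff axis_def bij_inv_eq_iff)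
  have B: "(Basis :: (real^'n::finite) set) = range (\<lambda>i. axis i 1)" by (auto simp: Basis_vec_def)
  have "inj (inv b)" "surj (inv b)" using b by (auto simp: bij_def inj_imp_surj_inv surj_imp_inj_inv)
  show ?thesis unfolding B
  proof (rule bij_betw_imageI)
    show "inj_on (\<lambda>c. \<chi> i. c $ b i) (range (\<lambda>i. axis i (1::real)))"
      using \<open>inj (inv b)\<close> unfolding inj_on_def by (auto simp only: ax axis_eq_axis) 
    have "(\<lambda>c. \<chi> i. c $ b i) ` range (\<lambda>i::'m. axis i (1::real)) = (\<lambda>j. axis j 1) ` range (inv b)"
      by (simp only: image_image ax)
    then show "(\<lambda>c. \<chi> i. c $ b i) ` range (\<lambda>i::'m. axis i (1::real)) = range (\<lambda>i. axis i 1)"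
      by (simp only: \<open>surj (inv b)\<close>)
  qed
qed

lemma integral_reindex:
  fixes f :: "real^'w::finite \<Rightarrow> real" and b :: "'w \<Rightarrow> 'm::finite"
  assumes b: "bij b" and f: "integrable lebesgue f"
  shows "integrable lebesgue (\<lambda>x. f (reindex b x))"
    "(LINT x|lebesgue. f (reindex b x)) = (LINT y|lebesgue. f y)"
  using integral_lebesgue_basis[OF bij_betw_Basis_reindex[OF b] f]
  by (simp_all add: reindex_eq_basis[OF b])

lemma reindex_inv:
  assumes b: "bij b"
  shows "reindex (inv b) (reindex b x) = x" "reindex b (reindex (inv b) y) = y"
  using b by (auto simp: reindex_def vec_eq_iff bij_def surj_f_inv_f)

lemma set_integral_reindex:
  fixes f :: "real^'w::finite \<Rightarrow> real" and b :: "'w \<Rightarrow> 'm::finite"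
  assumes b: "bij b" and f: "set_integrable lebesgue S f"
  shows "set_integrable lebesgue (reindex (inv b) ` S) (\<lambda>x. f (reindex b x))"
    "(LINT x:(reindex (inv b) ` S)|lebesgue. f (reindex b x)) = (LINT y:S|lebesgue. f y)"
proof -
  have "indicator (reindex (inv b) ` S) x = (indicator S (reindex b x) :: real)" for x
    using reindex_inv[OF b] by (auto simp: indicator_def image_iff) metis+
  then show "set_integrable lebesgue (reindex (inv b) ` S) (\<lambda>x. f (reindex b x))"
    "(LINT x:(reindex (inv b) ` S)|lebesgue. f (reindex b x)) = (LINT y:S|lebesgue. f y)"
    using integral_reindex[OF b f[unfolded set_integrable_def]]
    unfolding set_integrable_def set_lebesgue_integral_def by auto
qed

lemma linear_reindex: "linear (reindex b)"
  by (rule linearI) (auto simp: reindex_def vec_eq_iff)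

text \<open>Conjugation by \<open>b\<close> matches the permutations of the two index types and
  keeps their signs, so the two Leibniz expansions agree term by term.\<close>

lemma det_reindex:
  fixes A :: "real^'m::finite^'m" and b :: "'w::finite \<Rightarrow> 'm"
  assumes b: "bij b"
  shows "det (\<chi> i j. A $ b i $ b j) = det A"
proof -
  have bw: "bij_betw b UNIV UNIV" and inj: "inj_on b UNIV"
    using b by (auto simp: bij_def bij_betw_def)
  have mp: "map_permutation UNIV b p permutes UNIV" if "p permutes UNIV" for p
    using map_permutation_permutes[OF bw that] .
  have ap: "map_permutation UNIV b p (b i) = b (p i)" if "p permutes UNIV" for p i
    using inj by (intro map_permutation_apply) auto
  have "det A = (\<Sum>q | q permutes UNIV. of_int (sign q) * (\<Prod>i\<in>UNIV. A $ i $ q i))"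
    by (simp add: det_def)
  also have "\<dots> = (\<Sum>p | p permutes (UNIV::'w set). of_int (sign p) * (\<Prod>i\<in>UNIV. A $ b i $ b (p i)))"
  proof (rule sum.reindex_bij_witness[where i = "map_permutation UNIV b" and j = "map_permutation UNIV (inv b)"])
    have bi: "bij (inv b)" using b by (rule bij_imp_bij_inv)
    then have bwi: "bij_betw (inv b) UNIV UNIV" by (auto simp: bij_def bij_betw_def)
    fix q assume q: "q \<in> {q. q permutes (UNIV::'m set)}"
    then show "map_permutation UNIV b (map_permutation UNIV (inv b) q) = q"
      using b by (intro map_permutation_compose_inv[OF bwi]) (auto simp: bij_def surj_f_inv_f)
    show m: "map_permutation UNIV (inv b) q \<in> {p. p permutes UNIV}"
      using map_permutation_permutes[OF bwi] q by auto
    have "sign (map_permutation UNIV (inv b) q) = sign q"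
      using q bi by (intro sign_map_permutation) (auto simp: bij_def)
    moreover have "b (map_permutation UNIV (inv b) q i) = q (b i)" for i
    proof -
      have "map_permutation UNIV (inv b) q (inv b (b i)) = inv b (q (b i))"
        using bi by (intro map_permutation_apply) (auto simp: bij_def)
      then show ?thesis using b by (simp add: bij_def surj_f_inv_f)
    qed
    moreover have "(\<Prod>i\<in>UNIV. A $ b i $ q (b i)) = (\<Prod>i\<in>UNIV. A $ i $ q i)"
      using prod.reindex_bij_betw[OF bw, of "\<lambda>i. A $ i $ q i"] by simp
    ultimately show "of_int (sign (map_permutation UNIV (inv b) q)) *
        (\<Prod>i\<in>UNIV. A $ b i $ b (map_permutation UNIV (inv b) q i)) =
        of_int (sign q) * (\<Prod>i\<in>UNIV. A $ i $ q i)" by simp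
  next
    fix p assume p: "p \<in> {p. p permutes (UNIV::'w set)}"
    then show "map_permutation UNIV (inv b) (map_permutation UNIV b p) = p"
      using b by (intro map_permutation_compose_inv[OF bw]) (auto simp: bij_def)
    show "map_permutation UNIV b p \<in> {q. q permutes UNIV}" using mp p by auto
  qed
  also have "\<dots> = det (\<chi> i j. A $ b i $ b j)" by (simp add: det_def)
  finally show ?thesis by simp
qed

text \<open>The change of variables theorem of the library needs a well-ordered index type; every finite
  type has a well-ordered copy.\<close>

typedef 'a wo_copy = "{..<CARD('a::finite)}"
  by (rule exI[of _ 0]) simp

instance wo_copy :: (finite) finite
proof
  have "(UNIV :: 'a wo_copy set) = Abs_wo_copy ` {..<CARD('a)}"
    by (rule type_definition.Abs_image[OF type_definition_wo_copy, symmetric])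
  then show "finite (UNIV :: 'a wo_copy set)" by (metis finite_imageI finite_lessThan)
qed

instantiation wo_copy :: (finite) wellorder
begin

definition "(x :: 'a wo_copy) \<le> y \<longleftrightarrow> Rep_wo_copy x \<le> Rep_wo_copy y"
definition "(x :: 'a wo_copy) < y \<longleftrightarrow> Rep_wo_copy x < Rep_wo_copy y"

instance
proof
  fix P :: "'a wo_copy \<Rightarrow> bool" and a :: "'a wo_copy"
  assume step: "\<And>x. (\<And>y. y < x \<Longrightarrow> P y) \<Longrightarrow> P x"
  show "P a"
  proof (induction a rule: measure_induct_rule[of Rep_wo_copy])
    case (less x)
    show ?case by (rule step, rule less.IH) (simp only: less_wo_copy_def)
  qed
next
  fix x y :: "'a wo_copy"
  assume "x \<le> y" "y \<le> x"
  then show "x = y" unfolding less_eq_wo_copy_def by (metis Rep_wo_copy_inject order_antisym)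
qed (unfold less_eq_wo_copy_def less_wo_copy_def, linarith+)

end

lemma CARD_wo_copy: "CARD('a::finite wo_copy) = CARD('a)"
  using type_definition.card[OF type_definition_wo_copy] by auto

text \<open>Real integrands enter the vector-valued theorem through \<open>real^1\<close>.
  Integrability and value are kept together in one equivalence with a free \<open>c\<close>, because
  the non-integrable case has to be read off from it later.\<close>

lemma change_of_variables_wo:
  fixes f :: "real^'m::{finite,wellorder} \<Rightarrow> real" and g :: "real^'m::_ \<Rightarrow> real^'m::_"
  assumes S: "S \<in> sets lebesgue"
    and der: "\<And>x. x \<in> S \<Longrightarrow> (g has_derivative g' x) (at x within S)"
    and inj: "inj_on g S"
  shows "set_integrable lebesgue S (\<lambda>x. \<bar>det (matrix (g' x))\<bar> * f (g x)) \<and>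
      (LINT x:S|lebesgue. \<bar>det (matrix (g' x))\<bar> * f (g x)) = c \<longleftrightarrow>
    set_integrable lebesgue (g ` S) f \<and> (LINT y:(g ` S)|lebesgue. f y) = c"
proof -
  have "(\<lambda>x. \<bar>det (matrix (g' x))\<bar> *\<^sub>R (vec (f (g x)) :: real^1)) absolutely_integrable_on S \<and>
           integral S (\<lambda>x. \<bar>det (matrix (g' x))\<bar> *\<^sub>R (vec (f (g x)) :: real^1)) = vec c
     \<longleftrightarrow> (\<lambda>y. vec (f y) :: real^1) absolutely_integrable_on (g ` S) \<and>
        integral (g ` S) (\<lambda>y. vec (f y) :: real^1) = vec c"
    using has_absolute_integral_change_of_variables[OF S der inj, of "\<lambda>y. vec (f y)" "vec c"] by blast
  then have *: "(\<lambda>x. \<bar>det (matrix (g' x))\<bar> * f (g x)) absolutely_integrable_on S \<and>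
           integral S (\<lambda>x. \<bar>det (matrix (g' x))\<bar> * f (g x)) = c
     \<longleftrightarrow> f absolutely_integrable_on (g ` S) \<and> integral (g ` S) f = c"
    by (simp add: absolutely_integrable_on_1_iff integral_on_1_eq vec_eq_iff cong: conj_cong)
  have eq: "set_integrable lebesgue U F \<and> (LINT x:U|lebesgue. F x) = c \<longleftrightarrow>
      set_integrable lebesgue U F \<and> integral U F = c" for U and F :: "real^'m::_ \<Rightarrow> real"
    by (rule conj_cong[OF refl]) (simp add: set_lebesgue_integral_eq_integral(2))
  show ?thesis unfolding eq by (rule *)
qed

text \<open>Conjugation of \<open>g\<close> with the relabelling onto the well-ordered copy changes
  neither Lebesgue integrals nor the Jacobian determinant.\<close>

lemma has_absolute_integral_change_of_variables_finite:
  fixes f :: "real^'m::finite \<Rightarrow> real" and g :: "real^'m \<Rightarrow> real^'m"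
  assumes S: "S \<in> sets lebesgue"
    and der: "\<And>x. x \<in> S \<Longrightarrow> (g has_derivative g' x) (at x within S)"
    and inj: "inj_on g S"
  shows "set_integrable lebesgue S (\<lambda>x. \<bar>det (matrix (g' x))\<bar> * f (g x)) \<and>
      (LINT x:S|lebesgue. \<bar>det (matrix (g' x))\<bar> * f (g x)) = c \<longleftrightarrow>
    set_integrable lebesgue (g ` S) f \<and> (LINT y:(g ` S)|lebesgue. f y) = c"
proof -
  obtain b :: "'m wo_copy \<Rightarrow> 'm" where b: "bij b"
    using finite_same_card_bij[of "UNIV :: 'm wo_copy set" "UNIV :: 'm set"] CARD_wo_copy
    by auto
  let ?T = "reindex b" and ?U = "reindex (inv b)"
  have bi: "bij (inv b)" using b by (rule bij_imp_bij_inv)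
  have iib: "inv (inv b) = b" using b by (rule inv_inv_eq)
  note UT = reindex_inv[OF b]
  have lin: "bounded_linear ?T" "bounded_linear ?U"
    using linear_reindex linear_conv_bounded_linear by blast+
  have transfer: "set_integrable lebesgue A F \<and> (LINT x:A|lebesgue. F x) = c \<longleftrightarrow>
    set_integrable lebesgue (?T ` A) (\<lambda>y. F (?U y)) \<and> (LINT y:(?T ` A)|lebesgue. F (?U y)) = c"
    for A and F :: "real^'m \<Rightarrow> real"
  proof
    assume "set_integrable lebesgue A F \<and> (LINT x:A|lebesgue. F x) = c"
    then show "set_integrable lebesgue (?T ` A) (\<lambda>y. F (?U y)) \<and> (LINT y:(?T ` A)|lebesgue. F (?U y)) = c"
      using set_integral_reindex[OF bi, of A F] by (simp add: iib)
  next
    assume "set_integrable lebesgue (?T ` A) (\<lambda>y. F (?U y)) \<and> (LINT y:(?T ` A)|lebesgue. F (?U y)) = c"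
    then show "set_integrable lebesgue A F \<and> (LINT x:A|lebesgue. F x) = c"
      using set_integral_reindex[OF b, of "?T ` A" "\<lambda>y. F (?U y)"] by (simp add: UT image_image)
  qed
  let ?g = "\<lambda>y. ?T (g (?U y))" and ?g' = "\<lambda>y h. ?T (g' (?U y) (?U h))"
  have SU: "?U y \<in> S" if "y \<in> ?T ` S" for y using that UT by auto
  have det: "det (matrix (?g' y)) = det (matrix (g' (?U y)))" for y
  proof -
    have iv: "inv b (b j) = j" "b (inv b i) = i" for i j
      using b by (simp_all add: bij_is_inj bij_is_surj surj_f_inv_f)
    have "?U (axis j 1) = axis (b j) 1" for j
      by (auto simp: reindex_def vec_eq_iff axis_def iv)
    then have "matrix (?g' y) = (\<chi> i j. matrix (g' (?U y)) $ b i $ b j)"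
      by (simp add: matrix_def vec_eq_iff reindex_def)
    then show ?thesis by (simp add: det_reindex[OF b])
  qed
  have "set_integrable lebesgue (?T ` S) (\<lambda>y. \<bar>det (matrix (?g' y))\<bar> * f (?U (?g y))) \<and>
      (LINT y:(?T ` S)|lebesgue. \<bar>det (matrix (?g' y))\<bar> * f (?U (?g y))) = c \<longleftrightarrow>
    set_integrable lebesgue (?g ` (?T ` S)) (\<lambda>y. f (?U y)) \<and>
      (LINT y:(?g ` (?T ` S))|lebesgue. f (?U y)) = c"
  proof (rule change_of_variables_wo)
    have "?T ` S = ?U -` S \<inter> space lebesgue"
    proof (intro equalityI subsetI)
      fix y assume "y \<in> ?U -` S \<inter> space lebesgue"
      then have "?T (?U y) \<in> ?T ` S" by blast
      then show "y \<in> ?T ` S" by (simp add: UT)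
    qed (use UT in auto)
    moreover have "?U \<in> lebesgue \<rightarrow>\<^sub>M lebesgue"
      using lebesgue_distr_basis(1)[OF bij_betw_Basis_reindex[OF bi]] by (simp add: reindex_eq_basis[OF bi])
    ultimately show "?T ` S \<in> sets lebesgue" using measurable_sets[OF _ S, of ?U lebesgue] by simp
    show "inj_on ?g (?T ` S)"
    proof (rule inj_onI)
      fix y z assume yz: "y \<in> ?T ` S" "z \<in> ?T ` S" "?g y = ?g z"
      then have "?U (?g y) = ?U (?g z)" by simp
      then have "g (?U y) = g (?U z)" by (simp only: UT)
      then have "?U y = ?U z" using inj SU[OF yz(1)] SU[OF yz(2)] by (auto dest: inj_onD)
      then have "?T (?U y) = ?T (?U z)" by simp
      then show "y = z" by (simp add: UT)
    qed
    fix y assume y: "y \<in> ?T ` S"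
    have "(g has_derivative g' (?U y)) (at (?U y) within ?U ` (?T ` S))"
      using der[OF SU[OF y]] by (simp add: image_image UT)
    from diff_chain_within[OF bounded_linear_imp_has_derivative[OF lin(2)] this]
    have "((g \<circ> ?U) has_derivative (g' (?U y) \<circ> ?U)) (at y within ?T ` S)" .
    from bounded_linear.has_derivative[OF lin(1) this]
    show "(?g has_derivative ?g' y) (at y within ?T ` S)" by (simp add: o_def)
  qed
  then show ?thesis
    unfolding transfer[of S] transfer[of "g ` S"] by (simp add: image_image UT det)
qed

text \<open>If one side is not integrable then neither is the other, and both integrals are 0 by
  convention; hence the equation is available for arbitrary integrands, as a surface integral
  requires.\<close>

lemma integral_change_of_variables_finite:
  fixes f :: "real^'m::finite \<Rightarrow> real" and g :: "real^'m \<Rightarrow> real^'m"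
  assumes S: "S \<in> sets lebesgue"
    and der: "\<And>x. x \<in> S \<Longrightarrow> (g has_derivative g' x) (at x within S)"
    and inj: "inj_on g S"
  shows "(LINT y:(g ` S)|lebesgue. f y) = (LINT x:S|lebesgue. \<bar>det (matrix (g' x))\<bar> * f (g x))"
proof -
  let ?h = "\<lambda>x. \<bar>det (matrix (g' x))\<bar> * f (g x)"
  have iff: "set_integrable lebesgue S ?h \<and> (LINT x:S|lebesgue. ?h x) = c \<longleftrightarrow>
      set_integrable lebesgue (g ` S) f \<and> (LINT y:(g ` S)|lebesgue. f y) = c" for c
    by (rule has_absolute_integral_change_of_variables_finite[OF S der inj])
  show ?thesis
  proof (cases "set_integrable lebesgue (g ` S) f")
    case True
    then show ?thesis using iff[of "LINT y:(g ` S)|lebesgue. f y"] by simp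
  next
    case False
    then have "\<not> set_integrable lebesgue S ?h" using iff by blast
    then have h0: "(LINT x:S|lebesgue. ?h x) = 0"
      unfolding set_integrable_def set_lebesgue_integral_def by (rule not_integrable_integral_eq)
    have "(LINT y:(g ` S)|lebesgue. f y) = 0"
      using False unfolding set_integrable_def set_lebesgue_integral_def by (rule not_integrable_integral_eq)
    with h0 show ?thesis by simp
  qed
qed

section \<open>Determinants\<close>

text \<open>The determinant as a function of a family of rows, so that replacing a row is function
  update.\<close>

definition rdet :: "('d::finite \<Rightarrow> real^'d) \<Rightarrow> real" where
  "rdet b = det (\<chi> i. b i)"

lemma rdet_expand: "rdet b = (\<Sum>p | p permutes UNIV. of_int (sign p) * (\<Prod>i\<in>UNIV. b i $ p i))"
  by (simp add: rdet_def det_def)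

text \<open>Product rule in each term of the Leibniz expansion; the differentiated factor is
  collected into an updated row.\<close>

lemma has_derivative_rdet:
  fixes b :: "'d::finite \<Rightarrow> 'a::real_normed_vector \<Rightarrow> real^'d"
  assumes b: "\<And>i. (b i has_derivative b' i) (at x within S)"
  shows "((\<lambda>x. rdet (\<lambda>i. b i x)) has_derivative
      (\<lambda>h. \<Sum>m\<in>UNIV. rdet ((\<lambda>i. b i x)(m := b' m h)))) (at x within S)"
proof -
  have c: "((\<lambda>x. b i x $ k) has_derivative (\<lambda>h. b' i h $ k)) (at x within S)" for i k
    using bounded_linear.has_derivative[OF bounded_linear_vec_nth b[of i]] .
  have d: "((\<lambda>x. \<Sum>p | p permutes UNIV. of_int (sign p) * (\<Prod>i\<in>UNIV. b i x $ p i)) has_derivative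
      (\<lambda>h. \<Sum>p | p permutes UNIV. of_int (sign p) *
         (\<Sum>m\<in>UNIV. b' m h $ p m * (\<Prod>j\<in>UNIV - {m}. b j x $ p j)))) (at x within S)"
    by (intro has_derivative_sum has_derivative_mult_right has_derivative_prod c)
  have pr: "b' m h $ p m * (\<Prod>j\<in>UNIV - {m}. b j x $ p j) =
      (\<Prod>i\<in>UNIV. ((\<lambda>i. b i x)(m := b' m h)) i $ p i)" for m h and p :: "'d \<Rightarrow> 'd"
    by (subst prod.remove[of UNIV m]) auto
  have "(\<Sum>p | p permutes UNIV. of_int (sign p) *
         (\<Sum>m\<in>UNIV. b' m h $ p m * (\<Prod>j\<in>UNIV - {m}. b j x $ p j))) =
      (\<Sum>m\<in>UNIV. rdet ((\<lambda>i. b i x)(m := b' m h)))" for h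
    unfolding rdet_expand pr sum_distrib_left by (rule sum.swap)
  with d show ?thesis by (simp add: rdet_expand)
qed

lemma continuous_on_rdet:
  assumes "\<And>i. continuous_on S (b i)"
  shows "continuous_on S (\<lambda>x. rdet (\<lambda>i. b i x))"
  unfolding rdet_expand using assms by (intro continuous_intros)

lemma rdet_swap:
  assumes "a \<noteq> c"
  shows "rdet (b(a := u, c := w)) = - rdet (b(a := w, c := u))"
proof -
  let ?p = "Transposition.transpose a c"
  have "det (\<chi> i. (\<chi> i. (b(a := w, c := u)) i) $ ?p i) =
      of_int (sign ?p) * det (\<chi> i. (b(a := w, c := u)) i)"
    by (rule det_permute_rows) (simp add: permutes_swap_id)
  moreover have "(\<chi> i. (\<chi> i. (b(a := w, c := u)) i) $ ?p i) = (\<chi> i. (b(a := u, c := w)) i)"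
    using assms by (auto simp: vec_eq_iff Transposition.transpose_def)
  ultimately show ?thesis using assms by (simp add: rdet_def sign_swap_id)
qed

text \<open>Cramer's rule. The columns of \<open>B\<close> appear as rows because the determinant is
  invariant under transposition.\<close>

lemma rdet_replace:
  fixes B :: "real^'d::finite^'d"
  shows "rdet ((\<lambda>m. column m B)(j := B *v y)) = y $ j * det B"
proof -
  let ?r = "(\<lambda>m. column m B)(j := B *v y)"
  have "rdet ?r = det (transpose (\<chi> i. ?r i))" by (simp only: rdet_def det_transpose)
  also have "transpose (\<chi> i. ?r i) = (\<chi> i k. if k = j then (B *v y) $ i else B $ i $ k)"
    by (simp add: vec_eq_iff transpose_def column_def)
  also have "det \<dots> = y $ j * det B" by (rule cramer_lemma)
  finally show ?thesis .
qed

lemma matrix_inv_det: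
  fixes B :: "real^'d::finite^'d"
  assumes "det B \<noteq> 0"
  shows "B ** matrix_inv B = mat 1" "matrix_inv B ** B = mat 1"
proof -
  have "\<exists>C. B ** C = mat 1 \<and> C ** B = mat 1"
    using assms invertible_det_nz[of B] by (simp add: invertible_def)
  then have "B ** matrix_inv B = mat 1 \<and> matrix_inv B ** B = mat 1"
    unfolding matrix_inv_def by (rule someI_ex)
  then show "B ** matrix_inv B = mat 1" "matrix_inv B ** B = mat 1" by auto
qed

text \<open>With \<open>M *v column j B\<close> written as \<open>B\<close> times a vector, Cramer's
  rule yields the diagonal entry \<open>j\<close> of \<open>matrix_inv B ** (M ** B)\<close>, and
  the trace is invariant under similarity. For \<open>M\<close> the gradient of a field, this turns
  the sum left by the Piola identity into divergence times Jacobian determinant.\<close>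

lemma rdet_trace:
  fixes B M :: "real^'d::finite^'d"
  assumes B: "det B \<noteq> 0"
  shows "(\<Sum>j\<in>UNIV. rdet ((\<lambda>m. column m B)(j := M *v column j B))) = trace M * det B"
proof -
  let ?I = "matrix_inv B"
  have inv: "B ** ?I = mat 1" "?I ** B = mat 1"
    using matrix_inv_det[OF B] by auto
  have "M *v column j B = B *v ((?I ** (M ** B)) *v axis j 1)" for j
  proof -
    have "B *v ((?I ** (M ** B)) *v axis j 1) = ((B ** ?I) ** (M ** B)) *v axis j 1"
      by (simp add: matrix_vector_mul_assoc matrix_mul_assoc)
    also have "\<dots> = M *v (B *v axis j 1)" by (simp add: inv matrix_vector_mul_assoc)
    finally show ?thesis by (simp add: matrix_vector_mult_basis)
  qed
  then have "rdet ((\<lambda>m. column m B)(j := M *v column j B)) = (?I ** (M ** B)) $ j $ j * det B" for j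
    by (simp add: rdet_replace) (simp add: matrix_vector_mult_basis column_def)
  then have "(\<Sum>j\<in>UNIV. rdet ((\<lambda>m. column m B)(j := M *v column j B))) = trace (?I ** (M ** B)) * det B"
    by (simp add: trace_def sum_distrib_right)
  also have "trace (?I ** (M ** B)) = trace M"
    by (subst trace_mul_sym) (simp add: matrix_mul_assoc[symmetric] inv)
  finally show ?thesis .
qed

text \<open>Expansion along row \<open>j\<close>, which is zero off the diagonal: permutations
  moving \<open>j\<close> contribute nothing, and the others are permutations of the remaining
  indices, which \<open>\<beta>\<close> enumerates.\<close>

lemma det_border:
  fixes A :: "real^'d::finite^'d" and \<beta> :: "'e::finite \<Rightarrow> 'd"
  assumes \<beta>: "bij_betw \<beta> UNIV (UNIV - {j})"
    and A1: "A $ j $ j = 1" and A0: "\<And>k. k \<noteq> j \<Longrightarrow> A $ j $ k = 0"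
  shows "det A = det (\<chi> a b. A $ \<beta> a $ \<beta> b)"
proof -
  let ?U = "UNIV :: 'd set" and ?V = "UNIV - {j}"
  let ?i = "inv_into UNIV \<beta>"
  have inj: "inj \<beta>" and im: "\<beta> ` UNIV = ?V" using \<beta> by (auto simp: bij_betw_def)
  have \<beta>i: "bij_betw ?i ?V UNIV" using \<beta> by (rule bij_betw_inv_into)
  have bi: "\<beta> (?i k) = k" if "k \<noteq> j" for k using that \<beta> by (simp add: bij_betw_inv_into_right)
  have ib: "?i (\<beta> a) = a" for a using inj by simp
  have "det A = (\<Sum>p | p permutes ?U. of_int (sign p) * (\<Prod>i\<in>UNIV. A $ i $ p i))"
    by (simp add: det_def)
  also have "\<dots> = (\<Sum>p | p permutes ?V. of_int (sign p) * (\<Prod>i\<in>UNIV. A $ i $ p i))"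
  proof (rule sum.mono_neutral_right)
    show "finite {p. p permutes ?U}" by (simp add: finite_permutations)
    show "{p. p permutes ?V} \<subseteq> {p. p permutes ?U}"
    proof
      fix p assume "p \<in> {p. p permutes ?V}"
      then have "p permutes ?V" by simp
      then have "p permutes ?U" by (rule permutes_subset) simp
      then show "p \<in> {p. p permutes ?U}" by simp
    qed
    show "\<forall>p\<in>{p. p permutes ?U} - {p. p permutes ?V}. of_int (sign p) * (\<Prod>i\<in>UNIV. A $ i $ p i) = 0"
    proof
      fix p assume p: "p \<in> {p. p permutes ?U} - {p. p permutes ?V}"
      have p1: "p permutes ?U" and p2: "\<not> p permutes ?V" using p by blast+
      have "p j \<noteq> j"
      proof
        assume pj: "p j = j"
        have "p permutes ?V"
        proof (rule permutes_superset[OF p1])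
          fix x assume "x \<in> ?U - ?V"
          then have "x = j" by blast
          with pj show "p x = x" by simp
        qed
        with p2 show False by contradiction
      qed
      then have "A $ j $ p j = 0" by (rule A0)
      then have "(\<Prod>i\<in>UNIV. A $ i $ p i) = 0" by (intro prod_zero) auto
      then show "of_int (sign p) * (\<Prod>i\<in>UNIV. A $ i $ p i) = 0" by simp
    qed
  qed
  also have "\<dots> = (\<Sum>p | p permutes (UNIV :: 'e set). of_int (sign p) * (\<Prod>a\<in>UNIV. A $ \<beta> a $ \<beta> (p a)))"
  proof (rule sum.reindex_bij_witness[where i = "map_permutation UNIV \<beta>" and j = "map_permutation ?V ?i"])
    fix q assume "q \<in> {q. q permutes ?V}"
    then have q: "q permutes ?V" by simp
    show "map_permutation UNIV \<beta> (map_permutation ?V ?i q) = q"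
      using q bi by (intro map_permutation_compose_inv[OF \<beta>i]) auto
    show "map_permutation ?V ?i q \<in> {p. p permutes UNIV}"
      using map_permutation_permutes[OF \<beta>i q] by auto
    have s: "sign (map_permutation ?V ?i q) = sign q"
      using q \<beta>i by (intro sign_map_permutation) (auto simp: bij_betw_def)
    have ap: "\<beta> (map_permutation ?V ?i q a) = q (\<beta> a)" for a
    proof -
      have bV: "\<beta> a \<in> ?V" using im by auto
      have "map_permutation ?V ?i q (?i (\<beta> a)) = ?i (q (\<beta> a))"
        using \<beta>i bV by (intro map_permutation_apply) (auto simp: bij_betw_def)
      moreover have "q (\<beta> a) \<in> ?V" using permutes_in_image[OF q] bV by blast
      ultimately show ?thesis by (simp add: ib bi)
    qed
    have qj: "q j = j" using q by (auto simp: permutes_def)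
    have "(\<Prod>i\<in>UNIV. A $ i $ q i) = A $ j $ q j * (\<Prod>i\<in>?V. A $ i $ q i)"
      by (rule prod.remove) auto
    also have "\<dots> = (\<Prod>a\<in>UNIV. A $ \<beta> a $ q (\<beta> a))"
      using prod.reindex_bij_betw[OF \<beta>, of "\<lambda>i. A $ i $ q i"] by (simp add: qj A1)
    finally show "of_int (sign (map_permutation ?V ?i q)) *
        (\<Prod>a\<in>UNIV. A $ \<beta> a $ \<beta> (map_permutation ?V ?i q a)) =
        of_int (sign q) * (\<Prod>i\<in>UNIV. A $ i $ q i)" by (simp add: s ap)
  next
    fix p assume "p \<in> {p. p permutes (UNIV::'e set)}"
    then have p: "p permutes UNIV" by simp
    show "map_permutation ?V ?i (map_permutation UNIV \<beta> p) = p"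
      using p ib by (intro map_permutation_compose_inv[OF \<beta>]) auto
    show "map_permutation UNIV \<beta> p \<in> {q. q permutes ?V}"
      using map_permutation_permutes[OF \<beta> p] by auto
  qed
  also have "\<dots> = det (\<chi> a b. A $ \<beta> a $ \<beta> b)" by (simp add: det_def)
  finally show ?thesis .
qed

text \<open>Meant for \<open>\<beta>\<close> a bijection onto the indices other than
  \<open>j\<close>: the tangent vectors \<open>l\<close> of a face are completed by one transversal
  vector \<open>c\<close> to a square family.\<close>

definition insert_row :: "('e::finite \<Rightarrow> 'd::finite) \<Rightarrow> 'd \<Rightarrow> ('e \<Rightarrow> real^'d) \<Rightarrow> real^'d \<Rightarrow> 'd \<Rightarrow> real^'d" where
  "insert_row \<beta> j l c m = (if m = j then c else l (inv_into UNIV \<beta> m))"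

lemma insert_row_simps:
  assumes \<beta>: "bij_betw \<beta> UNIV (UNIV - {j})"
  shows "insert_row \<beta> j l c j = c" "insert_row \<beta> j l c (\<beta> a) = l a"
  using assms by (auto simp: insert_row_def bij_betw_def)

text \<open>For the matrix \<open>Q\<close> with these rows, the product of \<open>Q\<close> and its
  transpose splits into the entry 1 of the unit normal and the Gram matrix of the tangents, while
  its determinant is the square of that of \<open>Q\<close>.\<close>

lemma rdet_gram:
  assumes \<beta>: "bij_betw \<beta> UNIV (UNIV - {j})"
    and n: "n \<bullet> n = 1" and orth: "\<And>a. l a \<bullet> n = 0"
  shows "(rdet (insert_row \<beta> j l n))\<^sup>2 = det (\<chi> a b. l a \<bullet> l b)"
proof -
  note [simp] = insert_row_simps[OF \<beta>]
  let ?r = "insert_row \<beta> j l n" and ?Q = "\<chi> i. insert_row \<beta> j l n i"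
  have G: "(?Q ** transpose ?Q) $ i $ k = ?r i \<bullet> ?r k" for i k
    by (simp add: matrix_matrix_mult_def transpose_def inner_vec_def)
  have "?r j \<bullet> ?r k = 0" if "k \<noteq> j" for k
    using that orth by (simp add: insert_row_def inner_commute)
  then have "det (?Q ** transpose ?Q) = det (\<chi> a b. (?Q ** transpose ?Q) $ \<beta> a $ \<beta> b)"
    by (intro det_border[OF \<beta>]) (simp_all add: G n)
  then show ?thesis by (simp only: G) (simp add: det_mul power2_eq_square rdet_def)
qed

lemma inner_transpose_mult:
  fixes A :: "real^'d::finite^'n::finite"
  shows "(transpose A *v y) \<bullet> x = y \<bullet> (A *v x)"
  by (simp add: transpose_matrix_vector dot_lmul_matrix)

text \<open>Nanson's formula. The assumption \<open>l\<close> says that \<open>\<nu>\<close> is, up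
  to sign, the generalized cross product of the reference tangents. The tangents
  \<open>B *v l a\<close> together with the unit normal \<open>n\<close> form the image under
  \<open>B\<close> of the reference tangents and \<open>matrix_inv B *v n\<close>; taking
  determinants gives \<open>\<bar>det B\<bar>\<close> times the component of
  \<open>matrix_inv B *v n\<close> along \<open>\<nu>\<close>, which is
  \<open>norm N\<close>.\<close>

lemma sqrt_gram_normal:
  fixes B :: "real^'d::finite^'d" and \<beta> :: "'e::finite \<Rightarrow> 'd"
  assumes \<beta>: "bij_betw \<beta> UNIV (UNIV - {j})" and B: "det B \<noteq> 0"
    and \<nu>: "\<nu> \<noteq> 0" and l: "\<And>c. \<bar>rdet (insert_row \<beta> j l c)\<bar> = \<bar>c \<bullet> \<nu>\<bar>"
  defines "N \<equiv> transpose (matrix_inv B) *v \<nu>"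
  shows "sqrt (det (\<chi> a b. (B *v l a) \<bullet> (B *v l b))) = norm N * \<bar>det B\<bar>" "N \<noteq> 0"
proof -
  let ?I = "matrix_inv B"
  have inv: "B ** ?I = mat 1" "?I ** B = mat 1"
    using matrix_inv_det[OF B] by auto
  have NB: "N \<bullet> (B *v x) = \<nu> \<bullet> x" for x
    by (simp only: N_def inner_transpose_mult matrix_vector_mul_assoc inv matrix_vector_mul_lid)
  show N0: "N \<noteq> 0"
  proof
    assume "N = 0"
    then have "\<nu> \<bullet> \<nu> = 0" using NB[of \<nu>] by simp
    then show False using \<nu> by simp
  qed
  \<comment> \<open>Inserting a tangent as the extra vector produces two equal rows, so the
    assumption \<open>l\<close> makes each tangent orthogonal to \<open>\<nu>\<close>.\<close>
  have l\<nu>: "l a \<bullet> \<nu> = 0" for a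
  proof -
    have "\<beta> a \<noteq> j" using \<beta> by (auto simp: bij_betw_def)
    then have "det (\<chi> i. insert_row \<beta> j l (l a) i) = 0"
      by (intro det_identical_rows[of "\<beta> a" j]) (auto simp: row_def vec_eq_iff insert_row_simps[OF \<beta>])
    then show ?thesis using l[of "l a"] by (simp add: rdet_def)
  qed
  define n where "n = N /\<^sub>R norm N"
  have n1: "n \<bullet> n = 1" using N0 by (simp add: n_def dot_square_norm power2_eq_square)
  have orth: "(B *v l a) \<bullet> n = 0" for a
    using NB[of "l a"] l\<nu>[of a] by (simp add: n_def inner_commute)
  have "(\<chi> i. insert_row \<beta> j (\<lambda>a. B *v l a) n i) = (\<chi> i. insert_row \<beta> j l (?I *v n) i) ** transpose B"
  proof -
    have "insert_row \<beta> j (\<lambda>a. B *v l a) n i = B *v insert_row \<beta> j l (?I *v n) i" for i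
      by (simp add: insert_row_def matrix_vector_mul_assoc inv)
    then show ?thesis
      by (simp add: vec_eq_iff matrix_matrix_mult_def matrix_vector_mult_def transpose_def mult.commute)
  qed
  then have "\<bar>rdet (insert_row \<beta> j (\<lambda>a. B *v l a) n)\<bar> = \<bar>rdet (insert_row \<beta> j l (?I *v n))\<bar> * \<bar>det B\<bar>"
    by (simp add: rdet_def det_mul abs_mult)
  also have "\<bar>rdet (insert_row \<beta> j l (?I *v n))\<bar> = \<bar>(?I *v n) \<bullet> \<nu>\<bar>" by (rule l)
  also have "(?I *v n) \<bullet> \<nu> = N \<bullet> n" using inner_transpose_mult[of ?I \<nu> n] by (simp only: N_def inner_commute)
  also have "N \<bullet> n = norm N" using N0 by (simp add: n_def dot_square_norm power2_eq_square)
  finally have "\<bar>rdet (insert_row \<beta> j (\<lambda>a. B *v l a) n)\<bar> = norm N * \<bar>det B\<bar>" by simp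
  then show "sqrt (det (\<chi> a b. (B *v l a) \<bullet> (B *v l b))) = norm N * \<bar>det B\<bar>"
    by (simp flip: rdet_gram[OF \<beta> n1 orth])
qed

lemma rdet_insert_row_axis:
  assumes \<beta>: "bij_betw \<beta> UNIV (UNIV - {j})"
  shows "rdet (insert_row \<beta> j (\<lambda>a. axis (\<beta> a) 1) c) = c $ j"
proof -
  have "insert_row \<beta> j (\<lambda>a. axis (\<beta> a) 1) c = (\<lambda>m. column m (mat 1))(j := c)"
    using \<beta> by (auto simp: fun_eq_iff insert_row_def vec_eq_iff column_def mat_def axis_def bij_betw_inv_into_right)
  then show ?thesis using rdet_replace[of "mat 1" j c] by simp
qed

text \<open>The matrix \<open>B0\<close> with column \<open>axis j 1\<close> at \<open>j\<close> and
  \<open>axis m 1 - axis j 1\<close> at the other \<open>m\<close> has determinant 1. The solution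
  \<open>y\<close> of \<open>B0 *v y = c\<close> has the coordinate sum of \<open>c\<close> at place
  \<open>j\<close>, and Cramer's rule reads it off.\<close>

lemma rdet_insert_row_slant:
  fixes \<beta> :: "'e::finite \<Rightarrow> 'd::finite"
  assumes \<beta>: "bij_betw \<beta> UNIV (UNIV - {j})"
  shows "rdet (insert_row \<beta> j (\<lambda>a. axis (\<beta> a) 1 - axis j 1) c) = (\<Sum>i\<in>UNIV. c $ i)"
proof -
  define B0 :: "real^'d^'d" where "B0 = (\<chi> i m. if m = j then (if i = j then 1 else 0) else (if i = m then 1 else 0) - (if i = j then 1 else 0))"
  define y :: "real^'d" where "y = (\<chi> m. if m = j then \<Sum>i\<in>UNIV. c $ i else c $ m)"
  have col: "column m B0 = (if m = j then axis j 1 else axis m 1 - axis j 1)" for m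
    by (auto simp: column_def B0_def axis_def vec_eq_iff)
  have "(B0 *v y) $ i = c $ i" for i
  proof -
    have S: "(\<Sum>k\<in>UNIV. c $ k) = c $ j + (\<Sum>k\<in>UNIV - {j}. c $ k)" by (rule sum.remove) auto
    have "(B0 *v y) $ i = B0 $ i $ j * y $ j + (\<Sum>m\<in>UNIV - {j}. B0 $ i $ m * y $ m)"
      unfolding matrix_vector_mult_def by (simp add: sum.remove[of UNIV j])
    also have "(\<Sum>m\<in>UNIV - {j}. B0 $ i $ m * y $ m) =
        (\<Sum>m\<in>UNIV - {j}. (if i = m then c $ m else 0) - (if i = j then 1 else 0) * c $ m)"
      by (intro sum.cong) (auto simp: B0_def y_def)
    also have "\<dots> = (if i = j then 0 else c $ i) - (if i = j then 1 else 0) * (\<Sum>m\<in>UNIV - {j}. c $ m)"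
      by (simp add: sum_subtractf sum_distrib_left)
    finally show ?thesis by (simp add: B0_def y_def S)
  qed
  then have B0y: "B0 *v y = c" by (simp add: vec_eq_iff)
  have "det (transpose B0) = det (\<chi> a b. transpose B0 $ \<beta> a $ \<beta> b)"
    by (rule det_border[OF \<beta>]) (auto simp: transpose_def B0_def)
  also have "(\<chi> a b. transpose B0 $ \<beta> a $ \<beta> b) = mat 1"
    using \<beta> by (auto simp: transpose_def B0_def mat_def vec_eq_iff bij_betw_def inj_eq)
  finally have d: "det B0 = 1" by simp
  have "insert_row \<beta> j (\<lambda>a. axis (\<beta> a) 1 - axis j 1) c = (\<lambda>m. column m B0)(j := B0 *v y)"
    using \<beta> by (auto simp: fun_eq_iff insert_row_def col B0y bij_betw_inv_into_right)
  then show ?thesis using rdet_replace[of B0 j y] by (simp add: d y_def)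
qed

section \<open>Piola identity and the fundamental theorem on the simplex\<close>

lemma has_derivative_line:
  fixes g :: "'a::real_normed_vector \<Rightarrow> real"
  assumes "(g has_derivative g') (at (p + s *\<^sub>R a))"
  shows "((\<lambda>s. g (p + s *\<^sub>R a)) has_real_derivative g' a) (at s)"
proof -
  have l: "((\<lambda>s. p + s *\<^sub>R a) has_derivative (\<lambda>h. h *\<^sub>R a)) (at s)"
    by (auto intro!: derivative_eq_intros)
  have "((\<lambda>s. g (p + s *\<^sub>R a)) has_derivative (\<lambda>h. g' (h *\<^sub>R a))) (at s)"
    using has_derivative_compose[OF l assms] .
  moreover have "g' (h *\<^sub>R a) = h * g' a" for h
    using assms has_derivative_bounded_linear linear_simps(5) by fastforce
  ultimately show ?thesis by (simp add: has_field_derivative_def mult.commute[of _ "g' a"])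
qed

text \<open>The mean value theorem is applied twice, along \<open>a\<close> to the increment in
  direction \<open>b\<close>, then along \<open>b\<close> to the derivative in direction
  \<open>a\<close>. The left side is symmetric in \<open>a\<close> and \<open>b\<close>, which is
  what makes the two mixed derivatives comparable.\<close>

lemma second_difference:
  fixes f :: "'a::real_normed_vector \<Rightarrow> real"
  assumes h: "h > 0"
    and U: "\<And>s t. 0 \<le> s \<Longrightarrow> s \<le> h \<Longrightarrow> 0 \<le> t \<Longrightarrow> t \<le> h \<Longrightarrow> x + s *\<^sub>R a + t *\<^sub>R b \<in> U"
    and f: "\<And>y. y \<in> U \<Longrightarrow> (f has_derivative f' y) (at y)"
    and fa: "\<And>y. y \<in> U \<Longrightarrow> ((\<lambda>y. f' y a) has_derivative fa' y) (at y)"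
  obtains s t where "0 < s" "s < h" "0 < t" "t < h"
    "f (x + h *\<^sub>R a + h *\<^sub>R b) - f (x + h *\<^sub>R a) - f (x + h *\<^sub>R b) + f x = h * h * fa' (x + s *\<^sub>R a + t *\<^sub>R b) b"
proof -
  have "DERIV (\<lambda>s. f ((x + h *\<^sub>R b) + s *\<^sub>R a) - f (x + s *\<^sub>R a)) s :>
      f' ((x + h *\<^sub>R b) + s *\<^sub>R a) a - f' (x + s *\<^sub>R a) a" if "0 \<le> s" "s \<le> h" for s
    using U[of s h] U[of s 0] that h
    by (intro DERIV_diff has_derivative_line f) (auto simp: algebra_simps)
  from MVT2[OF h this] obtain s where s: "0 < s" "s < h" and
    1: "f ((x + h *\<^sub>R b) + h *\<^sub>R a) - f (x + h *\<^sub>R a) - (f (x + h *\<^sub>R b) - f x) =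
      h * (f' ((x + h *\<^sub>R b) + s *\<^sub>R a) a - f' (x + s *\<^sub>R a) a)"
    by auto
  have "DERIV (\<lambda>t. f' ((x + s *\<^sub>R a) + t *\<^sub>R b) a) t :> fa' ((x + s *\<^sub>R a) + t *\<^sub>R b) b"
    if "0 \<le> t" "t \<le> h" for t
    using U[of s t] that s by (intro has_derivative_line fa) auto
  from MVT2[OF h this] obtain t where t: "0 < t" "t < h" and
    2: "f' ((x + s *\<^sub>R a) + h *\<^sub>R b) a - f' (x + s *\<^sub>R a) a = h * fa' ((x + s *\<^sub>R a) + t *\<^sub>R b) b"
    by auto
  have 3: "(x + h *\<^sub>R b) + s *\<^sub>R a = (x + s *\<^sub>R a) + h *\<^sub>R b"
    "(x + h *\<^sub>R b) + h *\<^sub>R a = (x + h *\<^sub>R a) + h *\<^sub>R b" by (simp_all add: algebra_simps)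
  show thesis
    by (rule that[OF s t]) (use 1 2 in \<open>simp add: 3\<close>)
qed

text \<open>One and the same second difference equals \<open>h * h\<close> times either mixed
  derivative at some nearby point; by continuity both values are within \<open>e\<close> of their
  values at \<open>x\<close>, which cannot differ by \<open>2 * e\<close>.\<close>

lemma mixed_partials_commute:
  fixes f :: "'a::real_normed_vector \<Rightarrow> real"
  assumes U: "open U" "x \<in> U"
    and f: "\<And>y. y \<in> U \<Longrightarrow> (f has_derivative f' y) (at y)"
    and fa: "\<And>y. y \<in> U \<Longrightarrow> ((\<lambda>y. f' y a) has_derivative fa' y) (at y)"
    and fb: "\<And>y. y \<in> U \<Longrightarrow> ((\<lambda>y. f' y b) has_derivative fb' y) (at y)"
    and ca: "continuous_on U (\<lambda>y. fa' y b)" and cb: "continuous_on U (\<lambda>y. fb' y a)"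
  shows "fa' x b = fb' x a"
proof (rule ccontr)
  assume "fa' x b \<noteq> fb' x a"
  define e where "e = \<bar>fa' x b - fb' x a\<bar> / 2"
  have e: "e > 0" using \<open>fa' x b \<noteq> fb' x a\<close> by (simp add: e_def)
  have ia: "isCont (\<lambda>y. fa' y b) x" and ib: "isCont (\<lambda>y. fb' y a) x"
    using ca cb U by (auto simp: continuous_on_eq_continuous_at)
  obtain r1 where r1: "r1 > 0" "\<And>y. dist y x < r1 \<Longrightarrow> dist (fa' y b) (fa' x b) < e"
    using ia e unfolding continuous_at_eps_delta by metis
  obtain r2 where r2: "r2 > 0" "\<And>y. dist y x < r2 \<Longrightarrow> dist (fb' y a) (fb' x a) < e"
    using ib e unfolding continuous_at_eps_delta by metis
  obtain r3 where r3: "r3 > 0" "ball x r3 \<subseteq> U" using U open_contains_ball by blast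
  define r where "r = min r1 (min r2 r3)"
  have r: "r > 0" using r1 r2 r3 by (simp add: r_def)
  \<comment> \<open>All points \<open>x + s *\<^sub>R a + t *\<^sub>R b\<close> with
    \<open>s\<close> and \<open>t\<close> up to \<open>h\<close> must stay within \<open>r\<close>
    of \<open>x\<close>; the summand 1 keeps the denominator positive when \<open>a\<close> and
    \<open>b\<close> vanish.\<close>
  define h where "h = r / (2 * (norm a + norm b + 1))"
  have h: "h > 0" using r by (simp add: h_def add_nonneg_pos)
  have hr: "h * (norm a + norm b) < r"
  proof -
    have "h * (norm a + norm b) \<le> h * (norm a + norm b + 1)" using h by (intro mult_left_mono) auto
    also have "\<dots> = r / 2"
    proof -
      have "norm a + norm b + 1 > 0" by (simp add: add_nonneg_pos)
      then show ?thesis by (simp add: h_def field_simps)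
    qed
    finally show ?thesis using r by simp
  qed
  have d: "dist (x + s *\<^sub>R a + t *\<^sub>R b) x < r" if "0 \<le> s" "s \<le> h" "0 \<le> t" "t \<le> h" for s t
  proof -
    have "dist (x + s *\<^sub>R a + t *\<^sub>R b) x = norm (s *\<^sub>R a + t *\<^sub>R b)" by (simp add: dist_norm algebra_simps)
    also have "\<dots> \<le> s * norm a + t * norm b" using that norm_triangle_ineq[of "s *\<^sub>R a" "t *\<^sub>R b"] by simp
    also have "\<dots> \<le> h * norm a + h * norm b" using that by (intro add_mono mult_right_mono) auto
    finally show ?thesis using hr by (simp add: algebra_simps)
  qed
  have inU: "x + s *\<^sub>R a + t *\<^sub>R b \<in> U" if "0 \<le> s" "s \<le> h" "0 \<le> t" "t \<le> h" for s t
    using d[OF that] r3 by (auto simp: r_def subset_iff dist_commute)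
  have inU': "x + s *\<^sub>R b + t *\<^sub>R a \<in> U" if "0 \<le> s" "s \<le> h" "0 \<le> t" "t \<le> h" for s t
    using inU[of t s] that by (simp add: add_ac)
  obtain s t where st: "0 < s" "s < h" "0 < t" "t < h" and
    1: "f (x + h *\<^sub>R a + h *\<^sub>R b) - f (x + h *\<^sub>R a) - f (x + h *\<^sub>R b) + f x = h * h * fa' (x + s *\<^sub>R a + t *\<^sub>R b) b"
    by (rule second_difference[where f = f and x = x and h = h and a = a and b = b and U = U, OF h inU f fa]) auto
  obtain s' t' where st': "0 < s'" "s' < h" "0 < t'" "t' < h" and
    2: "f (x + h *\<^sub>R b + h *\<^sub>R a) - f (x + h *\<^sub>R b) - f (x + h *\<^sub>R a) + f x = h * h * fb' (x + s' *\<^sub>R b + t' *\<^sub>R a) a"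
    by (rule second_difference[where f = f and x = x and h = h and a = b and b = a and U = U, OF h inU' f fb]) auto
  have "h * h * fa' (x + s *\<^sub>R a + t *\<^sub>R b) b = h * h * fb' (x + s' *\<^sub>R b + t' *\<^sub>R a) a"
  proof -
    have "x + h *\<^sub>R b + h *\<^sub>R a = x + h *\<^sub>R a + h *\<^sub>R b" by (simp add: add_ac)
    with 2 have "f (x + h *\<^sub>R a + h *\<^sub>R b) - f (x + h *\<^sub>R b) - f (x + h *\<^sub>R a) + f x =
      h * h * fb' (x + s' *\<^sub>R b + t' *\<^sub>R a) a" by simp
    with 1 show ?thesis by linarith
  qed
  then have eq: "fa' (x + s *\<^sub>R a + t *\<^sub>R b) b = fb' (x + s' *\<^sub>R b + t' *\<^sub>R a) a" using h by simp
  have "dist (fa' (x + s *\<^sub>R a + t *\<^sub>R b) b) (fa' x b) < e"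
    using d[of s t] st by (intro r1) (auto simp: r_def)
  moreover have "dist (fb' (x + s' *\<^sub>R b + t' *\<^sub>R a) a) (fb' x a) < e"
    using d[of t' s'] st' by (intro r2) (auto simp: r_def add_ac)
  ultimately have "\<bar>fa' x b - fb' x a\<bar> < 2 * e" using eq by (simp add: dist_real_def)
  then show False by (simp add: e_def)
qed

section \<open>Symmetry of second derivatives and the Piola identity\<close>

abbreviation fderiv :: "('a::real_normed_vector \<Rightarrow> 'b::real_normed_vector) \<Rightarrow> 'a \<Rightarrow> 'a \<Rightarrow> 'b" where
  "fderiv f x \<equiv> frechet_derivative f (at x)"

lemma Ck_on_has_derivative:
  assumes U: "open U" "x \<in> U" and f: "Ck_on (Suc m) f U"
  shows "(f has_derivative fderiv f x) (at x)"
proof -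
  have "f differentiable_on U" using f by simp
  then have "f differentiable (at x within U)" using U by (simp add: differentiable_on_def)
  then have "f differentiable (at x)" by (simp only: at_within_open[OF U(2,1)])
  then show ?thesis by (simp add: frechet_derivative_works)
qed

lemma Ck_on_2D:
  assumes U: "open U" and f: "Ck_on 2 f U"
  shows "x \<in> U \<Longrightarrow> (f has_derivative fderiv f x) (at x)"
    "x \<in> U \<Longrightarrow> ((\<lambda>x. fderiv f x h) has_derivative fderiv (\<lambda>x. fderiv f x h) x) (at x)"
    "continuous_on U (\<lambda>x. fderiv (\<lambda>x. fderiv f x h) x k)"
    "continuous_on U (\<lambda>x. fderiv f x h)"
proof -
  have 2: "Ck_on (Suc (Suc 0)) f U" using f by (simp add: numeral_2_eq_2)
  then have 1: "Ck_on (Suc 0) (\<lambda>x. fderiv f x h) U" for h by auto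
  show "x \<in> U \<Longrightarrow> (f has_derivative fderiv f x) (at x)" by (rule Ck_on_has_derivative[OF U _ 2])
  show d: "x \<in> U \<Longrightarrow> ((\<lambda>x. fderiv f x h) has_derivative fderiv (\<lambda>x. fderiv f x h) x) (at x)" for x
    by (rule Ck_on_has_derivative[OF U _ 1])
  show "continuous_on U (\<lambda>x. fderiv (\<lambda>x. fderiv f x h) x k)" using 1[of h] by auto
  show "continuous_on U (\<lambda>x. fderiv f x h)"
    using 1[of h] by (auto intro: differentiable_imp_continuous_on)
qed

lemma Ck_on_2_mixed_partials:
  fixes f :: "'a::real_normed_vector \<Rightarrow> real^'d::finite"
  assumes U: "open U" "x \<in> U" and f: "Ck_on 2 f U"
  shows "fderiv (\<lambda>x. fderiv f x a) x b = fderiv (\<lambda>x. fderiv f x b) x a"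
proof -
  note D = Ck_on_2D[OF U(1) f]
  have nth: "((\<lambda>x. g x $ i) has_derivative (\<lambda>h. g' h $ i)) (at y)" if "(g has_derivative g') (at y)"
    for g g' y and i :: 'd
    using bounded_linear.has_derivative[OF bounded_linear_vec_nth that] .
  have cnth: "continuous_on U (\<lambda>x. g x $ i)" if "continuous_on U g" for g :: "'a \<Rightarrow> real^'d" and i
    using that by (rule continuous_on_component)
  have "fderiv (\<lambda>x. fderiv f x a) x b $ i = fderiv (\<lambda>x. fderiv f x b) x a $ i" for i
  proof (rule mixed_partials_commute[OF U, where f = "\<lambda>x. f x $ i" and f' = "\<lambda>y h. fderiv f y h $ i"
        and fa' = "\<lambda>y h. fderiv (\<lambda>x. fderiv f x a) y h $ i" and fb' = "\<lambda>y h. fderiv (\<lambda>x. fderiv f x b) y h $ i"])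
    fix y assume y: "y \<in> U"
    show "((\<lambda>x. f x $ i) has_derivative (\<lambda>h. fderiv f y h $ i)) (at y)" by (rule nth[OF D(1)[OF y]])
    show "((\<lambda>y. fderiv f y a $ i) has_derivative (\<lambda>h. fderiv (\<lambda>x. fderiv f x a) y h $ i)) (at y)"
      by (rule nth[OF D(2)[OF y]])
    show "((\<lambda>y. fderiv f y b $ i) has_derivative (\<lambda>h. fderiv (\<lambda>x. fderiv f x b) y h $ i)) (at y)"
      by (rule nth[OF D(2)[OF y]])
  next
    show "continuous_on U (\<lambda>y. fderiv (\<lambda>x. fderiv f x a) y b $ i)"
      "continuous_on U (\<lambda>y. fderiv (\<lambda>x. fderiv f x b) y a $ i)"
      by (rule cnth[OF D(3)])+
  qed
  then show ?thesis by (simp add: vec_eq_iff)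
qed

text \<open>In the derivative of the determinant, differentiating the inserted field gives the
  stated right side; the remaining terms contain second derivatives of \<open>\<Phi>\<close> and
  cancel in pairs. Continuity of \<open>G'\<close> is delivered as well because the fundamental
  theorem on the simplex consumes it.\<close>

lemma piola:
  fixes \<Phi> F :: "real^'d::finite \<Rightarrow> real^'d"
  assumes U: "open U" and \<Phi>: "Ck_on 2 \<Phi> U"
    and F: "\<And>x. x \<in> U \<Longrightarrow> (F has_derivative F' x) (at x)"
    and F': "\<And>h. continuous_on U (\<lambda>x. F' x h)"
  defines "b \<equiv> \<lambda>m x. fderiv \<Phi> x (axis m 1)"
  obtains G' where
    "\<And>j x. x \<in> U \<Longrightarrow> ((\<lambda>x. rdet ((\<lambda>m. b m x)(j := F x))) has_derivative G' j x) (at x)"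
    "\<And>j h. continuous_on U (\<lambda>x. G' j x h)"
    "\<And>x. x \<in> U \<Longrightarrow> (\<Sum>j\<in>UNIV. G' j x (axis j 1)) =
       (\<Sum>j\<in>UNIV. rdet ((\<lambda>m. b m x)(j := F' x (axis j 1))))"
proof -
  note D = Ck_on_2D[OF U \<Phi>]
  define b' where "b' m x = fderiv (b m) x" for m x
  have b: "(b m has_derivative b' m x) (at x)" if "x \<in> U" for m x
    unfolding b_def b'_def using D(2)[OF that] .
  have cb': "continuous_on U (\<lambda>x. b' m x h)" for m h
    unfolding b_def b'_def by (rule D(3))
  have cb: "continuous_on U (b m)" for m
    unfolding b_def by (rule D(4))
  have cF: "continuous_on U F"
    using F by (intro has_derivative_continuous_on[where f' = F']) (auto intro: has_derivative_at_withinI)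
  define c where "c j i x = (if i = j then F x else b i x)" for j i x
  define c' where "c' j i x = (if i = j then F' x else b' i x)" for j i x
  define G' where "G' j x h = (\<Sum>m\<in>UNIV. rdet ((\<lambda>i. c j i x)(m := c' j m x h)))" for j x h
  have upd: "(\<lambda>m. b m x)(j := F x) = (\<lambda>i. c j i x)" for j x by (auto simp: c_def)
  have cd: "(c j i has_derivative c' j i x) (at x)" if "x \<in> U" for i j x
    unfolding c_def c'_def using b[OF that] F[OF that] by auto
  show thesis
  proof (rule that[of G'])
    fix j x assume "x \<in> U"
    then show "((\<lambda>x. rdet ((\<lambda>m. b m x)(j := F x))) has_derivative G' j x) (at x)"
      unfolding upd G'_def[abs_def] by (intro has_derivative_rdet cd)
  next
    fix j h
    have "continuous_on U (\<lambda>x. ((\<lambda>i. c j i x)(m := c' j m x h)) i)" for m i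
      by (cases "i = m"; cases "i = j") (auto simp: c_def c'_def intro: cb cF cb' F')
    then show "continuous_on U (\<lambda>x. G' j x h)"
      unfolding G'_def by (intro continuous_on_sum continuous_on_rdet) auto
  next
    fix x assume x: "x \<in> U"
    \<comment> \<open>Row \<open>j\<close> holds the field and row \<open>m\<close> a second
      derivative of the chart. Exchanging \<open>j\<close> and \<open>m\<close> keeps that second
      derivative, by symmetry, but swaps two rows; so \<open>t\<close> is antisymmetric and its
      double sum vanishes.\<close>
    define t where "t j m = rdet ((\<lambda>i. b i x)(j := F x, m := b' m x (axis j 1)))" for j m
    have sym: "b' m x (axis j 1) = b' j x (axis m 1)" for j m
      unfolding b'_def b_def by (rule Ck_on_2_mixed_partials[OF U x \<Phi>])
    have anti: "t j m = - t m j" if "j \<noteq> m" for j m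
      unfolding t_def sym[of m j] using that by (subst rdet_swap) (auto simp: fun_upd_twist)
    have G: "G' j x (axis j 1) = rdet ((\<lambda>i. b i x)(j := F' x (axis j 1))) + (\<Sum>m\<in>UNIV. if m = j then 0 else t j m)" for j
    proof -
      have "G' j x (axis j 1) = rdet ((\<lambda>i. c j i x)(j := c' j j x (axis j 1))) +
          (\<Sum>m\<in>UNIV - {j}. rdet ((\<lambda>i. c j i x)(m := c' j m x (axis j 1))))"
        unfolding G'_def by (rule sum.remove) auto
      also have "(\<lambda>i. c j i x)(j := c' j j x (axis j 1)) = (\<lambda>i. b i x)(j := F' x (axis j 1))"
        by (auto simp: c_def c'_def)
      also have "(\<Sum>m\<in>UNIV - {j}. rdet ((\<lambda>i. c j i x)(m := c' j m x (axis j 1)))) = (\<Sum>m\<in>UNIV - {j}. t j m)"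
      proof (rule sum.cong[OF refl])
        fix m assume "m \<in> UNIV - {j}"
        then have "(\<lambda>i. c j i x)(m := c' j m x (axis j 1)) = (\<lambda>i. b i x)(j := F x, m := b' m x (axis j 1))"
          by (auto simp: c_def c'_def)
        then show "rdet ((\<lambda>i. c j i x)(m := c' j m x (axis j 1))) = t j m" by (simp add: t_def)
      qed
      also have "\<dots> = (\<Sum>m\<in>UNIV. if m = j then 0 else t j m)"
        by (rule sum.mono_neutral_cong_left) auto
      finally show ?thesis .
    qed
    define X where "X = (\<Sum>j\<in>UNIV. \<Sum>m\<in>UNIV. if m = j then 0 else t j m)"
    have "X = (\<Sum>m\<in>UNIV. \<Sum>j\<in>UNIV. if m = j then 0 else t j m)" unfolding X_def by (rule sum.swap)
    also have "\<dots> = (\<Sum>m\<in>UNIV. \<Sum>j\<in>UNIV. - (if j = m then 0 else t m j))"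
    proof (intro sum.cong refl)
      fix m j show "(if m = j then 0 else t j m) = - (if j = m then 0 else t m j)"
        using anti[of j m] by (cases "m = j") auto
    qed
    also have "\<dots> = - X" by (simp add: X_def sum_negf)
    finally have "X = 0" by simp
    then show "(\<Sum>j\<in>UNIV. G' j x (axis j 1)) = (\<Sum>j\<in>UNIV. rdet ((\<lambda>m. b m x)(j := F' x (axis j 1))))"
      by (simp add: G sum.distrib X_def)
  qed
qed

section \<open>The reference simplex in coordinates\<close>

lemma sum_Basis_vec: "(\<Sum>b\<in>Basis. f (b::real^'d)) = (\<Sum>i\<in>UNIV. f (axis i 1))"
proof -
  have B: "(Basis :: (real^'d) set) = (\<lambda>i. axis i 1) ` UNIV" by (auto simp: Basis_vec_def)
  have inj: "inj (\<lambda>i::'d. axis i (1::real))" by (auto simp: inj_on_def axis_eq_axis)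
  show ?thesis unfolding B by (subst sum.reindex[OF inj]) (simp add: o_def)
qed

lemma ref_simplex_vec:
  "ref_simplex = {x::real^'d. (\<forall>i. 0 \<le> x $ i) \<and> (\<Sum>i\<in>UNIV. x $ i) \<le> 1}"
  unfolding ref_simplex_def std_simplex sum_Basis_vec by (auto simp: Basis_vec_def inner_axis)

lemma interior_ref_simplex_vec:
  "interior ref_simplex = {x::real^'d. (\<forall>i. 0 < x $ i) \<and> (\<Sum>i\<in>UNIV. x $ i) < 1}"
  unfolding ref_simplex_def interior_std_simplex sum_Basis_vec by (auto simp: Basis_vec_def inner_axis)

lemma compact_ref_simplex: "compact (ref_simplex :: 'a::euclidean_space set)"
  unfolding ref_simplex_def by (intro compact_convex_hull finite_imp_compact) auto

lemma convex_ref_simplex: "convex (ref_simplex :: 'a::euclidean_space set)"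
  unfolding ref_simplex_def by (rule convex_convex_hull)

definition coord_face :: "('e::finite \<Rightarrow> 'd::finite) \<Rightarrow> real^'e \<Rightarrow> real^'d" where
  "coord_face \<beta> s = (\<Sum>a\<in>UNIV. s $ a *\<^sub>R axis (\<beta> a) 1)"

text \<open>The point at which the line through \<open>coord_face \<beta> s\<close> in direction
  \<open>axis j 1\<close> leaves the simplex; the slanted face is parametrized by its projection
  along that axis.\<close>

definition slant_face :: "('e::finite \<Rightarrow> 'd::finite) \<Rightarrow> 'd \<Rightarrow> real^'e \<Rightarrow> real^'d" where
  "slant_face \<beta> j s = coord_face \<beta> s + (1 - (\<Sum>a\<in>UNIV. s $ a)) *\<^sub>R axis j 1"

lemma linear_coord_face: "linear (coord_face \<beta>)"
  by (rule linearI) (auto simp: coord_face_def sum.distrib scaleR_add_left scaleR_sum_right)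

lemma coord_face_nth:
  assumes \<beta>: "bij_betw \<beta> UNIV (UNIV - {j})"
  shows "coord_face \<beta> s $ j = 0" "coord_face \<beta> s $ \<beta> a = s $ a"
    "(\<Sum>i\<in>UNIV. coord_face \<beta> s $ i) = (\<Sum>a\<in>UNIV. s $ a)"
proof -
  have nj: "\<beta> a \<noteq> j" for a using \<beta> by (auto simp: bij_betw_def)
  have inj: "\<beta> a = \<beta> c \<longleftrightarrow> a = c" for a c using \<beta> by (auto simp: bij_betw_def inj_eq)
  show 1: "coord_face \<beta> s $ j = 0" using nj nj[symmetric] by (simp add: coord_face_def axis_def)
  show 2: "coord_face \<beta> s $ \<beta> a = s $ a" for a
    by (simp add: coord_face_def axis_def inj if_distrib cong: if_cong)
  have "(\<Sum>i\<in>UNIV. coord_face \<beta> s $ i) = coord_face \<beta> s $ j + (\<Sum>i\<in>UNIV - {j}. coord_face \<beta> s $ i)"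
    by (rule sum.remove) auto
  then show "(\<Sum>i\<in>UNIV. coord_face \<beta> s $ i) = (\<Sum>a\<in>UNIV. s $ a)"
    using sum.reindex_bij_betw[OF \<beta>, of "\<lambda>i. coord_face \<beta> s $ i"] by (simp add: 1 2)
qed

lemma lborel_distr_linear_basis:
  fixes T :: "'a::euclidean_space \<Rightarrow> 'b::euclidean_space"
  assumes T: "linear T" and B: "bij_betw T Basis Basis"
  shows "distr lborel borel T = lborel"
proof -
  have "(\<Sum>b\<in>Basis. (x \<bullet> b) *\<^sub>R T b) = T x" for x
  proof -
    have "T (\<Sum>b\<in>Basis. (x \<bullet> b) *\<^sub>R b) = (\<Sum>b\<in>Basis. (x \<bullet> b) *\<^sub>R T b)"
      using T by (simp add: linear_sum linear_cmul)
    then show ?thesis by (simp add: euclidean_representation)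
  qed
  then have "(\<lambda>x. \<Sum>b\<in>Basis. (x \<bullet> b) *\<^sub>R T b) = T" by (rule ext)
  then show ?thesis using lborel_distr_basis[OF B] by metis
qed

lemma coord_face_axis: "coord_face \<beta> (axis a 1) = axis (\<beta> a) 1"
proof -
  have "coord_face \<beta> (axis a 1) = (\<Sum>c\<in>UNIV. if c = a then axis (\<beta> c) 1 else 0)"
    unfolding coord_face_def by (intro sum.cong refl) (simp add: axis_def[of a])
  then show ?thesis by simp
qed

text \<open>The splitting map sends the standard basis of the product bijectively to the standard
  basis, hence preserves Lebesgue measure; this isolates the direction \<open>j\<close> for
  Fubini.\<close>

lemma lborel_distr_coord_split:
  fixes \<beta> :: "'e::finite \<Rightarrow> 'd::finite"
  assumes \<beta>: "bij_betw \<beta> UNIV (UNIV - {j})"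
  shows "distr lborel borel (\<lambda>(s, r). coord_face \<beta> s + r *\<^sub>R axis j 1) = lborel"
proof (rule lborel_distr_linear_basis)
  let ?T = "\<lambda>(s, r). coord_face \<beta> s + r *\<^sub>R axis j (1::real)"
  show "linear ?T"
    by (rule linearI) (auto simp: linear_add[OF linear_coord_face] linear_cmul[OF linear_coord_face] algebra_simps)
  have z: "coord_face \<beta> 0 = 0" by (simp add: coord_face_def)
  have B: "(Basis :: (real^'n::finite) set) = range (\<lambda>i. axis i 1)" by (auto simp: Basis_vec_def)
  have B2: "(Basis :: ((real^'e) \<times> real) set) = range (\<lambda>a. (axis a 1, 0)) \<union> {(0, 1)}"
    unfolding Basis_prod_def B by auto
  have nj: "\<beta> a \<noteq> j" for a using \<beta> by (auto simp: bij_betw_def)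
  have inj: "\<beta> a = \<beta> c \<longleftrightarrow> a = c" for a c using \<beta> by (auto simp: bij_betw_def inj_eq)
  have im: "range \<beta> = UNIV - {j}" using \<beta> by (auto simp: bij_betw_def)
  show "bij_betw ?T Basis Basis"
  proof (rule bij_betw_imageI)
    show "inj_on ?T Basis"
      unfolding B2 by (rule inj_onI) (auto simp: coord_face_axis z axis_eq_axis nj nj[symmetric] inj)
    have "?T ` Basis = (\<lambda>i. axis i 1) ` (range \<beta> \<union> {j})"
      unfolding B2 by (simp add: image_Un image_image coord_face_axis z)
    then show "?T ` Basis = Basis" by (simp only: im B) simp
  qed
qed

lemma coord_split_mem_ref_simplex:
  assumes \<beta>: "bij_betw \<beta> UNIV (UNIV - {j})"
  shows "coord_face \<beta> s + r *\<^sub>R axis j 1 \<in> ref_simplex \<longleftrightarrow>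
    s \<in> ref_simplex \<and> 0 \<le> r \<and> r \<le> 1 - (\<Sum>a\<in>UNIV. s $ a)"
proof -
  note n = coord_face_nth[OF \<beta>]
  have nj: "\<beta> a \<noteq> j" for a using \<beta> by (auto simp: bij_betw_def)
  have cs: "i = j \<or> (\<exists>a. i = \<beta> a)" for i using \<beta> by (auto simp: bij_betw_def)
  have 1: "(\<forall>i. 0 \<le> (coord_face \<beta> s + r *\<^sub>R axis j 1) $ i) \<longleftrightarrow> 0 \<le> r \<and> (\<forall>a. 0 \<le> s $ a)"
  proof
    assume *: "\<forall>i. 0 \<le> (coord_face \<beta> s + r *\<^sub>R axis j 1) $ i"
    have "0 \<le> r" using spec[OF *, of j] n by (simp add: axis_def)
    moreover have "0 \<le> s $ a" for a using spec[OF *, of "\<beta> a"] n nj[of a] by (simp add: axis_def)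
    ultimately show "0 \<le> r \<and> (\<forall>a. 0 \<le> s $ a)" by simp
  next
    assume *: "0 \<le> r \<and> (\<forall>a. 0 \<le> s $ a)"
    show "\<forall>i. 0 \<le> (coord_face \<beta> s + r *\<^sub>R axis j 1) $ i"
    proof
      fix i show "0 \<le> (coord_face \<beta> s + r *\<^sub>R axis j 1) $ i"
        using cs[of i] * n nj by (auto simp: axis_def)
    qed
  qed
  have 2: "(\<Sum>i\<in>UNIV. (coord_face \<beta> s + r *\<^sub>R axis j 1) $ i) = (\<Sum>a\<in>UNIV. s $ a) + r"
    by (simp add: sum.distrib n(3)) (simp add: axis_def if_distrib cong: if_cong)
  show ?thesis
    unfolding ref_simplex_vec mem_Collect_eq 1 2 by auto
qed

lemma continuous_on_coord_face [continuous_intros]: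
  "continuous_on S f \<Longrightarrow> continuous_on S (\<lambda>x. coord_face \<beta> (f x))"
  unfolding coord_face_def by (intro continuous_intros)

lemma continuous_on_slant_face [continuous_intros]:
  "continuous_on S f \<Longrightarrow> continuous_on S (\<lambda>x. slant_face \<beta> j (f x))"
  unfolding slant_face_def by (intro continuous_intros)

text \<open>In split coordinates the simplex is the region below a graph over the lower-dimensional
  simplex. Fubini integrates along \<open>axis j 1\<close> first, and the fundamental theorem leaves
  the two end points, one on the slanted face and one on the coordinate face.\<close>

lemma integral_ref_simplex_partial:
  fixes g :: "real^'d::finite \<Rightarrow> real" and \<beta> :: "'e::finite \<Rightarrow> 'd"
  assumes \<beta>: "bij_betw \<beta> UNIV (UNIV - {j})"
    and g: "\<And>x. x \<in> ref_simplex \<Longrightarrow> (g has_derivative g' x) (at x)"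
    and g': "continuous_on ref_simplex (\<lambda>x. g' x (axis j 1))"
  shows "(LINT x:ref_simplex|lebesgue. g' x (axis j 1)) =
    (LINT s:ref_simplex|lebesgue. g (slant_face \<beta> j s) - g (coord_face \<beta> s))"
proof -
  let ?S = "ref_simplex :: (real^'d) set" and ?E = "ref_simplex :: (real^'e) set"
  define D where "D x = g' x (axis j 1)" for x
  define k where "k x = indicator ?S x *\<^sub>R D x" for x
  let ?T = "\<lambda>(s, r). coord_face \<beta> s + r *\<^sub>R axis j (1::real)"
  have cl: "closed ?S" "closed ?E" using compact_ref_simplex compact_imp_closed by blast+
  have kint: "integrable lborel k"
    unfolding k_def D_def by (rule borel_integrable_compact[OF compact_ref_simplex g'])
  then have kb: "k \<in> borel_measurable borel" using borel_measurable_integrable by fastforce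
  have cT: "continuous_on UNIV ?T"
    unfolding case_prod_beta by (intro continuous_intros)
  then have mT: "?T \<in> lborel \<rightarrow>\<^sub>M borel" by (simp add: borel_measurable_continuous_onI)
  note dT = lborel_distr_coord_split[OF \<beta>]
  have kT: "integrable lborel (\<lambda>x. k (?T x))"
    by (rule integrable_distr[OF mT]) (use kint in \<open>simp add: dT\<close>)
  have "(LINT x:?S|lebesgue. g' x (axis j 1)) = integral\<^sup>L lborel k"
    unfolding set_lebesgue_integral_def k_def D_def
    by (rule integral_completion) (use kb in \<open>simp add: k_def[abs_def] D_def\<close>)
  also have "\<dots> = integral\<^sup>L (distr lborel borel ?T) k" by (simp add: dT)
  also have "\<dots> = (LINT x|lborel. k (?T x))" by (rule integral_distr[OF mT kb])
  also have "\<dots> = (LINT x|(lborel \<Otimes>\<^sub>M lborel). k (?T x))" by (simp add: lborel_prod)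
  also have "\<dots> = (LINT s|lborel. (LINT r|lborel. k (?T (s, r))))"
    by (rule lborel_pair.integral_fst'[symmetric]) (use kT in \<open>simp add: lborel_prod\<close>)
  also have "\<dots> = (LINT s|lborel. indicator ?E s *\<^sub>R (g (slant_face \<beta> j s) - g (coord_face \<beta> s)))"
  proof (rule Bochner_Integration.integral_cong[OF refl])
    fix s :: "real^'e"
    show "(LINT r|lborel. k (?T (s, r))) = indicator ?E s *\<^sub>R (g (slant_face \<beta> j s) - g (coord_face \<beta> s))"
    proof (cases "s \<in> ?E")
      case False
      then have "k (?T (s, r)) = 0" for r
        by (simp add: k_def coord_split_mem_ref_simplex[OF \<beta>])
      then show ?thesis using False by simp
    next
      case True
      let ?b = "1 - (\<Sum>a\<in>UNIV. s $ a)"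
      have b0: "0 \<le> ?b" using True by (simp add: ref_simplex_vec)
      have mem: "coord_face \<beta> s + r *\<^sub>R axis j 1 \<in> ?S" if "0 \<le> r" "r \<le> ?b" for r
        using that True by (simp add: coord_split_mem_ref_simplex[OF \<beta>])
      have "k (?T (s, r)) = indicator {0..?b} r *\<^sub>R D (coord_face \<beta> s + r *\<^sub>R axis j 1)" for r
        using True by (auto simp: k_def coord_split_mem_ref_simplex[OF \<beta>] indicator_def)
      then have "(LINT r|lborel. k (?T (s, r))) =
          (LINT r|lborel. indicator {0..?b} r *\<^sub>R D (coord_face \<beta> s + r *\<^sub>R axis j 1))" by simp
      also have "\<dots> = g (coord_face \<beta> s + ?b *\<^sub>R axis j 1) - g (coord_face \<beta> s + 0 *\<^sub>R axis j 1)"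
      proof (rule integral_FTC_Icc[OF b0])
        fix r assume r: "0 \<le> r" "r \<le> ?b"
        have "((\<lambda>r. g (coord_face \<beta> s + r *\<^sub>R axis j 1)) has_real_derivative D (coord_face \<beta> s + r *\<^sub>R axis j 1)) (at r)"
          unfolding D_def by (rule has_derivative_line) (rule g[OF mem[OF r]])
        then show "((\<lambda>r. g (coord_face \<beta> s + r *\<^sub>R axis j 1)) has_vector_derivative D (coord_face \<beta> s + r *\<^sub>R axis j 1)) (at r within {0..?b})"
          using has_real_derivative_iff_has_vector_derivative has_vector_derivative_at_within by blast
      next
        have "continuous_on {0..?b} (\<lambda>r. coord_face \<beta> s + r *\<^sub>R axis j 1)" by (intro continuous_intros)
        then show "continuous_on {0..?b} (\<lambda>r. D (coord_face \<beta> s + r *\<^sub>R axis j 1))"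
          unfolding D_def by (rule continuous_on_compose2[OF g']) (use mem in auto)
      qed
      finally show ?thesis using True by (simp add: slant_face_def)
    qed
  qed
  also have "\<dots> = (LINT s:?E|lebesgue. g (slant_face \<beta> j s) - g (coord_face \<beta> s))"
  proof -
    have gc: "continuous_on ?S g"
      using g by (intro has_derivative_continuous_on[where f' = g']) (auto intro: has_derivative_at_withinI)
    have "continuous_on ?E (\<lambda>s. g (slant_face \<beta> j s) - g (coord_face \<beta> s))"
    proof (intro continuous_on_diff continuous_on_compose2[OF gc] continuous_intros)
      show "slant_face \<beta> j ` ?E \<subseteq> ?S"
        by (auto simp: slant_face_def coord_split_mem_ref_simplex[OF \<beta>]) (simp add: ref_simplex_vec)
      have "coord_face \<beta> s \<in> ?S" if "s \<in> ?E" for s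
        using coord_split_mem_ref_simplex[OF \<beta>, of s 0] that by (simp add: ref_simplex_vec)
      then show "coord_face \<beta> ` ?E \<subseteq> ?S" by auto
    qed
    then have "(\<lambda>s. indicator ?E s *\<^sub>R (g (slant_face \<beta> j s) - g (coord_face \<beta> s))) \<in> borel_measurable borel"
      using cl by (intro borel_measurable_continuous_on_indicator) auto
    then show ?thesis
      unfolding set_lebesgue_integral_def by (intro integral_completion[symmetric]) simp
  qed
  finally show ?thesis .
qed

section \<open>Smooth parametrizations of surface patches\<close>

lemma has_derivative_transform_open:
  assumes "open U" "x \<in> U" "\<And>y. y \<in> U \<Longrightarrow> f y = g y"
  shows "(f has_derivative D) (at x) \<longleftrightarrow> (g has_derivative D) (at x)"
  using has_derivative_transform_within_open[OF _ assms(1,2), of f D UNIV g]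
    has_derivative_transform_within_open[OF _ assms(1,2), of g D UNIV f] assms(3)
  by (simp add: subset_iff) blast

lemma fderiv_cong_open:
  assumes "open U" "x \<in> U" "\<And>y. y \<in> U \<Longrightarrow> f y = g y"
  shows "fderiv f x = fderiv g x"
  unfolding frechet_derivative_def by (simp only: has_derivative_transform_open[OF assms])

lemma Ck_on_cong_open:
  assumes U: "open U" and eq: "\<And>y. y \<in> U \<Longrightarrow> f y = g y"
  shows "Ck_on m f U \<longleftrightarrow> Ck_on m g U"
  using eq
proof (induction m arbitrary: f g)
  case 0
  then show ?case by (simp cong: continuous_on_cong)
next
  case (Suc m)
  have "(f has_derivative D) (at x within U) \<longleftrightarrow> (g has_derivative D) (at x within U)"
    if x: "x \<in> U" for x D
    using has_derivative_transform[OF x, of g f D] has_derivative_transform[OF x, of f g D]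
    by (rule iffI) (simp_all add: Suc.prems)
  then have "f differentiable_on U \<longleftrightarrow> g differentiable_on U"
    unfolding differentiable_on_def differentiable_def by simp
  moreover have "Ck_on m (\<lambda>x. fderiv f x h) U \<longleftrightarrow> Ck_on m (\<lambda>x. fderiv g x h) U" for h
    by (rule Suc.IH) (simp only: fderiv_cong_open[OF U _ Suc.prems])
  ultimately show ?case by simp
qed

lemma has_derivative_affine:
  fixes L :: "'a::real_normed_vector \<Rightarrow> 'b::real_normed_vector"
  assumes L: "bounded_linear L" and f: "(f has_derivative f') (at (a + L s))"
  shows "((\<lambda>s. f (a + L s)) has_derivative (\<lambda>h. f' (L h))) (at s)"
proof -
  have "((\<lambda>s. a + L s) has_derivative L) (at s)"
    using has_derivative_add[OF has_derivative_const bounded_linear_imp_has_derivative[OF L]] by simp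
  from has_derivative_compose[OF this f] show ?thesis .
qed

text \<open>Induction on the order works because a directional derivative of the composite is a
  directional derivative of \<open>f\<close>, in the fixed direction \<open>L h\<close>, composed
  with the same affine map.\<close>

lemma Ck_on_affine:
  fixes L :: "'a::real_normed_vector \<Rightarrow> 'b::real_normed_vector" and f :: "'b \<Rightarrow> 'c::real_normed_vector"
  assumes L: "bounded_linear L" and U: "open U" and f: "Ck_on m f U"
  shows "Ck_on m (\<lambda>s. f (a + L s)) ((\<lambda>s. a + L s) -` U)"
  using f
proof (induction m arbitrary: f)
  case 0
  have c: "continuous_on ((\<lambda>s. a + L s) -` U) (\<lambda>s. a + L s)"
    by (intro continuous_intros linear_continuous_on L)
  have "continuous_on U f" using 0 by simp
  then show ?case using continuous_on_compose2[OF _ c, of U f] by auto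
next
  case (Suc m)
  let ?V = "(\<lambda>s. a + L s) -` U"
  have cL: "continuous_on UNIV (\<lambda>s. a + L s)" by (intro continuous_intros linear_continuous_on L)
  have V: "open ?V" using U cL by (rule open_vimage)
  have D: "((\<lambda>s. f (a + L s)) has_derivative (\<lambda>h. fderiv f (a + L s) (L h))) (at s)" if "s \<in> ?V" for s
    by (rule has_derivative_affine[OF L Ck_on_has_derivative[OF U _ Suc.prems]]) (use that in simp)
  have "Ck_on m (\<lambda>s. fderiv (\<lambda>s. f (a + L s)) s h) ?V" for h
  proof -
    have "Ck_on m (\<lambda>s. fderiv f (a + L s) (L h)) ?V"
      by (rule Suc.IH) (use Suc.prems in simp)
    moreover have "fderiv f (a + L s) (L h) = fderiv (\<lambda>s. f (a + L s)) s h" if "s \<in> ?V" for s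
      using frechet_derivative_at[OF D[OF that]] by metis
    ultimately show ?thesis
      by (subst (asm) Ck_on_cong_open[OF V, where g = "\<lambda>s. fderiv (\<lambda>s. f (a + L s)) s h"])
    qed
  moreover have "(\<lambda>s. f (a + L s)) differentiable_on ?V"
    unfolding differentiable_on_def differentiable_def using D has_derivative_at_withinI by blast
  ultimately show ?case by simp
qed

lemma Ck_on_const: "Ck_on m (\<lambda>x. c) U"
proof (induction m arbitrary: c)
  case (Suc m)
  have "fderiv (\<lambda>x. c) x = (\<lambda>h. 0)" for x by (rule frechet_derivative_const)
  with Suc show ?case by simp
qed simp

lemma Ck_on_ident: "Ck_on m (\<lambda>x. x) U"
proof (cases m)
  case (Suc n)
  have "fderiv (\<lambda>x. x) x = (\<lambda>h. h)" for x :: 'a by (rule frechet_derivative_ident)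
  with Suc show ?thesis by (simp add: Ck_on_const)
qed simp

lemma smooth_embedding_ident: "smooth_embedding (\<lambda>x. x) S"
  unfolding smooth_embedding_def
proof (intro conjI ballI)
  show "\<exists>U. open U \<and> S \<subseteq> U \<and> (\<forall>m. Ck_on m (\<lambda>x::'a. x) U)"
    by (rule exI[of _ UNIV]) (simp add: Ck_on_ident)
  fix x :: 'a
  have "fderiv (\<lambda>x. x) x = (\<lambda>h. h)" by (rule frechet_derivative_ident)
  then show "inj (fderiv (\<lambda>x. x) x)" by (simp add: inj_def)
qed simp

lemma smooth_embeddingD:
  assumes "smooth_embedding g S"
  shows "x \<in> S \<Longrightarrow> (g has_derivative fderiv g x) (at x)"
    "continuous_on S (\<lambda>x. fderiv g x h)" "continuous_on S g" "inj_on g S"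
    "x \<in> S \<Longrightarrow> inj (fderiv g x)" "g differentiable_on S"
proof -
  obtain U where U: "open U" "S \<subseteq> U" and C: "\<And>m. Ck_on m g U"
    and i: "inj_on g S" "\<forall>x\<in>S. inj (fderiv g x)"
    using assms unfolding smooth_embedding_def by blast
  show d: "x \<in> S \<Longrightarrow> (g has_derivative fderiv g x) (at x)" for x
    using Ck_on_has_derivative[OF U(1) _ C[of "Suc 0"]] U(2) by blast
  show "continuous_on S (\<lambda>x. fderiv g x h)"
    using Ck_on_2D(4)[OF U(1) C] U(2) continuous_on_subset by blast
  show "inj_on g S" "x \<in> S \<Longrightarrow> inj (fderiv g x)" using i by auto
  show "g differentiable_on S"
    unfolding differentiable_on_def differentiable_def using d has_derivative_at_withinI by blast
  then show "continuous_on S g" by (rule differentiable_imp_continuous_on)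
qed

lemma smooth_embedding_affine:
  fixes g :: "'b::real_normed_vector \<Rightarrow> 'c::real_normed_vector"
  assumes g: "smooth_embedding g S" and L: "bounded_linear L" "inj L"
    and im: "\<And>s. s \<in> E \<Longrightarrow> a + L s \<in> S"
  shows "smooth_embedding (\<lambda>s. g (a + L s)) E"
    "s \<in> E \<Longrightarrow> fderiv (\<lambda>s. g (a + L s)) s = (\<lambda>h. fderiv g (a + L s) (L h))"
proof -
  obtain U where U: "open U" "S \<subseteq> U" and C: "\<And>m. Ck_on m g U"
    using g unfolding smooth_embedding_def by blast
  note gD = smooth_embeddingD[OF g]
  show D: "s \<in> E \<Longrightarrow> fderiv (\<lambda>s. g (a + L s)) s = (\<lambda>h. fderiv g (a + L s) (L h))" for s
    by (rule frechet_derivative_at[symmetric], rule has_derivative_affine[OF L(1) gD(1)[OF im]])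
  show "smooth_embedding (\<lambda>s. g (a + L s)) E"
    unfolding smooth_embedding_def
  proof (intro conjI ballI)
    have "continuous_on UNIV (\<lambda>s. a + L s)" by (intro continuous_intros linear_continuous_on L)
    then have "open ((\<lambda>s. a + L s) -` U)" using U by (intro open_vimage)
    then show "\<exists>V. open V \<and> E \<subseteq> V \<and> (\<forall>m. Ck_on m (\<lambda>s. g (a + L s)) V)"
      using Ck_on_affine[OF L(1) U(1) C] subsetD[OF U(2) im]
      by (intro exI[of _ "(\<lambda>s. a + L s) -` U"]) auto
    show "inj_on (\<lambda>s. g (a + L s)) E"
    proof (rule inj_onI)
      fix s t assume st: "s \<in> E" "t \<in> E" "g (a + L s) = g (a + L t)"
      then have "a + L s = a + L t" using inj_onD[OF gD(4)] im by blast
      then show "s = t" using L(2) by (simp add: inj_eq)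
    qed
    fix s assume s: "s \<in> E"
    show "inj (fderiv (\<lambda>s. g (a + L s)) s)"
      unfolding D[OF s] using inj_compose[OF gD(5)[OF im[OF s]] L(2)] by (simp add: o_def)
  qed
qed

text \<open>Either both functions are integrable or both integrals are 0 by convention, so
  integrands may be exchanged off a null set before any integrability is known.\<close>

lemma set_lebesgue_integral_spike:
  fixes f g :: "'a::euclidean_space \<Rightarrow> real"
  assumes N: "negligible N" and eq: "\<And>x. x \<in> S - N \<Longrightarrow> f x = g x"
  shows "set_integrable lebesgue S f \<longleftrightarrow> set_integrable lebesgue S g"
    "(LINT x:S|lebesgue. f x) = (LINT x:S|lebesgue. g x)"
proof -
  show iff: "set_integrable lebesgue S f \<longleftrightarrow> set_integrable lebesgue S g"
  proof
    assume "set_integrable lebesgue S f"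
    then show "set_integrable lebesgue S g"
      by (rule absolutely_integrable_spike[OF _ N]) (simp add: eq)
  next
    assume "set_integrable lebesgue S g"
    then show "set_integrable lebesgue S f"
      by (rule absolutely_integrable_spike[OF _ N]) (simp add: eq)
  qed
  show "(LINT x:S|lebesgue. f x) = (LINT x:S|lebesgue. g x)"
  proof (cases "set_integrable lebesgue S f")
    case True
    have "integral S f = integral S g" by (rule integral_spike[OF N]) (simp add: eq)
    then show ?thesis
      using True iff by (simp add: set_lebesgue_integral_eq_integral(2))
  next
    case False
    then show ?thesis
      using iff unfolding set_integrable_def set_lebesgue_integral_def
      by (simp add: not_integrable_integral_eq)
  qed
qed

lemma negligible_boundary_ref_simplex: "negligible (ref_simplex - interior ref_simplex :: 'a::euclidean_space set)"
  by (rule negligible_subset[OF negligible_convex_frontier[OF convex_ref_simplex]])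
     (use closure_subset in \<open>auto simp: frontier_def\<close>)

lemma sets_lebesgue_compact: "compact (S :: 'a::euclidean_space set) \<Longrightarrow> S \<in> sets lebesgue"
  by (simp add: borel_compact)

section \<open>Area element and change of surface parametrization\<close>

definition area :: "(real^'e::finite \<Rightarrow> real^'d::finite) \<Rightarrow> real^'e \<Rightarrow> real" where
  "area \<gamma> s = (let J = matrix (fderiv \<gamma> s) in sqrt (det (transpose J ** J)))"

lemma area_gram:
  "area \<gamma> s = sqrt (det (\<chi> a b. fderiv \<gamma> s (axis a 1) \<bullet> fderiv \<gamma> s (axis b 1)))"
proof -
  have gm: "transpose (matrix D) ** matrix D = (\<chi> a b. D (axis a 1) \<bullet> D (axis b 1))"
    for D :: "real^'e \<Rightarrow> real^'d"
    by (simp add: vec_eq_iff matrix_matrix_mult_def transpose_def matrix_def inner_vec_def)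
  show ?thesis unfolding area_def Let_def gm ..
qed

lemma continuous_on_area:
  assumes "smooth_embedding \<gamma> E"
  shows "continuous_on E (area \<gamma>)"
proof -
  note c = smooth_embeddingD(2)[OF assms]
  have "continuous_on E (\<lambda>s. sqrt (rdet (\<lambda>a. \<chi> b. fderiv \<gamma> s (axis a 1) \<bullet> fderiv \<gamma> s (axis b 1))))"
    by (intro continuous_intros continuous_on_rdet c)
  then show ?thesis by (simp add: area_gram[abs_def] rdet_def)
qed

lemma area_reparam:
  fixes \<gamma> \<gamma>0 :: "real^'e::finite \<Rightarrow> real^'d::finite"
  assumes "fderiv \<gamma> s = (\<lambda>h. D0 (P h))" "fderiv \<gamma>0 t = D0" "linear D0" "linear P"
  shows "area \<gamma> s = \<bar>det (matrix P)\<bar> * area \<gamma>0 t"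
proof -
  let ?A = "matrix D0" and ?B = "matrix P"
  have m: "matrix (fderiv \<gamma> s) = ?A ** ?B"
    using matrix_compose[OF assms(4,3)] by (simp add: assms(1) o_def)
  have "transpose (?A ** ?B) ** (?A ** ?B) = transpose ?B ** (transpose ?A ** ?A) ** ?B"
    by (simp add: matrix_transpose_mul matrix_mul_assoc)
  then have "det (transpose (?A ** ?B) ** (?A ** ?B)) = (det ?B)\<^sup>2 * det (transpose ?A ** ?A)"
    by (simp add: det_mul power2_eq_square)
  then show ?thesis by (simp add: area_def Let_def m assms(2) real_sqrt_mult)
qed

text \<open>\<open>\<psi>\<close> is the transition map, the inverse of \<open>\<gamma>0\<close>
  after \<open>\<gamma>\<close>. The inverse is continuous because \<open>E\<close> is compact, and
  it is differentiable within the patch; the chain rule then relates the two area elements.\<close>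

lemma reparametrization:
  fixes \<gamma> \<gamma>0 :: "real^'e::finite \<Rightarrow> real^'d::finite"
  assumes 0: "smooth_embedding \<gamma>0 E" and 1: "smooth_embedding \<gamma> E"
    and E: "compact E" and im: "\<gamma> ` E = \<gamma>0 ` E"
  obtains \<psi> \<psi>' where "bij_betw \<psi> E E" "\<And>s. s \<in> E \<Longrightarrow> \<gamma>0 (\<psi> s) = \<gamma> s" "continuous_on E \<psi>"
    "\<And>s. s \<in> E \<Longrightarrow> (\<psi> has_derivative \<psi>' s) (at s within E)"
    "\<And>s. s \<in> interior E \<Longrightarrow> area \<gamma> s = \<bar>det (matrix (\<psi>' s))\<bar> * area \<gamma>0 (\<psi> s)"
proof -
  note D0 = smooth_embeddingD[OF 0] and D1 = smooth_embeddingD[OF 1]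
  define i where "i = inv_into E \<gamma>0"
  define \<psi> where "\<psi> s = i (\<gamma> s)" for s
  have i0: "i (\<gamma>0 t) = t" if "t \<in> E" for t using that D0(4) by (simp add: i_def)
  have ci: "continuous_on (\<gamma>0 ` E) i"
    by (rule continuous_on_inv[OF D0(3) E]) (use i0 in auto)
  have \<psi>E: "\<psi> s \<in> E" and \<gamma>\<psi>: "\<gamma>0 (\<psi> s) = \<gamma> s" if "s \<in> E" for s
  proof -
    have "\<gamma> s \<in> \<gamma>0 ` E" using im that by blast
    then obtain t where "t \<in> E" "\<gamma> s = \<gamma>0 t" by blast
    then show "\<psi> s \<in> E" "\<gamma>0 (\<psi> s) = \<gamma> s" using i0 by (simp_all add: \<psi>_def)
  qed
  have bij: "bij_betw \<psi> E E"
  proof (rule bij_betw_imageI)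
    show "inj_on \<psi> E" using \<gamma>\<psi> D1(4) by (metis inj_on_def)
    show "\<psi> ` E = E"
    proof (intro equalityI subsetI)
      fix t assume t: "t \<in> E"
      then have "\<gamma>0 t \<in> \<gamma> ` E" using im by blast
      then obtain s where s: "s \<in> E" "\<gamma>0 t = \<gamma> s" by blast
      then have "\<psi> s = t" using i0[OF t] by (simp add: \<psi>_def)
      then show "t \<in> \<psi> ` E" using s by blast
    qed (use \<psi>E in blast)
  qed
  have c\<psi>: "continuous_on E \<psi>"
    unfolding \<psi>_def by (rule continuous_on_compose2[OF ci D1(3)]) (use im in auto)
  \<comment> \<open>The patch may have smaller dimension than the space around it, so the derivative
    has only a left inverse; any of them is a derivative of the inverse within the patch.\<close>
  have "\<exists>L. linear L \<and> L \<circ> fderiv \<gamma>0 t = id" if "t \<in> E" for t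
    using linear_injective_left_inverse[OF has_derivative_linear[OF D0(1)[OF that]] D0(5)[OF that]] by blast
  then obtain L where L: "\<And>t. t \<in> E \<Longrightarrow> linear (L t)" "\<And>t. t \<in> E \<Longrightarrow> L t \<circ> fderiv \<gamma>0 t = id"
    by metis
  define \<psi>' where "\<psi>' s h = L (\<psi> s) (fderiv \<gamma> s h)" for s h
  have d\<psi>: "(\<psi> has_derivative \<psi>' s) (at s within E)" if s: "s \<in> E" for s
  proof -
    have "(i has_derivative L (\<psi> s)) (at (\<gamma>0 (\<psi> s)) within \<gamma>0 ` E)"
    proof (rule has_derivative_inverse_within[OF has_derivative_at_withinI[OF D0(1)]])
      show "continuous (at (\<gamma>0 (\<psi> s)) within \<gamma>0 ` E) i"
        using ci \<psi>E[OF s] by (auto simp: continuous_on_eq_continuous_within)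
    qed (use \<psi>E[OF s] L i0 in auto)
    then have "(i has_derivative L (\<psi> s)) (at (\<gamma> s) within \<gamma> ` E)"
      by (simp only: \<gamma>\<psi>[OF s] im)
    from diff_chain_within[OF has_derivative_at_withinI[OF D1(1)[OF s]] this]
    show ?thesis by (simp add: o_def \<psi>_def[abs_def] \<psi>'_def[abs_def])
  qed
  \<comment> \<open>The comparison needs uniqueness of the derivative, obtained at interior points,
    where the derivative within \<open>E\<close> is a full one.\<close>
  have ar: "area \<gamma> s = \<bar>det (matrix (\<psi>' s))\<bar> * area \<gamma>0 (\<psi> s)" if s: "s \<in> interior E" for s
  proof (rule area_reparam[OF _ refl])
    have sE: "s \<in> E" using s interior_subset by blast
    have at: "at s within E = at s" using s by (rule at_within_interior)
    have "((\<gamma>0 \<circ> \<psi>) has_derivative (fderiv \<gamma>0 (\<psi> s) \<circ> \<psi>' s)) (at s)"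
      using diff_chain_within[OF d\<psi>[OF sE] has_derivative_at_withinI[OF D0(1)[OF \<psi>E[OF sE]]]] at by simp
    moreover have "((\<gamma>0 \<circ> \<psi>) has_derivative fderiv \<gamma> s) (at s)"
    proof -
      have "(\<gamma>0 \<circ> \<psi>) y = \<gamma> y" if "y \<in> interior E" for y
        using \<gamma>\<psi> that interior_subset by (metis comp_apply subsetD)
      then show ?thesis
        using has_derivative_transform_open[OF open_interior s, of "\<gamma>0 \<circ> \<psi>" \<gamma>] D1(1)[OF sE] by blast
    qed
    ultimately have "fderiv \<gamma> s = fderiv \<gamma>0 (\<psi> s) \<circ> \<psi>' s" by (rule has_derivative_unique[symmetric])
    then show "fderiv \<gamma> s = (\<lambda>h. fderiv \<gamma>0 (\<psi> s) (\<psi>' s h))" by (simp add: o_def)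
    show "linear (fderiv \<gamma>0 (\<psi> s))" using has_derivative_linear[OF D0(1)[OF \<psi>E[OF sE]]] .
    show "linear (\<psi>' s)" using has_derivative_linear[OF d\<psi>[OF sE]] .
  qed
  show thesis by (rule that[OF bij \<gamma>\<psi> c\<psi> d\<psi> ar])
qed

text \<open>The first claim is the change of variables along the transition map. The second is
  invariance of domain: the image of the interior under that map is open and lies in the simplex,
  hence in its interior. It makes the relative interior of a patch a property of the set
  alone.\<close>

lemma surface_parameter_change:
  fixes \<gamma> \<gamma>0 :: "real^'e::finite \<Rightarrow> real^'d::finite" and g :: "real^'d \<Rightarrow> real"
  assumes 0: "smooth_embedding \<gamma>0 ref_simplex" and 1: "smooth_embedding \<gamma> ref_simplex"
    and im: "\<gamma> ` ref_simplex = \<gamma>0 ` ref_simplex"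
  shows "(LINT s:ref_simplex|lebesgue. g (\<gamma> s) * area \<gamma> s) =
      (LINT s:ref_simplex|lebesgue. g (\<gamma>0 s) * area \<gamma>0 s)"
    "\<gamma> ` interior ref_simplex \<subseteq> \<gamma>0 ` interior ref_simplex"
proof -
  let ?E = "ref_simplex :: (real^'e) set"
  obtain \<psi> \<psi>' where bij: "bij_betw \<psi> ?E ?E" and \<gamma>\<psi>: "\<And>s. s \<in> ?E \<Longrightarrow> \<gamma>0 (\<psi> s) = \<gamma> s"
    and c: "continuous_on ?E \<psi>"
    and d: "\<And>s. s \<in> ?E \<Longrightarrow> (\<psi> has_derivative \<psi>' s) (at s within ?E)"
    and ar: "\<And>s. s \<in> interior ?E \<Longrightarrow> area \<gamma> s = \<bar>det (matrix (\<psi>' s))\<bar> * area \<gamma>0 (\<psi> s)"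
    by (rule reparametrization[OF 0 1 compact_ref_simplex im]) (rule that)
  let ?f = "\<lambda>t. g (\<gamma>0 t) * area \<gamma>0 t" and ?h = "\<lambda>s. \<bar>det (matrix (\<psi>' s))\<bar> * (g (\<gamma>0 (\<psi> s)) * area \<gamma>0 (\<psi> s))"
  have inj: "inj_on \<psi> ?E" and \<psi>E: "\<psi> ` ?E = ?E" using bij by (auto simp: bij_betw_def)
  have sE: "s \<in> ?E" if "s \<in> interior ?E" for s using that interior_subset by blast
  have "(LINT s:?E|lebesgue. g (\<gamma> s) * area \<gamma> s) = (LINT s:?E|lebesgue. ?h s)"
    by (rule set_lebesgue_integral_spike(2)[OF negligible_boundary_ref_simplex])
       (use ar \<gamma>\<psi> sE in auto)
  also have "\<dots> = (LINT s:?E|lebesgue. ?f s)"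
    using integral_change_of_variables_finite[OF sets_lebesgue_compact[OF compact_ref_simplex] d inj, of ?f]
    unfolding \<psi>E ..
  finally show "(LINT s:?E|lebesgue. g (\<gamma> s) * area \<gamma> s) = (LINT s:?E|lebesgue. ?f s)" .
  have "open (\<psi> ` interior ?E)"
    by (rule invariance_of_domain[OF continuous_on_subset[OF c] open_interior inj_on_subset[OF inj]])
       (auto simp: interior_subset)
  moreover have "\<psi> ` interior ?E \<subseteq> ?E" using \<psi>E interior_subset by blast
  ultimately have "\<psi> ` interior ?E \<subseteq> interior ?E" by (simp add: interior_maximal)
  then show "\<gamma> ` interior ?E \<subseteq> \<gamma>0 ` interior ?E"
    using \<gamma>\<psi> sE by (metis (no_types, opaque_lifting) image_subset_iff imageI)
qed

text \<open>Disposes of the choice operator: any smooth parametrization of the patch computes the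
  integral.\<close>

lemma surface_integral_eq:
  fixes \<gamma>0 :: "real^'e::finite \<Rightarrow> real^'d::finite"
  assumes 0: "smooth_embedding \<gamma>0 ref_simplex" and f: "\<gamma>0 ` ref_simplex = f"
  shows "surface_integral TYPE('e) f g = (LINT s:ref_simplex|lebesgue. g (\<gamma>0 s) * area \<gamma>0 s)"
proof -
  define \<gamma> where "\<gamma> = (SOME \<gamma> :: real^'e \<Rightarrow> real^'d. smooth_embedding \<gamma> ref_simplex \<and> \<gamma> ` ref_simplex = f)"
  have \<gamma>: "smooth_embedding \<gamma> ref_simplex" "\<gamma> ` ref_simplex = f"
    using someI[of "\<lambda>\<gamma> :: real^'e \<Rightarrow> real^'d. smooth_embedding \<gamma> ref_simplex \<and> \<gamma> ` ref_simplex = f" \<gamma>0] 0 f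
    by (auto simp: \<gamma>_def)
  have "surface_integral TYPE('e) f g = (LINT s:ref_simplex|lebesgue. g (\<gamma> s) * area \<gamma> s)"
    unfolding surface_integral_def Let_def area_def \<gamma>_def ..
  also have "\<dots> = (LINT s:ref_simplex|lebesgue. g (\<gamma>0 s) * area \<gamma>0 s)"
    by (rule surface_parameter_change(1)[OF 0 \<gamma>(1)]) (simp add: \<gamma> f)
  finally show ?thesis .
qed

lemma surface_parameter_interior:
  fixes \<gamma> \<gamma>0 :: "real^'e::finite \<Rightarrow> real^'d::finite"
  assumes "smooth_embedding \<gamma>0 ref_simplex" "smooth_embedding \<gamma> ref_simplex"
    "\<gamma> ` ref_simplex = \<gamma>0 ` ref_simplex"
  shows "\<gamma> ` interior ref_simplex = \<gamma>0 ` interior ref_simplex"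
  using surface_parameter_change(2)[OF assms] surface_parameter_change(2)[OF assms(2,1) assms(3)[symmetric]]
  by blast

section \<open>Faces and normals of a curved simplex\<close>

text \<open>\<open>\<alpha>\<close> parametrizes a face of the reference simplex, \<open>L\<close>
  is its linear part and \<open>\<nu>\<close> an outward normal. The normal of the slanted face is
  the all-ones vector, deliberately not of unit length: with this scaling it is the cross product of
  the tangents up to sign.\<close>

definition face_param :: "('e::finite \<Rightarrow> 'd::finite) \<Rightarrow> 'd \<Rightarrow> (real^'e \<Rightarrow> real^'d) \<Rightarrow> (real^'e \<Rightarrow> real^'d) \<Rightarrow> real^'d \<Rightarrow> bool" where
  "face_param \<beta> j \<alpha> L \<nu> \<longleftrightarrow> bij_betw \<beta> UNIV (UNIV - {j}) \<and>
    (\<alpha> = coord_face \<beta> \<and> L = coord_face \<beta> \<and> \<nu> = - axis j 1 \<or>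
     \<alpha> = slant_face \<beta> j \<and> L = (\<lambda>s. coord_face \<beta> s - (\<Sum>a\<in>UNIV. s $ a) *\<^sub>R axis j 1) \<and> \<nu> = 1)"

lemma face_param_affine:
  assumes "face_param \<beta> j \<alpha> L \<nu>"
  shows "\<alpha> s = \<alpha> 0 + L s" "linear L" "inj L" "bounded_linear L" "\<nu> \<noteq> 0"
proof -
  have \<beta>: "bij_betw \<beta> UNIV (UNIV - {j})" using assms by (simp add: face_param_def)
  note n = coord_face_nth[OF \<beta>]
  have nj: "\<beta> a \<noteq> j" for a using \<beta> by (auto simp: bij_betw_def)
  have z: "coord_face \<beta> 0 = 0" by (simp add: coord_face_def)
  have c: "\<alpha> = coord_face \<beta> \<and> L = coord_face \<beta> \<and> \<nu> = - axis j 1 \<or>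
     \<alpha> = slant_face \<beta> j \<and> L = (\<lambda>s. coord_face \<beta> s - (\<Sum>a\<in>UNIV. s $ a) *\<^sub>R axis j 1) \<and> \<nu> = 1"
    using assms by (simp add: face_param_def)
  show "\<alpha> s = \<alpha> 0 + L s" using c by (auto simp: z slant_face_def algebra_simps)
  have l2: "linear (\<lambda>s. coord_face \<beta> s - (\<Sum>a\<in>UNIV. s $ a) *\<^sub>R axis j 1)"
    by (rule linearI) (auto simp: linear_add[OF linear_coord_face] linear_cmul[OF linear_coord_face]
        sum.distrib scaleR_add_left sum_distrib_left[symmetric] scaleR_diff_right)
  then show l: "linear L" using c linear_coord_face by auto
  then show "bounded_linear L" by (simp add: linear_conv_bounded_linear)
  have "L s $ \<beta> a = s $ a" for s a using c n(2)[of s a] nj[of a] by (auto simp: axis_def)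
  then show "inj L" by (metis injI vec_eq_iff)
  show "\<nu> \<noteq> 0" using c by (auto simp: vec_eq_iff axis_def)
qed

lemma sum_axis: "(\<Sum>c\<in>UNIV. axis a (1::real) $ c) = 1"
  by (simp add: axis_def)

lemma inner_vec_one: "c \<bullet> 1 = (\<Sum>i\<in>UNIV. c $ i :: real)"
  by (simp add: inner_vec_def)

text \<open>Verifies for both kinds of faces the cross product property on which
  \<open>sqrt_gram_normal\<close> rests.\<close>

lemma face_param_det:
  assumes "face_param \<beta> j \<alpha> L \<nu>"
  shows "\<bar>rdet (insert_row \<beta> j (\<lambda>a. L (axis a 1)) c)\<bar> = \<bar>c \<bullet> \<nu>\<bar>"
proof -
  have \<beta>: "bij_betw \<beta> UNIV (UNIV - {j})" using assms by (simp add: face_param_def)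
  consider "L = coord_face \<beta>" "\<nu> = - axis j 1"
    | "L = (\<lambda>s. coord_face \<beta> s - (\<Sum>a\<in>UNIV. s $ a) *\<^sub>R axis j 1)" "\<nu> = 1"
    using assms by (auto simp: face_param_def)
  then show ?thesis
  proof cases
    case 1
    then show ?thesis
      by (simp add: coord_face_axis rdet_insert_row_axis[OF \<beta>] inner_axis)
  next
    case 2
    then show ?thesis
      by (simp add: coord_face_axis sum_axis rdet_insert_row_slant[OF \<beta>] inner_vec_one)
  qed
qed

lemma face_param_mem:
  assumes "face_param \<beta> j \<alpha> L \<nu>" and s: "s \<in> ref_simplex"
  shows "\<alpha> s \<in> ref_simplex"
proof -
  have \<beta>: "bij_betw \<beta> UNIV (UNIV - {j})" using assms by (simp add: face_param_def)
  have \<alpha>: "\<alpha> = coord_face \<beta> \<or> \<alpha> = slant_face \<beta> j" using assms by (auto simp: face_param_def)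
  have s1: "(\<Sum>a\<in>UNIV. s $ a) \<le> 1" using s by (simp add: ref_simplex_vec)
  have "coord_face \<beta> s \<in> ref_simplex"
    using coord_split_mem_ref_simplex[OF \<beta>, of s 0] s s1 by simp
  moreover have "slant_face \<beta> j s \<in> ref_simplex"
    unfolding slant_face_def using coord_split_mem_ref_simplex[OF \<beta>, of s] s s1 by simp
  ultimately show ?thesis using \<alpha> by auto
qed

text \<open>At a relatively interior point of a face only the constraint of that face is active; the
  other constraints are strict and remain so on the open set \<open>W\<close>.\<close>

lemma face_param_local_halfspace:
  assumes fp: "face_param \<beta> j \<alpha> L \<nu>" and s: "s \<in> interior ref_simplex"
  obtains r where "r > 0" "\<And>\<eta>. dist \<eta> (\<alpha> s) < r \<Longrightarrow> \<eta> \<in> ref_simplex \<longleftrightarrow> (\<eta> - \<alpha> s) \<bullet> \<nu> \<le> 0"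
proof -
  have \<beta>: "bij_betw \<beta> UNIV (UNIV - {j})" using fp by (simp add: face_param_def)
  note n = coord_face_nth[OF \<beta>]
  have nj: "\<beta> a \<noteq> j" for a using \<beta> by (auto simp: bij_betw_def)
  have cs: "i = j \<or> (\<exists>a. i = \<beta> a)" for i using \<beta> by (auto simp: bij_betw_def)
  have s0: "0 < s $ a" and s1: "(\<Sum>a\<in>UNIV. s $ a) < 1" for a using s by (auto simp: interior_ref_simplex_vec)
  have "\<exists>W. open W \<and> \<alpha> s \<in> W \<and> (\<forall>\<eta>\<in>W. \<eta> \<in> ref_simplex \<longleftrightarrow> (\<eta> - \<alpha> s) \<bullet> \<nu> \<le> 0)"
  proof -
    consider "\<alpha> = coord_face \<beta>" "\<nu> = - axis j 1" | "\<alpha> = slant_face \<beta> j" "\<nu> = 1"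
      using fp by (auto simp: face_param_def)
    then show ?thesis
    proof cases
      case 1
      define W where "W = (\<Inter>a. {\<eta>::real^'b. 0 < \<eta> $ \<beta> a}) \<inter> {\<eta>. (\<Sum>i\<in>UNIV. \<eta> $ i) < 1}"
      have "open W"
        unfolding W_def by (intro open_Int open_INT ballI open_Collect_less continuous_intros) auto
      moreover have "\<alpha> s \<in> W" using s0 s1 by (simp add: W_def 1 n)
      moreover have "\<eta> \<in> ref_simplex \<longleftrightarrow> (\<eta> - \<alpha> s) \<bullet> \<nu> \<le> 0" if "\<eta> \<in> W" for \<eta>
      proof -
        have p: "0 < \<eta> $ \<beta> a" "(\<Sum>i\<in>UNIV. \<eta> $ i) < 1" for a using that by (auto simp: W_def)
        have "(\<eta> - \<alpha> s) \<bullet> \<nu> = - (\<eta> $ j)" by (simp add: 1 n inner_axis)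
        moreover have "(\<forall>i. 0 \<le> \<eta> $ i) \<longleftrightarrow> 0 \<le> \<eta> $ j"
          using cs p(1) by (metis less_imp_le)
        ultimately show ?thesis using p(2) by (simp add: ref_simplex_vec)
      qed
      ultimately show ?thesis by blast
    next
      case 2
      define W where "W = (\<Inter>i. {\<eta>::real^'b. 0 < \<eta> $ i})"
      have "open W"
        unfolding W_def by (intro open_INT ballI open_Collect_less continuous_intros) auto
      moreover have "\<alpha> s \<in> W"
      proof -
        have "0 < \<alpha> s $ i" for i
          using cs[of i] s0 s1 nj n by (auto simp: 2 slant_face_def axis_def)
        then show ?thesis by (simp add: W_def)
      qed
      moreover have "\<eta> \<in> ref_simplex \<longleftrightarrow> (\<eta> - \<alpha> s) \<bullet> \<nu> \<le> 0" if "\<eta> \<in> W" for \<eta>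
      proof -
        have p: "0 \<le> \<eta> $ i" for i using that by (auto simp: W_def less_imp_le)
        have "(\<Sum>i\<in>UNIV. \<alpha> s $ i) = (\<Sum>i\<in>UNIV. coord_face \<beta> s $ i) + (1 - (\<Sum>a\<in>UNIV. s $ a)) * (\<Sum>i\<in>UNIV. axis j (1::real) $ i)"
          by (simp add: 2 slant_face_def sum.distrib sum_distrib_left)
        also have "\<dots> = 1" by (simp add: n(3) sum_axis)
        finally have "(\<eta> - \<alpha> s) \<bullet> \<nu> = (\<Sum>i\<in>UNIV. \<eta> $ i) - 1"
          by (simp add: 2(2) inner_vec_one sum_subtractf)
        then show ?thesis using p by (simp add: ref_simplex_vec)
      qed
      ultimately show ?thesis by blast
    qed
  qed
  then obtain W where W: "open W" "\<alpha> s \<in> W" "\<And>\<eta>. \<eta> \<in> W \<Longrightarrow> \<eta> \<in> ref_simplex \<longleftrightarrow> (\<eta> - \<alpha> s) \<bullet> \<nu> \<le> 0"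
    by blast
  then obtain r where r: "r > 0" "ball (\<alpha> s) r \<subseteq> W" using open_contains_ball by blast
  show thesis
  proof (rule that[OF r(1)])
    fix \<eta> assume "dist \<eta> (\<alpha> s) < r"
    then have "\<eta> \<in> ball (\<alpha> s) r" by (simp add: dist_commute)
    then show "\<eta> \<in> ref_simplex \<longleftrightarrow> (\<eta> - \<alpha> s) \<bullet> \<nu> \<le> 0" using r(2) W(3) by blast
  qed
qed

section \<open>The faces of the reference simplex as sets\<close>

definition coord_facet :: "'d::finite \<Rightarrow> (real^'d) set" where
  "coord_facet j = convex hull (insert 0 Basis - {axis j 1})"

definition slant_facet :: "(real^'d::finite) set" where
  "slant_facet = convex hull (insert 0 Basis - {0})"

lemma Basis_vec_range: "(Basis :: (real^'n::finite) set) = range (\<lambda>i. axis i 1)"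
  by (auto simp: Basis_vec_def)

lemma ref_faces_eq: "ref_faces = insert (slant_facet :: (real^'d::finite) set) (range coord_facet)"
  unfolding ref_faces_def slant_facet_def coord_facet_def[abs_def] by (simp add: Basis_vec_range image_image)

lemma axis_ne_zero: "axis j (1::real) \<noteq> 0"
  by (simp add: axis_eq_0_iff)

lemma coord_face_image:
  assumes \<beta>: "bij_betw \<beta> UNIV (UNIV - {j})"
  shows "coord_face \<beta> ` ref_simplex = coord_facet j"
proof -
  have im: "range \<beta> = UNIV - {j}" using \<beta> by (auto simp: bij_betw_def)
  have "coord_face \<beta> ` (insert 0 Basis) = insert 0 ((\<lambda>i. axis i 1) ` range \<beta>)"
    by (simp add: Basis_vec_range image_image coord_face_axis linear_0[OF linear_coord_face])
  also have "\<dots> = insert 0 Basis - {axis j 1}"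
    unfolding im Basis_vec_range using axis_ne_zero[of j] by (auto simp: axis_eq_axis)
  finally show ?thesis
    unfolding ref_simplex_def coord_facet_def by (simp add: convex_hull_linear_image[OF linear_coord_face])
qed

lemma slant_face_image:
  assumes \<beta>: "bij_betw \<beta> UNIV (UNIV - {j})"
  shows "slant_face \<beta> j ` ref_simplex = slant_facet"
proof -
  define L where "L s = coord_face \<beta> s - (\<Sum>a\<in>UNIV. s $ a) *\<^sub>R axis j 1" for s
  have fp: "face_param \<beta> j (slant_face \<beta> j) L 1" using \<beta> by (auto simp: face_param_def L_def fun_eq_iff)
  have im: "range \<beta> = UNIV - {j}" using \<beta> by (auto simp: bij_betw_def)
  note a = face_param_affine[OF fp]
  have s0: "slant_face \<beta> j 0 = axis j 1" by (simp add: slant_face_def linear_0[OF linear_coord_face])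
  have "L (axis a 1) = axis (\<beta> a) 1 - axis j 1" for a by (simp add: L_def coord_face_axis sum_axis)
  then have "(+) (axis j 1) ` L ` (insert 0 Basis) = insert (axis j 1) ((\<lambda>i. axis i 1) ` range \<beta>)"
    by (simp add: Basis_vec_range image_image linear_0[OF a(2)])
  also have "\<dots> = (Basis :: (real^_) set)" unfolding im Basis_vec_range by auto
  also have "\<dots> = insert 0 Basis - {0}" using axis_ne_zero by (auto simp: Basis_vec_range)
  finally have *: "(+) (axis j 1) ` L ` (insert 0 Basis) = insert 0 Basis - {0}" .
  have "slant_face \<beta> j ` ref_simplex = (+) (axis j 1) ` L ` (convex hull (insert 0 Basis))"
    unfolding ref_simplex_def image_image using a(1) s0 by (intro image_cong) auto
  also have "\<dots> = convex hull ((+) (axis j 1) ` L ` (insert 0 Basis))"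
    by (simp only: convex_hull_linear_image[OF a(2)] convex_hull_translation)
  finally show ?thesis unfolding slant_facet_def * .
qed

lemma face_param_exists:
  assumes "CARD('e::finite) + 1 = CARD('d::finite)"
  obtains \<beta> :: "'e::finite \<Rightarrow> 'd::finite" where "bij_betw \<beta> UNIV (UNIV - {j})"
proof -
  have "card (UNIV :: 'e set) = card (UNIV - {j} :: 'd set)" using assms by (simp add: card_Diff_singleton)
  then show thesis using finite_same_card_bij[of "UNIV :: 'e set" "UNIV - {j}"] that by auto
qed

lemma face_param_ref_faces:
  assumes card: "CARD('e::finite) + 1 = CARD('d::finite)" and f: "f \<in> (ref_faces :: (real^'d::finite) set set)"
  obtains \<beta> :: "'e::finite \<Rightarrow> 'd::finite" and j \<alpha> L \<nu> where "face_param \<beta> j \<alpha> L \<nu>" "\<alpha> ` ref_simplex = f"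
proof -
  consider "f = slant_facet" | j where "f = coord_facet j" using f by (auto simp: ref_faces_eq)
  then show thesis
  proof cases
    case 1
    obtain \<beta> :: "'e \<Rightarrow> 'd" where \<beta>: "bij_betw \<beta> UNIV (UNIV - {undefined})"
      using face_param_exists[OF card] .
    show thesis
      by (rule that[of \<beta> undefined "slant_face \<beta> undefined" "\<lambda>s. coord_face \<beta> s - (\<Sum>a\<in>UNIV. s $ a) *\<^sub>R axis undefined 1" 1])
         (simp_all add: face_param_def \<beta> slant_face_image[OF \<beta>] 1)
  next
    case 2
    obtain \<beta> :: "'e \<Rightarrow> 'd" where \<beta>: "bij_betw \<beta> UNIV (UNIV - {j})"
      using face_param_exists[OF card] .
    show thesis
      by (rule that[of \<beta> j "coord_face \<beta>" "coord_face \<beta>" "- axis j 1"])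
         (simp_all add: face_param_def \<beta> coord_face_image[OF \<beta>] 2)
  qed
qed

text \<open>The vertex \<open>axis j 1\<close> lies in every facet except
  \<open>coord_facet j\<close>, where the coordinate \<open>j\<close> vanishes. Since faces are
  summed over as a set, coinciding facets would be counted only once.\<close>

lemma facet_distinct:
  assumes card: "CARD('e::finite) + 1 = CARD('d::finite)"
  shows "inj (coord_facet :: 'd::finite \<Rightarrow> _)" "(slant_facet :: (real^'d::finite) set) \<notin> range coord_facet"
    "finite (ref_faces :: (real^'d::finite) set set)" "f \<in> ref_faces \<Longrightarrow> f \<subseteq> (ref_simplex :: (real^'d::finite) set)"
proof -
  have z: "x $ j = 0" if "x \<in> coord_facet j" for x and j :: 'd
  proof -
    obtain \<beta> :: "'e \<Rightarrow> 'd" where \<beta>: "bij_betw \<beta> UNIV (UNIV - {j})" using face_param_exists[OF card] .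
    show ?thesis using that coord_face_nth(1)[OF \<beta>] by (auto simp: coord_face_image[OF \<beta>, symmetric])
  qed
  have v: "0 \<in> coord_facet j" "i \<noteq> j \<Longrightarrow> axis i 1 \<in> coord_facet j" for i j :: 'd
    unfolding coord_facet_def using axis_ne_zero[of j]
    by (auto intro!: hull_inc simp: Basis_vec_range axis_eq_axis)
  show "inj (coord_facet :: 'd \<Rightarrow> _)"
  proof (rule injI, rule ccontr)
    fix i j :: 'd assume e: "coord_facet i = coord_facet j" "i \<noteq> j"
    then have "axis i 1 \<in> coord_facet i" using v(2)[of i j] by simp
    from z[OF this] show False by (simp add: axis_def)
  qed
  show "(slant_facet :: (real^'d) set) \<notin> range coord_facet"
  proof
    assume "(slant_facet :: (real^'d) set) \<in> range coord_facet"
    then obtain j where "(slant_facet :: (real^'d) set) = coord_facet j" by blast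
    moreover have "axis j 1 \<in> (slant_facet :: (real^'d) set)"
      unfolding slant_facet_def using axis_ne_zero[of j] by (auto intro!: hull_inc)
    ultimately have "axis j 1 \<in> coord_facet j" by simp
    from z[OF this] show False by (simp add: axis_def)
  qed
  show "finite (ref_faces :: (real^'d) set set)" by (simp add: ref_faces_eq)
  show "f \<in> ref_faces \<Longrightarrow> f \<subseteq> (ref_simplex :: (real^'d) set)"
    unfolding ref_faces_def ref_simplex_def by (auto intro: subsetD[OF hull_mono, rotated])
qed

section \<open>Charts and the outward normal of a curved element\<close>

definition jac :: "(real^'d::finite \<Rightarrow> real^'d) \<Rightarrow> real^'d \<Rightarrow> real^'d^'d" where
  "jac \<Phi> \<xi> = matrix (fderiv \<Phi> \<xi>)"

definition conormal :: "(real^'d::finite \<Rightarrow> real^'d) \<Rightarrow> real^'d \<Rightarrow> real^'d \<Rightarrow> real^'d" where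
  "conormal \<Phi> \<nu> \<xi> = transpose (matrix_inv (jac \<Phi> \<xi>)) *v \<nu>"

lemma jac_works:
  assumes "smooth_embedding \<Phi> S" "\<xi> \<in> S"
  shows "fderiv \<Phi> \<xi> = (\<lambda>h. jac \<Phi> \<xi> *v h)" "det (jac \<Phi> \<xi>) \<noteq> 0"
    "jac \<Phi> \<xi> ** matrix_inv (jac \<Phi> \<xi>) = mat 1" "matrix_inv (jac \<Phi> \<xi>) ** jac \<Phi> \<xi> = mat 1"
proof -
  note D = smooth_embeddingD[OF assms(1)]
  have l: "linear (fderiv \<Phi> \<xi>)" using has_derivative_linear[OF D(1)[OF assms(2)]] .
  show "fderiv \<Phi> \<xi> = (\<lambda>h. jac \<Phi> \<xi> *v h)"
    unfolding jac_def by (rule matrix_vector_mul(2)[OF l, symmetric])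
  show d: "det (jac \<Phi> \<xi>) \<noteq> 0" unfolding jac_def using det_nz_iff_inj[OF l] D(5)[OF assms(2)] by simp
  show "jac \<Phi> \<xi> ** matrix_inv (jac \<Phi> \<xi>) = mat 1" "matrix_inv (jac \<Phi> \<xi>) ** jac \<Phi> \<xi> = mat 1"
    using matrix_inv_det[OF d] by auto
qed

lemma chart_face:
  fixes \<Phi> :: "real^'d::finite \<Rightarrow> real^'d" and \<alpha> :: "real^'e::finite \<Rightarrow> real^'d"
  assumes \<Phi>: "smooth_embedding \<Phi> ref_simplex" and fp: "face_param \<beta> j \<alpha> L \<nu>"
  shows "smooth_embedding (\<lambda>s. \<Phi> (\<alpha> s)) ref_simplex"
    "s \<in> ref_simplex \<Longrightarrow> area (\<lambda>s. \<Phi> (\<alpha> s)) s = norm (conormal \<Phi> \<nu> (\<alpha> s)) * \<bar>det (jac \<Phi> (\<alpha> s))\<bar>"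
    "s \<in> ref_simplex \<Longrightarrow> conormal \<Phi> \<nu> (\<alpha> s) \<noteq> 0"
proof -
  have \<beta>: "bij_betw \<beta> UNIV (UNIV - {j})" using fp by (simp add: face_param_def)
  note a = face_param_affine[OF fp]
  have eq: "(\<lambda>s. \<Phi> (\<alpha> s)) = (\<lambda>s. \<Phi> (\<alpha> 0 + L s))" using a(1) by metis
  have mem: "\<alpha> 0 + L s \<in> ref_simplex" if "s \<in> ref_simplex" for s
    using face_param_mem[OF fp that] a(1) by metis
  note se1 = smooth_embedding_affine(1)[OF \<Phi> a(4,3) mem]
  have se2: "fderiv (\<lambda>s. \<Phi> (\<alpha> 0 + L s)) s = (\<lambda>h. fderiv \<Phi> (\<alpha> 0 + L s) (L h))" if "s \<in> ref_simplex" for s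
    using smooth_embedding_affine(2)[OF \<Phi> a(4,3), of ref_simplex "\<alpha> 0" s] mem that by blast
  show "smooth_embedding (\<lambda>s. \<Phi> (\<alpha> s)) ref_simplex" unfolding eq by (rule se1)
  assume s: "s \<in> ref_simplex"
  let ?\<xi> = "\<alpha> s"
  note J = jac_works[OF \<Phi> face_param_mem[OF fp s]]
  have "fderiv (\<lambda>s. \<Phi> (\<alpha> s)) s = (\<lambda>h. jac \<Phi> ?\<xi> *v L h)"
    unfolding eq se2[OF s] by (simp add: a(1)[symmetric] J(1))
  then show "area (\<lambda>s. \<Phi> (\<alpha> s)) s = norm (conormal \<Phi> \<nu> ?\<xi>) * \<bar>det (jac \<Phi> ?\<xi>)\<bar>"
    using sqrt_gram_normal(1)[OF \<beta> J(2) a(5), of "\<lambda>a. L (axis a 1)"] face_param_det[OF fp]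
    by (simp add: area_gram conormal_def)
  show "conormal \<Phi> \<nu> ?\<xi> \<noteq> 0"
    unfolding conormal_def
    by (rule sqrt_gram_normal(2)[OF \<beta> J(2) a(5), of "\<lambda>a. L (axis a 1)"]) (rule face_param_det[OF fp])
qed

lemma conormal_inner:
  "h \<bullet> conormal \<Phi> \<nu> \<xi> = (matrix_inv (jac \<Phi> \<xi>) *v h) \<bullet> \<nu>"
  using inner_transpose_mult[of "matrix_inv (jac \<Phi> \<xi>)" \<nu> h] by (simp only: conormal_def inner_commute)

text \<open>Compactness of \<open>S\<close> makes the inverse continuous on the image, and
  continuity upgrades the inverse matrix to a derivative within the image, at boundary points
  too.\<close>

lemma chart_inverse:
  fixes \<Phi> :: "real^'d::finite \<Rightarrow> real^'d"
  assumes \<Phi>: "smooth_embedding \<Phi> S" and S: "compact S"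
  shows "\<xi> \<in> S \<Longrightarrow> inv_into S \<Phi> (\<Phi> \<xi>) = \<xi>" "continuous_on (\<Phi> ` S) (inv_into S \<Phi>)"
    "\<xi> \<in> S \<Longrightarrow> (inv_into S \<Phi> has_derivative (\<lambda>h. matrix_inv (jac \<Phi> \<xi>) *v h)) (at (\<Phi> \<xi>) within \<Phi> ` S)"
proof -
  note D = smooth_embeddingD[OF \<Phi>]
  show i: "\<xi> \<in> S \<Longrightarrow> inv_into S \<Phi> (\<Phi> \<xi>) = \<xi>" for \<xi> using D(4) by simp
  show c: "continuous_on (\<Phi> ` S) (inv_into S \<Phi>)"
    by (rule continuous_on_inv[OF D(3) S]) (use i in auto)
  assume \<xi>: "\<xi> \<in> S"
  note J = jac_works[OF \<Phi> \<xi>]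
  show "(inv_into S \<Phi> has_derivative (\<lambda>h. matrix_inv (jac \<Phi> \<xi>) *v h)) (at (\<Phi> \<xi>) within \<Phi> ` S)"
  proof (rule has_derivative_inverse_within[OF has_derivative_at_withinI[OF D(1)[OF \<xi>]] _ \<xi>])
    show "continuous (at (\<Phi> \<xi>) within \<Phi> ` S) (inv_into S \<Phi>)"
      using c \<xi> by (auto simp: continuous_on_eq_continuous_within)
    show "(\<lambda>h. matrix_inv (jac \<Phi> \<xi>) *v h) \<circ> fderiv \<Phi> \<xi> = id"
      by (simp add: fun_eq_iff J(1,4) matrix_vector_mul_assoc)
  qed (use i in auto)
qed

text \<open>Membership is decided in reference coordinates, where the simplex is locally a
  half-space. The two clauses of the definition need two inverses of the chart, both with the
  inverse Jacobian as derivative: the inverse on the element for points known to belong to it, and a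
  local inverse on a full neighbourhood for points that have to be shown to belong to it. Either way
  the reference displacement has inner product with \<open>\<nu>\<close> equal to
  \<open>h \<bullet> N\<close> up to \<open>o(norm h)\<close>.\<close>

lemma is_outward_normal_chart:
  fixes \<Phi> :: "real^'d::finite \<Rightarrow> real^'d" and \<alpha> :: "real^'e::finite \<Rightarrow> real^'d"
  assumes \<Phi>: "smooth_embedding \<Phi> ref_simplex" and fp: "face_param \<beta> j \<alpha> L \<nu>"
    and s: "s \<in> interior ref_simplex"
  shows "is_outward_normal (\<Phi> ` ref_simplex) (\<Phi> (\<alpha> s)) (conormal \<Phi> \<nu> (\<alpha> s) /\<^sub>R norm (conormal \<Phi> \<nu> (\<alpha> s)))"
proof -
  let ?S = "ref_simplex :: (real^'d) set"
  define \<xi> where "\<xi> = \<alpha> s"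
  define N where "N = conormal \<Phi> \<nu> \<xi>"
  have sE: "s \<in> ref_simplex" using s interior_subset by blast
  have \<xi>S: "\<xi> \<in> ?S" unfolding \<xi>_def by (rule face_param_mem[OF fp sE])
  have N0: "norm N > 0" using chart_face(3)[OF \<Phi> fp sE] by (simp add: N_def \<xi>_def)
  have \<nu>0: "norm \<nu> > 0" using face_param_affine(5)[OF fp] by simp
  obtain r where r: "r > 0" "\<And>\<eta>. dist \<eta> (\<alpha> s) < r \<Longrightarrow> \<eta> \<in> ?S \<longleftrightarrow> (\<eta> - \<alpha> s) \<bullet> \<nu> \<le> 0"
    by (rule face_param_local_halfspace[OF fp s]) (rule that)
  note r = r[folded \<xi>_def]
  note D = smooth_embeddingD[OF \<Phi>] and J = jac_works[OF \<Phi> \<xi>S]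
  let ?I = "matrix_inv (jac \<Phi> \<xi>)"
  have IN: "(?I *v h) \<bullet> \<nu> = h \<bullet> N" for h
    by (simp add: N_def conormal_inner)
  have IJ: "(\<lambda>h. ?I *v h) \<circ> fderiv \<Phi> \<xi> = id"
    by (simp add: fun_eq_iff J(1,4) matrix_vector_mul_assoc)
  obtain U where U: "open U" "?S \<subseteq> U" and C: "\<And>m. Ck_on m \<Phi> U"
    using \<Phi> unfolding smooth_embedding_def by blast
  note DU = Ck_on_2D[OF U(1) C]
  have \<xi>U: "\<xi> \<in> U" using \<xi>S U by blast
  have bl: "bounded_linear (fderiv \<Phi> x)" if "x \<in> U" for x
    using has_derivative_bounded_linear[OF DU(1)[OF that]] .
  obtain U' V g g' where iv: "open U'" "U' \<subseteq> U" "\<xi> \<in> U'" "open V" "\<Phi> \<xi> \<in> V" "homeomorphism U' V \<Phi> g"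
    "\<And>y. y \<in> V \<Longrightarrow> (g has_derivative (g' y)) (at y)"
    "\<And>y. y \<in> V \<Longrightarrow> g' y = inv (blinfun_apply (Blinfun (fderiv \<Phi> (g y))))"
  proof (rule inverse_function_theorem[OF U(1), of \<Phi> "\<lambda>x. Blinfun (fderiv \<Phi> x)" \<xi> "Blinfun (\<lambda>h. ?I *v h)"])
    show "(\<Phi> has_derivative blinfun_apply (Blinfun (fderiv \<Phi> x))) (at x)" if "x \<in> U" for x
      using DU(1)[OF that] bl[OF that] by (simp add: bounded_linear_Blinfun_apply)
    show "continuous_on U (\<lambda>x. Blinfun (fderiv \<Phi> x))"
    proof (rule continuous_on_blinfun_componentwise)
      fix i :: "real^'d"
      show "continuous_on U (\<lambda>x. blinfun_apply (Blinfun (fderiv \<Phi> x)) i)"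
        using DU(4)[of i] bl by (simp add: bounded_linear_Blinfun_apply cong: continuous_on_cong)
    qed
    show "\<xi> \<in> U" by (rule \<xi>U)
    have "bounded_linear (\<lambda>h. ?I *v h)" by (rule matrix_vector_mul_bounded_linear)
    then show "Blinfun (\<lambda>h. ?I *v h) o\<^sub>L Blinfun (fderiv \<Phi> \<xi>) = id_blinfun"
      using bl[OF \<xi>U] IJ by (intro blinfun_eqI) (simp add: bounded_linear_Blinfun_apply blinfun_compose.rep_eq fun_eq_iff)
  qed (rule that; assumption)
  have g\<xi>: "g (\<Phi> \<xi>) = \<xi>" using iv(3,6) by (simp add: homeomorphism_def)
  have "inv (fderiv \<Phi> \<xi>) = (\<lambda>h. ?I *v h)"
    by (rule inv_equality) (simp_all add: J matrix_vector_mul_assoc)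
  then have "g' (\<Phi> \<xi>) = (\<lambda>h. ?I *v h)"
    using iv(8)[OF iv(5)] bl[OF \<xi>U] by (simp add: g\<xi> bounded_linear_Blinfun_apply)
  then have dg: "(g has_derivative (\<lambda>h. ?I *v h)) (at (\<Phi> \<xi>))" using iv(7)[OF iv(5)] by simp
  define i where "i = inv_into ?S \<Phi>"
  note i\<Phi> = chart_inverse(1)[OF \<Phi> compact_ref_simplex, folded i_def]
    and ci = chart_inverse(2)[OF \<Phi> compact_ref_simplex, folded i_def]
    and di = chart_inverse(3)[OF \<Phi> compact_ref_simplex \<xi>S, folded i_def]
  \<comment> \<open>The tolerance carries the factor \<open>norm N / norm \<nu>\<close> because the
    error of the derivative is tested against \<open>\<nu>\<close>, whereas the claim concerns
    \<open>N\<close> divided by its norm.\<close>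
  have est: "\<bar>(\<eta> - \<xi>) \<bullet> \<nu> - h \<bullet> N\<bar> \<le> e * norm N * norm h"
    if "norm (\<eta> - \<xi> - ?I *v h) \<le> e * norm N / norm \<nu> * norm h" for \<eta> h e
  proof -
    have "(\<eta> - \<xi>) \<bullet> \<nu> - h \<bullet> N = (\<eta> - \<xi> - ?I *v h) \<bullet> \<nu>" by (simp add: inner_diff_left IN)
    also have "\<bar>\<dots>\<bar> \<le> norm (\<eta> - \<xi> - ?I *v h) * norm \<nu>" by (rule Cauchy_Schwarz_ineq2)
    also have "\<dots> \<le> e * norm N / norm \<nu> * norm h * norm \<nu>" using that by (intro mult_right_mono) auto
    finally show ?thesis using \<nu>0 by (simp add: field_simps)
  qed
  show ?thesis
    unfolding is_outward_normal_def \<xi>_def[symmetric] N_def[symmetric]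
  proof (intro conjI allI impI)
    show "norm (N /\<^sub>R norm N) = 1" using N0 by simp
    fix e :: real assume e: "e > 0"
    define \<delta> where "\<delta> = e * norm N / norm \<nu>"
    have \<delta>: "\<delta> > 0" using e N0 \<nu>0 by (simp add: \<delta>_def)
    obtain d1 where d1: "d1 > 0" "\<And>y. y \<in> \<Phi> ` ?S \<Longrightarrow> norm (y - \<Phi> \<xi>) < d1 \<Longrightarrow>
        norm (i y - i (\<Phi> \<xi>) - ?I *v (y - \<Phi> \<xi>)) \<le> \<delta> * norm (y - \<Phi> \<xi>)"
      using di \<delta> unfolding has_derivative_within_alt by blast
    obtain d2 where d2: "d2 > 0" "\<And>y. norm (y - \<Phi> \<xi>) < d2 \<Longrightarrow>
        norm (g y - g (\<Phi> \<xi>) - ?I *v (y - \<Phi> \<xi>)) \<le> \<delta> * norm (y - \<Phi> \<xi>)"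
      using dg \<delta> unfolding has_derivative_at_alt by blast
    obtain d3 where d3: "d3 > 0" "ball (\<Phi> \<xi>) d3 \<subseteq> V" using iv(4,5) open_contains_ball by blast
    have "isCont g (\<Phi> \<xi>)" using has_derivative_continuous[OF dg] by simp
    then obtain d4 where d4: "d4 > 0" "\<And>y. dist y (\<Phi> \<xi>) < d4 \<Longrightarrow> dist (g y) (g (\<Phi> \<xi>)) < r"
      using r(1) unfolding continuous_at_eps_delta by blast
    have "continuous (at (\<Phi> \<xi>) within \<Phi> ` ?S) i"
      using ci \<xi>S by (auto simp: continuous_on_eq_continuous_within)
    then obtain d5 where d5: "d5 > 0" "\<And>y. y \<in> \<Phi> ` ?S \<Longrightarrow> dist y (\<Phi> \<xi>) < d5 \<Longrightarrow> dist (i y) (i (\<Phi> \<xi>)) < r"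
      using r(1) unfolding continuous_within_eps_delta by blast
    define d where "d = min (min d1 d2) (min d3 (min d4 d5))"
    have d: "d > 0" using d1 d2 d3 d4 d5 by (simp add: d_def)
    have main: "(y \<in> \<Phi> ` ?S \<longrightarrow> (y - \<Phi> \<xi>) \<bullet> (N /\<^sub>R norm N) \<le> e * norm (y - \<Phi> \<xi>)) \<and>
        ((y - \<Phi> \<xi>) \<bullet> (N /\<^sub>R norm N) \<le> - e * norm (y - \<Phi> \<xi>) \<longrightarrow> y \<in> \<Phi> ` ?S)"
      if y: "dist y (\<Phi> \<xi>) < d" for y
    proof (intro conjI impI)
      let ?h = "y - \<Phi> \<xi>"
      have hN: "?h \<bullet> (N /\<^sub>R norm N) = (?h \<bullet> N) / norm N" by (simp add: field_simps)
      { assume yD: "y \<in> \<Phi> ` ?S"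
        then obtain \<eta> where \<eta>: "\<eta> \<in> ?S" "y = \<Phi> \<eta>" by blast
        have iy: "i y = \<eta>" using \<eta> i\<Phi> by simp
        have "dist \<eta> \<xi> < r" using d5(2)[OF yD] y iy i\<Phi>[OF \<xi>S] by (simp add: d_def)
        then have neg: "(\<eta> - \<xi>) \<bullet> \<nu> \<le> 0" using r(2) \<eta> by blast
        have "norm (\<eta> - \<xi> - ?I *v ?h) \<le> e * norm N / norm \<nu> * norm ?h"
          using d1(2)[OF yD] y iy i\<Phi>[OF \<xi>S] by (simp add: d_def dist_norm \<delta>_def)
        from est[OF this] neg have "?h \<bullet> N \<le> e * norm ?h * norm N" by (simp add: algebra_simps)
        then show "?h \<bullet> (N /\<^sub>R norm N) \<le> e * norm ?h" unfolding hN using N0 by (simp add: field_simps) }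
      { assume "?h \<bullet> (N /\<^sub>R norm N) \<le> - e * norm ?h"
        then have neg: "?h \<bullet> N \<le> - (e * norm N * norm ?h)" unfolding hN using N0 by (simp add: field_simps)
        have "norm (g y - \<xi> - ?I *v ?h) \<le> e * norm N / norm \<nu> * norm ?h"
          using d2(2)[of y] y by (simp add: d_def dist_norm \<delta>_def g\<xi>)
        from est[OF this] neg have "(g y - \<xi>) \<bullet> \<nu> \<le> 0" by linarith
        moreover have "dist (g y) \<xi> < r" using d4(2)[of y] y by (simp add: d_def g\<xi>)
        ultimately have "g y \<in> ?S" using r(2) by blast
        moreover have "\<Phi> (g y) = y"
        proof -
          have "y \<in> V" using d3(2) y by (auto simp: d_def dist_commute)
          then show ?thesis using iv(6) by (simp add: homeomorphism_def)
        qed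
        ultimately show "y \<in> \<Phi> ` ?S" by (metis imageI) }
    qed
    show "\<forall>\<^sub>F y in at (\<Phi> \<xi>). (y \<in> \<Phi> ` ?S \<longrightarrow> (y - \<Phi> \<xi>) \<bullet> (N /\<^sub>R norm N) \<le> e * norm (y - \<Phi> \<xi>)) \<and>
        ((y - \<Phi> \<xi>) \<bullet> (N /\<^sub>R norm N) \<le> - e * norm (y - \<Phi> \<xi>) \<longrightarrow> y \<in> \<Phi> ` ?S)"
      unfolding eventually_at using d main by blast
  qed
qed

lemma outward_normal_eq:
  assumes "is_outward_normal D x n"
  shows "outward_normal D x = n"
  unfolding outward_normal_def using assms is_outward_normal_unique[OF _ assms] by (rule the_equality)

section \<open>Divergence theorem on a curved simplex\<close>

lemma set_integrable_continuous_compact: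
  fixes f :: "'a::euclidean_space \<Rightarrow> real"
  assumes "compact S" "continuous_on S f"
  shows "set_integrable lebesgue S f"
proof -
  have "integrable lborel (\<lambda>x. indicator S x *\<^sub>R f x)" by (rule borel_integrable_compact[OF assms])
  then show ?thesis
    unfolding set_integrable_def by (subst integrable_completion) (auto dest: borel_measurable_integrable)
qed

lemma set_lebesgue_integral_sum:
  fixes f :: "'i \<Rightarrow> 'a \<Rightarrow> real"
  assumes "\<And>i. i \<in> I \<Longrightarrow> set_integrable M A (f i)"
  shows "(LINT x:A|M. (\<Sum>i\<in>I. f i x)) = (\<Sum>i\<in>I. LINT x:A|M. f i x)"
  using assms unfolding set_lebesgue_integral_def set_integrable_def
  by (simp add: scaleR_sum_right sum_distrib_left Bochner_Integration.integral_sum)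

lemma continuous_on_jac:
  assumes "smooth_embedding \<Phi> S"
  shows "continuous_on S (\<lambda>\<xi>. column m (jac \<Phi> \<xi>))" "continuous_on S (\<lambda>\<xi>. det (jac \<Phi> \<xi>))"
proof -
  have c: "column m (jac \<Phi> \<xi>) = fderiv \<Phi> \<xi> (axis m 1)" for m \<xi>
    by (simp add: column_def jac_def matrix_def vec_eq_iff)
  show 1: "continuous_on S (\<lambda>\<xi>. column m (jac \<Phi> \<xi>))" for m
    unfolding c by (rule smooth_embeddingD(2)[OF assms])
  have "det (jac \<Phi> \<xi>) = rdet (\<lambda>m. column m (jac \<Phi> \<xi>))" for \<xi>
  proof -
    have "(\<chi> m. column m (jac \<Phi> \<xi>)) = transpose (jac \<Phi> \<xi>)" by (simp add: column_def transpose_def vec_eq_iff)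
    then show ?thesis by (simp add: rdet_def)
  qed
  then show "continuous_on S (\<lambda>\<xi>. det (jac \<Phi> \<xi>))"
    by (simp only:) (rule continuous_on_rdet[OF 1])
qed

text \<open>Cramer's rule for the inverse: its entries are quotients of determinants, and so they
  inherit continuity and measurability from the entries of the matrix.\<close>

lemma matrix_inv_nth:
  fixes B :: "real^'d::finite^'d"
  assumes "det B \<noteq> 0"
  shows "(matrix_inv B *v w) $ i = rdet ((\<lambda>m. column m B)(i := w)) / det B"
proof -
  have "B *v (matrix_inv B *v w) = w" by (simp add: matrix_vector_mul_assoc matrix_inv_det[OF assms])
  then show ?thesis using rdet_replace[of B i "matrix_inv B *v w"] assms by simp
qed

lemma continuous_on_jac_inv:
  fixes \<Phi> :: "real^'d::finite \<Rightarrow> real^'d"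
  assumes \<Phi>: "smooth_embedding \<Phi> S" and w: "continuous_on S w"
  shows "continuous_on S (\<lambda>\<xi>. matrix_inv (jac \<Phi> \<xi>) *v w \<xi>)"
proof -
  have "continuous_on S (\<lambda>\<xi>. (matrix_inv (jac \<Phi> \<xi>) *v w \<xi>) $ i)" for i
  proof -
    have "continuous_on S (\<lambda>\<xi>. rdet (\<lambda>m. ((\<lambda>m. column m (jac \<Phi> \<xi>))(i := w \<xi>)) m) / det (jac \<Phi> \<xi>))"
    proof (intro continuous_on_divide continuous_on_rdet continuous_on_jac(2)[OF \<Phi>])
      show "continuous_on S (\<lambda>\<xi>. ((\<lambda>m. column m (jac \<Phi> \<xi>))(i := w \<xi>)) m)" for m
        by (cases "m = i") (simp_all add: continuous_on_jac(1)[OF \<Phi>] w)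
    qed (use jac_works(2)[OF \<Phi>] in auto)
    then show ?thesis
      by (rule continuous_on_eq) (simp add: matrix_inv_nth jac_works(2)[OF \<Phi>] fun_upd_def)
  qed
  then have "continuous_on S (\<lambda>\<xi>. \<chi> i. (matrix_inv (jac \<Phi> \<xi>) *v w \<xi>) $ i)"
    by (rule continuous_on_vec_lambda)
  then show ?thesis by simp
qed

text \<open>A continuous function without zeros on a connected set keeps its sign. The constant
  \<open>c\<close> thus takes over from the absolute value, and what remains is a determinant that
  can be differentiated.\<close>

lemma det_jac_sign:
  fixes \<Phi> :: "real^'d::finite \<Rightarrow> real^'d"
  assumes \<Phi>: "smooth_embedding \<Phi> S" and S: "convex S"
  obtains c :: real where "c = 1 \<or> c = - 1" "\<And>\<xi>. \<xi> \<in> S \<Longrightarrow> \<bar>det (jac \<Phi> \<xi>)\<bar> = c * det (jac \<Phi> \<xi>)"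
proof -
  let ?f = "\<lambda>\<xi>. det (jac \<Phi> \<xi>)"
  have con: "connected (?f ` S)"
    by (rule connected_continuous_image[OF continuous_on_jac(2)[OF \<Phi>] convex_connected[OF S]])
  have nz: "0 \<notin> ?f ` S" using jac_works(2)[OF \<Phi>] by auto
  have "(\<forall>\<xi>\<in>S. ?f \<xi> > 0) \<or> (\<forall>\<xi>\<in>S. ?f \<xi> < 0)"
  proof (rule ccontr)
    assume "\<not> ((\<forall>\<xi>\<in>S. ?f \<xi> > 0) \<or> (\<forall>\<xi>\<in>S. ?f \<xi> < 0))"
    then obtain \<xi> \<eta> where "\<xi> \<in> S" "\<eta> \<in> S" "?f \<xi> \<le> 0" "0 \<le> ?f \<eta>" by (meson not_less)
    then have "0 \<in> ?f ` S" using connectedD_interval[OF con, of "?f \<xi>" "?f \<eta>" 0] by blast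
    with nz show False by contradiction
  qed
  then show thesis
  proof
    assume *: "\<forall>\<xi>\<in>S. ?f \<xi> > 0"
    show thesis by (rule that[of 1]) (use * in auto)
  next
    assume *: "\<forall>\<xi>\<in>S. ?f \<xi> < 0"
    show thesis by (rule that[of "- 1"]) (use * in auto)
  qed
qed

lemma open_chart_interior:
  fixes \<Phi> :: "'a::euclidean_space \<Rightarrow> 'a"
  assumes \<Phi>: "smooth_embedding \<Phi> S"
  shows "open (\<Phi> ` interior S)" "\<Phi> ` interior S \<subseteq> interior (\<Phi> ` S)"
proof -
  note D = smooth_embeddingD[OF \<Phi>]
  show o: "open (\<Phi> ` interior S)"
    by (rule invariance_of_domain[OF continuous_on_subset[OF D(3) interior_subset] open_interior
          inj_on_subset[OF D(4) interior_subset]])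
  show "\<Phi> ` interior S \<subseteq> interior (\<Phi> ` S)"
    by (rule interior_maximal[OF image_mono[OF interior_subset] o])
qed

text \<open>The image of an interior point is interior to the element, where the derivative within
  the element is a full one and therefore unique; the chain rule with the inverse chart computes
  it.\<close>

lemma frechet_derivative_chart:
  fixes \<Phi> :: "real^'d::finite \<Rightarrow> real^'d"
  assumes \<Phi>: "smooth_embedding \<Phi> S" and S: "compact S" and \<xi>: "\<xi> \<in> interior S"
    and u: "\<And>\<eta>. \<eta> \<in> S \<Longrightarrow> u (\<Phi> \<eta>) = uh \<eta>" and uh: "(uh has_derivative uh') (at \<xi>)"
  shows "frechet_derivative u (at (\<Phi> \<xi>) within \<Phi> ` S) = (\<lambda>h. uh' (matrix_inv (jac \<Phi> \<xi>) *v h))"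
proof -
  have \<xi>S: "\<xi> \<in> S" using \<xi> interior_subset by blast
  note i = chart_inverse[OF \<Phi> S]
  have "\<Phi> \<xi> \<in> interior (\<Phi> ` S)" using open_chart_interior(2)[OF \<Phi>] \<xi> by blast
  then have at: "at (\<Phi> \<xi>) within \<Phi> ` S = at (\<Phi> \<xi>)" by (rule at_within_interior)
  have "(uh has_derivative uh') (at (inv_into S \<Phi> (\<Phi> \<xi>)) within inv_into S \<Phi> ` (\<Phi> ` S))"
    using has_derivative_at_withinI[OF uh] by (simp add: i(1)[OF \<xi>S])
  from diff_chain_within[OF i(3)[OF \<xi>S] this]
  have "((uh \<circ> inv_into S \<Phi>) has_derivative (uh' \<circ> (\<lambda>h. matrix_inv (jac \<Phi> \<xi>) *v h))) (at (\<Phi> \<xi>) within \<Phi> ` S)" .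
  then have "(u has_derivative (uh' \<circ> (\<lambda>h. matrix_inv (jac \<Phi> \<xi>) *v h))) (at (\<Phi> \<xi>) within \<Phi> ` S)"
    by (rule has_derivative_transform[rotated 2]) (use \<xi>S i(1) u in auto)
  then show ?thesis
    unfolding at by (simp add: frechet_derivative_at[symmetric] o_def)
qed

text \<open>The norm of the conormal occurs in the area element and, inverted, in the unit normal.
  It cancels, and what is left is the reference flux of the Piola transform.\<close>

lemma flux_chart:
  fixes \<Phi> :: "real^'d::finite \<Rightarrow> real^'d" and \<alpha> :: "real^'e::finite \<Rightarrow> real^'d"
  assumes \<Phi>: "smooth_embedding \<Phi> ref_simplex" and fp: "face_param \<beta> j \<alpha> L \<nu>"
    and f: "f = \<Phi> ` \<alpha> ` ref_simplex" and F: "\<And>\<xi>. \<xi> \<in> ref_simplex \<Longrightarrow> F (\<Phi> \<xi>) = Fh \<xi>"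
  shows "surface_integral TYPE('e) f (\<lambda>x. F x \<bullet> outward_normal (\<Phi> ` ref_simplex) x) =
    (LINT s:ref_simplex|lebesgue. ((matrix_inv (jac \<Phi> (\<alpha> s)) *v Fh (\<alpha> s)) \<bullet> \<nu>) * \<bar>det (jac \<Phi> (\<alpha> s))\<bar>)"
proof -
  let ?\<gamma> = "\<lambda>s. \<Phi> (\<alpha> s)" and ?N = "\<lambda>s. conormal \<Phi> \<nu> (\<alpha> s)"
  have "surface_integral TYPE('e) f (\<lambda>x. F x \<bullet> outward_normal (\<Phi> ` ref_simplex) x) =
      (LINT s:ref_simplex|lebesgue. (F (?\<gamma> s) \<bullet> outward_normal (\<Phi> ` ref_simplex) (?\<gamma> s)) * area ?\<gamma> s)"
    by (rule surface_integral_eq[OF chart_face(1)[OF \<Phi> fp]]) (simp add: f image_image)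
  also have "\<dots> = (LINT s:ref_simplex|lebesgue. ((matrix_inv (jac \<Phi> (\<alpha> s)) *v Fh (\<alpha> s)) \<bullet> \<nu>) * \<bar>det (jac \<Phi> (\<alpha> s))\<bar>)"
  proof (rule set_lebesgue_integral_spike(2)[OF negligible_boundary_ref_simplex])
    fix s :: "real^'e" assume "s \<in> ref_simplex - (ref_simplex - interior ref_simplex)"
    then have s: "s \<in> interior ref_simplex" "s \<in> ref_simplex" by auto
    have n: "outward_normal (\<Phi> ` ref_simplex) (?\<gamma> s) = ?N s /\<^sub>R norm (?N s)"
      by (rule outward_normal_eq[OF is_outward_normal_chart[OF \<Phi> fp s(1)]])
    have "F (?\<gamma> s) = Fh (\<alpha> s)" by (rule F[OF face_param_mem[OF fp s(2)]])
    then show "(F (?\<gamma> s) \<bullet> outward_normal (\<Phi> ` ref_simplex) (?\<gamma> s)) * area ?\<gamma> s =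
        ((matrix_inv (jac \<Phi> (\<alpha> s)) *v Fh (\<alpha> s)) \<bullet> \<nu>) * \<bar>det (jac \<Phi> (\<alpha> s))\<bar>"
      using chart_face(3)[OF \<Phi> fp s(2)]
      by (simp add: n chart_face(2)[OF \<Phi> fp s(2)] conormal_inner[symmetric])
  qed
  finally show ?thesis .
qed

text \<open>Integrating along different axes yields the slanted face in different parametrizations.
  Seen as a surface with the identity chart, it has the same constant area element
  \<open>\<kappa>\<close> in each of them, so independence of the surface integral gives the claim
  after division by \<open>\<kappa>\<close>.\<close>

lemma integral_slant_face_indep:
  fixes \<beta> \<beta>' :: "'e::finite \<Rightarrow> 'd::finite" and g :: "real^'d \<Rightarrow> real"
  assumes \<beta>: "bij_betw \<beta> UNIV (UNIV - {j})" and \<beta>': "bij_betw \<beta>' UNIV (UNIV - {j'})"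
  shows "(LINT s:ref_simplex|lebesgue. g (slant_face \<beta> j s)) = (LINT s:ref_simplex|lebesgue. g (slant_face \<beta>' j' s))"
proof -
  let ?id = "\<lambda>x::real^'d. x"
  define \<kappa> where "\<kappa> = norm (1 :: real^'d)"
  have "(1 :: real^'d) \<noteq> 0" by (simp add: vec_eq_iff)
  then have \<kappa>: "\<kappa> \<noteq> 0" by (simp add: \<kappa>_def)
  note id = smooth_embedding_ident[of "ref_simplex :: (real^'d) set"]
  have "fderiv ?id x = (\<lambda>h. h)" for x :: "real^'d" by (rule frechet_derivative_ident)
  then have jac: "jac ?id x = mat 1" for x by (simp add: jac_def matrix_def mat_def axis_def vec_eq_iff)
  have "matrix_inv (mat 1 :: real^'d^'d) = mat 1"
    using matrix_inv_det(1)[of "mat 1 :: real^'d^'d"] by simp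
  then have con: "conormal ?id \<nu> x = \<nu>" for \<nu> x by (simp add: conormal_def jac)
  have fp: "face_param \<beta> j (slant_face \<beta> j) (\<lambda>s. coord_face \<beta> s - (\<Sum>a\<in>UNIV. s $ a) *\<^sub>R axis j 1) 1"
    "face_param \<beta>' j' (slant_face \<beta>' j') (\<lambda>s. coord_face \<beta>' s - (\<Sum>a\<in>UNIV. s $ a) *\<^sub>R axis j' 1) 1"
    using \<beta> \<beta>' by (simp_all add: face_param_def)
  have ar: "s \<in> ref_simplex \<Longrightarrow> area (slant_face \<beta> j) s = \<kappa>" "s \<in> ref_simplex \<Longrightarrow> area (slant_face \<beta>' j') s = \<kappa>" for s
    using chart_face(2)[OF id fp(1), of s] chart_face(2)[OF id fp(2), of s] by (simp_all add: con jac \<kappa>_def)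
  have se: "smooth_embedding (slant_face \<beta> j) ref_simplex" "smooth_embedding (slant_face \<beta>' j') ref_simplex"
    using chart_face(1)[OF id fp(1)] chart_face(1)[OF id fp(2)] by auto
  have "(LINT s:ref_simplex|lebesgue. g (slant_face \<beta> j s) * area (slant_face \<beta> j) s) =
      (LINT s:ref_simplex|lebesgue. g (slant_face \<beta>' j' s) * area (slant_face \<beta>' j') s)"
    by (rule surface_parameter_change(1)[OF se(2,1)]) (simp add: slant_face_image[OF \<beta>] slant_face_image[OF \<beta>'])
  moreover have "(LINT s:ref_simplex|lebesgue. g (slant_face \<beta> j s) * area (slant_face \<beta> j) s) =
      (LINT s:ref_simplex|lebesgue. g (slant_face \<beta> j s) * \<kappa>)"
    by (rule set_lebesgue_integral_spike(2)[of "{}"]) (simp_all add: ar)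
  moreover have "(LINT s:ref_simplex|lebesgue. g (slant_face \<beta>' j' s) * area (slant_face \<beta>' j') s) =
      (LINT s:ref_simplex|lebesgue. g (slant_face \<beta>' j' s) * \<kappa>)"
    by (rule set_lebesgue_integral_spike(2)[of "{}"]) (simp_all add: ar)
  ultimately show ?thesis using \<kappa> by simp
qed

lemma sum_chart_faces:
  fixes \<Phi> :: "real^'d::finite \<Rightarrow> real^'d"
  assumes card: "CARD('e::finite) + 1 = CARD('d)" and inj: "inj_on \<Phi> ref_simplex"
  shows "(\<Sum>f\<in>(`) \<Phi> ` ref_faces. G f) = G (\<Phi> ` slant_facet) + (\<Sum>j\<in>UNIV. G (\<Phi> ` coord_facet j))"
proof -
  note d = facet_distinct[OF card]
  have "inj_on ((`) \<Phi>) ref_faces"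
    using d(4) inj_on_image_eq_iff[OF inj] by (auto simp: inj_on_def)
  then have "(\<Sum>f\<in>(`) \<Phi> ` ref_faces. G f) = (\<Sum>f\<in>ref_faces. G (\<Phi> ` f))"
    by (simp add: sum.reindex)
  also have "\<dots> = G (\<Phi> ` slant_facet) + (\<Sum>f\<in>range coord_facet. G (\<Phi> ` f))"
    unfolding ref_faces_eq using d(2) by simp
  also have "(\<Sum>f\<in>range coord_facet. G (\<Phi> ` f)) = (\<Sum>j\<in>UNIV. G (\<Phi> ` coord_facet j))"
    using d(1) by (simp add: sum.reindex)
  finally show ?thesis .
qed

theorem element_divergence:
  fixes \<Phi> F :: "real^'d::finite \<Rightarrow> real^'d"
  assumes card: "CARD('e::finite) + 1 = CARD('d)" and \<Phi>: "smooth_embedding \<Phi> ref_simplex"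
    and F: "\<And>\<xi>. \<xi> \<in> ref_simplex \<Longrightarrow> F (\<Phi> \<xi>) = Fh \<xi>"
    and Fh: "\<And>\<xi>. (Fh has_derivative Fh' \<xi>) (at \<xi>)" and Fh': "\<And>h. continuous_on UNIV (\<lambda>\<xi>. Fh' \<xi> h)"
  shows "(LINT x:\<Phi> ` ref_simplex|lebesgue.
      \<Sum>i\<in>UNIV. frechet_derivative F (at x within \<Phi> ` ref_simplex) (axis i 1) $ i) =
    (\<Sum>f\<in>(`) \<Phi> ` ref_faces. surface_integral TYPE('e) f (\<lambda>x. F x \<bullet> outward_normal (\<Phi> ` ref_simplex) x))"
proof -
  let ?S = "ref_simplex :: (real^'d) set" and ?E = "ref_simplex :: (real^'e) set"
  let ?B = "jac \<Phi>" and ?I = "\<lambda>\<xi>. matrix_inv (jac \<Phi> \<xi>)"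
  note D = smooth_embeddingD[OF \<Phi>] and J = jac_works[OF \<Phi>]
  obtain U where U: "open U" "?S \<subseteq> U" and C: "\<And>m. Ck_on m \<Phi> U"
    using \<Phi> unfolding smooth_embedding_def by blast
  obtain c :: real where c: "c = 1 \<or> c = - 1" "\<And>\<xi>. \<xi> \<in> ?S \<Longrightarrow> \<bar>det (?B \<xi>)\<bar> = c * det (?B \<xi>)"
    by (rule det_jac_sign[OF \<Phi> convex_ref_simplex]) (rule that)
  have col: "fderiv \<Phi> \<xi> (axis m 1) = column m (?B \<xi>)" for m \<xi>
    by (simp add: column_def jac_def matrix_def vec_eq_iff)
  \<comment> \<open>By Cramer's rule \<open>c * G j\<close> is the component \<open>j\<close> of the
    Piola transform, the field times the inverse Jacobian times its absolute determinant.\<close>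
  define G where "G j \<xi> = rdet ((\<lambda>m. fderiv \<Phi> \<xi> (axis m 1))(j := Fh \<xi>))" for j \<xi>
  obtain G' where
    G0: "\<And>j x. x \<in> U \<Longrightarrow> ((\<lambda>\<xi>. rdet ((\<lambda>m. fderiv \<Phi> \<xi> (axis m 1))(j := Fh \<xi>))) has_derivative G' j x) (at x)" and
    cG': "\<And>j h. continuous_on U (\<lambda>x. G' j x h)" and
    tr: "\<And>x. x \<in> U \<Longrightarrow> (\<Sum>j\<in>UNIV. G' j x (axis j 1)) =
       (\<Sum>j\<in>UNIV. rdet ((\<lambda>m. fderiv \<Phi> x (axis m 1))(j := Fh' x (axis j 1))))"
    by (rule piola[OF U(1) C Fh continuous_on_subset[OF Fh' subset_UNIV]]) (rule that)
  have G: "(G j has_derivative G' j x) (at x)" if "x \<in> U" for j x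
    unfolding G_def[abs_def] by (rule G0[OF that])
  have G_eq: "c * G j \<xi> = (?I \<xi> *v Fh \<xi>) $ j * \<bar>det (?B \<xi>)\<bar>" if "\<xi> \<in> ?S" for j \<xi>
    using matrix_inv_nth[OF J(2)[OF that], of "Fh \<xi>" j] J(2)[OF that] c(2)[OF that]
    by (simp add: G_def col)
  have cG: "continuous_on ?S (G j)" for j
    using G U(2) by (intro has_derivative_continuous_on[where f' = "G' j"]) (auto intro: has_derivative_at_withinI)
  have div: "\<bar>det (matrix (fderiv \<Phi> \<xi>))\<bar> *
      (\<Sum>i\<in>UNIV. frechet_derivative F (at (\<Phi> \<xi>) within \<Phi> ` ?S) (axis i 1) $ i) = c * (\<Sum>j\<in>UNIV. G' j \<xi> (axis j 1))"
    if \<xi>: "\<xi> \<in> interior ?S" for \<xi>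
  proof -
    have \<xi>S: "\<xi> \<in> ?S" using \<xi> interior_subset by blast
    have lin: "linear (Fh' \<xi>)" using has_derivative_linear[OF Fh] .
    \<comment> \<open>The derivative of \<open>F\<close> in physical coordinates. Its trace is the
      divergence, and it maps column \<open>j\<close> of the Jacobian to the derivative of
      \<open>Fh\<close> along \<open>axis j 1\<close>, which is the row inserted by the Piola
      identity.\<close>
    define Mt where "Mt = matrix (Fh' \<xi>) ** ?I \<xi>"
    have Mv: "Mt *v h = Fh' \<xi> (?I \<xi> *v h)" for h
      using matrix_vector_mul(2)[OF lin] by (simp add: Mt_def matrix_vector_mul_assoc[symmetric] fun_eq_iff)
    have "?I \<xi> *v column j (?B \<xi>) = axis j 1" for j
    proof -
      have "column j (?B \<xi>) = ?B \<xi> *v axis j 1" by (simp add: matrix_vector_mult_basis)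
      then show ?thesis by (simp add: matrix_vector_mul_assoc J(4)[OF \<xi>S])
    qed
    then have Mc: "Mt *v column j (?B \<xi>) = Fh' \<xi> (axis j 1)" for j by (simp add: Mv)
    have "(\<Sum>i\<in>UNIV. frechet_derivative F (at (\<Phi> \<xi>) within \<Phi> ` ?S) (axis i 1) $ i) = (\<Sum>i\<in>UNIV. (Mt *v axis i 1) $ i)"
      by (simp only: frechet_derivative_chart[OF \<Phi> compact_ref_simplex \<xi> F Fh] Mv)
    also have "\<dots> = trace Mt" by (simp add: trace_def matrix_vector_mult_basis column_def)
    finally have "\<bar>det (?B \<xi>)\<bar> * (\<Sum>i\<in>UNIV. frechet_derivative F (at (\<Phi> \<xi>) within \<Phi> ` ?S) (axis i 1) $ i) =
        c * (trace Mt * det (?B \<xi>))" by (simp add: c(2)[OF \<xi>S])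
    also have "trace Mt * det (?B \<xi>) = (\<Sum>j\<in>UNIV. G' j \<xi> (axis j 1))"
      using tr[of \<xi>] \<xi>S U(2) rdet_trace[OF J(2)[OF \<xi>S], of Mt] by (auto simp: Mc col)
    finally show ?thesis by (simp add: jac_def)
  qed
  have "\<exists>\<beta> :: 'e \<Rightarrow> 'd. bij_betw \<beta> UNIV (UNIV - {j})" for j
    by (rule face_param_exists[OF card]) blast
  then obtain \<beta> :: "'d \<Rightarrow> 'e \<Rightarrow> 'd" where \<beta>: "\<And>j. bij_betw (\<beta> j) UNIV (UNIV - {j})" by metis
  have coord_mem: "coord_face (\<beta> j) s \<in> ?S" and slant_mem: "slant_face (\<beta> j) j s \<in> ?S" if "s \<in> ?E" for j s
    using face_param_mem[OF _ that, of "\<beta> j" j "coord_face (\<beta> j)"]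
      face_param_mem[OF _ that, of "\<beta> j" j "slant_face (\<beta> j) j"] \<beta> by (auto simp: face_param_def)
  have ci: "set_integrable lebesgue ?E (\<lambda>s. G j (coord_face (\<beta> i) s))"
    and si: "set_integrable lebesgue ?E (\<lambda>s. G j (slant_face (\<beta> i) i s))" for i j
    by (intro set_integrable_continuous_compact compact_ref_simplex continuous_on_compose2[OF cG] continuous_intros;
        use coord_mem slant_mem in blast)+
  \<comment> \<open>Any fixed direction serves: the slanted face needs one parametrization common to
    all \<open>j\<close>, so that the components add up to the flux through it.\<close>
  let ?d = undefined
  have "(LINT x:\<Phi> ` ?S|lebesgue. \<Sum>i\<in>UNIV. frechet_derivative F (at x within \<Phi> ` ?S) (axis i 1) $ i) =
      (LINT \<xi>:?S|lebesgue. \<bar>det (matrix (fderiv \<Phi> \<xi>))\<bar> *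
         (\<Sum>i\<in>UNIV. frechet_derivative F (at (\<Phi> \<xi>) within \<Phi> ` ?S) (axis i 1) $ i))" (is "?lhs = _")
    by (rule integral_change_of_variables_finite[OF sets_lebesgue_compact[OF compact_ref_simplex]
          has_derivative_at_withinI[OF D(1)] D(4)])
  also have "\<dots> = (LINT \<xi>:?S|lebesgue. c * (\<Sum>j\<in>UNIV. G' j \<xi> (axis j 1)))"
    by (rule set_lebesgue_integral_spike(2)[OF negligible_boundary_ref_simplex]) (use div in auto)
  also have "\<dots> = c * (\<Sum>j\<in>UNIV. LINT \<xi>:?S|lebesgue. G' j \<xi> (axis j 1))"
    by (subst set_lebesgue_integral_sum[symmetric])
       (auto intro!: set_integrable_continuous_compact compact_ref_simplex continuous_on_subset[OF cG' U(2)])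
  also have "\<dots> = c * (\<Sum>j\<in>UNIV. LINT s:?E|lebesgue. G j (slant_face (\<beta> j) j s) - G j (coord_face (\<beta> j) s))"
    using integral_ref_simplex_partial[OF \<beta> G continuous_on_subset[OF cG' U(2)]] U(2) by (simp add: subset_iff)
  also have "\<dots> = (\<Sum>j\<in>UNIV. c * (LINT s:?E|lebesgue. G j (slant_face (\<beta> j) j s))) -
      (\<Sum>j\<in>UNIV. c * (LINT s:?E|lebesgue. G j (coord_face (\<beta> j) s)))"
    by (simp add: set_integral_diff(2)[OF si ci] sum_subtractf sum_distrib_left right_diff_distrib)
  also have "(\<Sum>j\<in>UNIV. c * (LINT s:?E|lebesgue. G j (slant_face (\<beta> j) j s))) =
      (\<Sum>j\<in>UNIV. LINT s:?E|lebesgue. c * G j (slant_face (\<beta> ?d) ?d s))"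
  proof (rule sum.cong[OF refl])
    fix j
    have "(LINT s:?E|lebesgue. G j (slant_face (\<beta> j) j s)) = (LINT s:?E|lebesgue. G j (slant_face (\<beta> ?d) ?d s))"
      by (rule integral_slant_face_indep[OF \<beta> \<beta>])
    then show "c * (LINT s:?E|lebesgue. G j (slant_face (\<beta> j) j s)) =
        (LINT s:?E|lebesgue. c * G j (slant_face (\<beta> ?d) ?d s))"
      by simp
  qed
  also have "\<dots> = (LINT s:?E|lebesgue. \<Sum>j\<in>UNIV. c * G j (slant_face (\<beta> ?d) ?d s))"
    by (rule set_lebesgue_integral_sum[symmetric]) (intro set_integrable_mult_right si)
  also have "\<dots> = surface_integral TYPE('e) (\<Phi> ` slant_facet) (\<lambda>x. F x \<bullet> outward_normal (\<Phi> ` ?S) x)"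
  proof -
    have "face_param (\<beta> ?d) ?d (slant_face (\<beta> ?d) ?d) (\<lambda>s. coord_face (\<beta> ?d) s - (\<Sum>a\<in>UNIV. s $ a) *\<^sub>R axis ?d 1) 1"
      using \<beta> by (simp add: face_param_def)
    from flux_chart[where F = F and Fh = Fh and f = "\<Phi> ` slant_facet", OF \<Phi> this _ F]
    have "surface_integral TYPE('e) (\<Phi> ` slant_facet) (\<lambda>x. F x \<bullet> outward_normal (\<Phi> ` ?S) x) =
        (LINT s:?E|lebesgue. ((?I (slant_face (\<beta> ?d) ?d s) *v Fh (slant_face (\<beta> ?d) ?d s)) \<bullet> 1) * \<bar>det (?B (slant_face (\<beta> ?d) ?d s))\<bar>)"
      by (simp add: slant_face_image[OF \<beta>])
    also have "\<dots> = (LINT s:?E|lebesgue. \<Sum>j\<in>UNIV. c * G j (slant_face (\<beta> ?d) ?d s))"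
      by (rule set_lebesgue_integral_spike(2)[of "{}"])
         (simp_all add: G_eq slant_mem inner_vec_one sum_distrib_right)
    finally show ?thesis by simp
  qed
  also have "(\<Sum>j\<in>UNIV. c * (LINT s:?E|lebesgue. G j (coord_face (\<beta> j) s))) =
      (\<Sum>j\<in>UNIV. - surface_integral TYPE('e) (\<Phi> ` coord_facet j) (\<lambda>x. F x \<bullet> outward_normal (\<Phi> ` ?S) x))"
  proof (rule sum.cong[OF refl])
    fix j
    have "face_param (\<beta> j) j (coord_face (\<beta> j)) (coord_face (\<beta> j)) (- axis j 1)"
      using \<beta> by (simp add: face_param_def)
    from flux_chart[where F = F and Fh = Fh and f = "\<Phi> ` coord_facet j", OF \<Phi> this _ F]
    have "surface_integral TYPE('e) (\<Phi> ` coord_facet j) (\<lambda>x. F x \<bullet> outward_normal (\<Phi> ` ?S) x) =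
        (LINT s:?E|lebesgue. ((?I (coord_face (\<beta> j) s) *v Fh (coord_face (\<beta> j) s)) \<bullet> (- axis j 1)) * \<bar>det (?B (coord_face (\<beta> j) s))\<bar>)"
      by (simp add: coord_face_image[OF \<beta>])
    also have "\<dots> = (LINT s:?E|lebesgue. (- c) * G j (coord_face (\<beta> j) s))"
      by (rule set_lebesgue_integral_spike(2)[of "{}"]) (simp_all add: G_eq coord_mem inner_axis)
    also have "\<dots> = (- c) * (LINT s:?E|lebesgue. G j (coord_face (\<beta> j) s))"
      by (rule set_integral_mult_right)
    finally show "c * (LINT s:?E|lebesgue. G j (coord_face (\<beta> j) s)) =
        - surface_integral TYPE('e) (\<Phi> ` coord_facet j) (\<lambda>x. F x \<bullet> outward_normal (\<Phi> ` ?S) x)"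
      by simp
  qed
  finally show ?thesis
    by (simp add: sum_chart_faces[OF card D(4)] sum_negf)
qed

section \<open>Faces of a conforming mesh\<close>

text \<open>With a strict inequality the truncated cone is open and omits its vertex
  \<open>x\<close>, so lying in \<open>D\<close> means lying in the interior.\<close>

lemma is_outward_normal_cone:
  assumes n: "is_outward_normal D x n" and e: "e > 0"
  obtains r where "r > 0" "{y \<in> ball x r. (y - x) \<bullet> n < - e * norm (y - x)} \<subseteq> interior D"
proof -
  from n e obtain r where r: "r > 0"
    "\<And>y. y \<noteq> x \<Longrightarrow> dist y x < r \<Longrightarrow> (y - x) \<bullet> n \<le> - e * norm (y - x) \<Longrightarrow> y \<in> D"
    unfolding is_outward_normal_def eventually_at by blast
  let ?C = "ball x r \<inter> {y. (y - x) \<bullet> n < - e * norm (y - x)}"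
  have "open ?C" by (intro open_Int open_ball open_Collect_less continuous_intros)
  moreover have "?C \<subseteq> D"
  proof
    fix y assume y: "y \<in> ?C"
    then have "y \<noteq> x" by auto
    with y show "y \<in> D" by (intro r(2)) (auto simp: dist_commute)
  qed
  ultimately have "?C \<subseteq> interior D" by (simp add: interior_maximal)
  then show thesis using that[OF r(1)] by (simp add: Int_def)
qed

lemma is_outward_normal_ray:
  assumes n: "is_outward_normal D x n" and w: "w \<bullet> n < 0"
  obtains T where "T > 0" "\<And>t. 0 < t \<Longrightarrow> t < T \<Longrightarrow> x + t *\<^sub>R w \<in> interior D"
proof -
  have w0: "norm w > 0" using w by auto
  \<comment> \<open>Half the cosine of the angle between \<open>w\<close> and \<open>- n\<close>, so
    that the ray along \<open>w\<close> stays strictly inside the cone.\<close>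
  define e where "e = - (w \<bullet> n) / (2 * norm w)"
  have e: "e > 0" using w w0 by (simp add: e_def divide_neg_pos)
  obtain r where r: "r > 0" "{y \<in> ball x r. (y - x) \<bullet> n < - e * norm (y - x)} \<subseteq> interior D"
    by (rule is_outward_normal_cone[OF n e]) (rule that)
  show thesis
  proof (rule that[of "r / norm w"])
    show "r / norm w > 0" using r w0 by simp
    fix t assume t: "0 < t" "t < r / norm w"
    have "dist x (x + t *\<^sub>R w) < r" using t w0 by (simp add: dist_norm field_simps)
    moreover have "t * (w \<bullet> n) < - e * (t * norm w)"
    proof -
      have "- e * (t * norm w) = t * (w \<bullet> n) / 2" using w0 by (simp add: e_def)
      moreover have "t * (w \<bullet> n) < 0" using t w by (simp add: mult_pos_neg)
      ultimately show ?thesis by simp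
    qed
    ultimately have "x + t *\<^sub>R w \<in> {y \<in> ball x r. (y - x) \<bullet> n < - e * norm (y - x)}"
      using t by (simp add: abs_of_pos)
    then show "x + t *\<^sub>R w \<in> interior D" using r(2) by blast
  qed
qed

text \<open>Unless the unit normals are opposite, the direction \<open>- (n + n')\<close> points
  into both sets, and a short step along it reaches a common interior point.\<close>

lemma disjoint_interiors_opposite_normals:
  assumes n: "is_outward_normal D x n" and n': "is_outward_normal D' x n'"
    and disj: "interior D \<inter> interior D' = {}"
  shows "n' = - n"
proof (rule ccontr)
  assume ne: "n' \<noteq> - n"
  have nn: "n \<bullet> n = 1" "n' \<bullet> n' = 1"
    using n n' by (simp_all add: is_outward_normal_def dot_square_norm)
  have "0 < (n + n') \<bullet> (n + n')"
    using ne by (simp add: eq_neg_iff_add_eq_0 add.commute)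
  then have p: "n \<bullet> n' > - 1" using nn by (simp add: inner_add inner_commute)
  define w where "w = - (n + n')"
  have w: "w \<bullet> n < 0" "w \<bullet> n' < 0" using p nn by (simp_all add: w_def inner_add inner_diff inner_commute)
  obtain T where T: "T > 0" "\<And>t. 0 < t \<Longrightarrow> t < T \<Longrightarrow> x + t *\<^sub>R w \<in> interior D"
    by (rule is_outward_normal_ray[OF n w(1)]) (rule that)
  obtain T' where T': "T' > 0" "\<And>t. 0 < t \<Longrightarrow> t < T' \<Longrightarrow> x + t *\<^sub>R w \<in> interior D'"
    by (rule is_outward_normal_ray[OF n' w(2)]) (rule that)
  have "x + (min T T' / 2) *\<^sub>R w \<in> interior D \<inter> interior D'"
    using T(2)[of "min T T' / 2"] T'(2)[of "min T T' / 2"] T(1) T'(1) by auto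
  with disj show False by blast
qed

text \<open>Since \<open>\<Omega>\<close> is open, \<open>x\<close> lies on or below the graph of
  \<open>h\<close>. Along \<open>w\<close> the height falls faster than the Lipschitz bound allows
  the graph to fall, so the ray runs strictly below the graph, where a whole neighbourhood misses
  \<open>\<Omega>\<close>.\<close>

lemma lipschitz_domain_exterior_cone:
  fixes \<Omega> :: "'a::euclidean_space set"
  assumes \<Omega>: "lipschitz_domain \<Omega>" and x: "x \<in> frontier \<Omega>"
  obtains e :: 'a and L :: real where "norm e = 1" "0 \<le> L"
    "\<And>w. w \<bullet> e < - L * norm (w - (w \<bullet> e) *\<^sub>R e) \<Longrightarrow> \<exists>T>0. \<forall>t. 0 < t \<and> t < T \<longrightarrow> x + t *\<^sub>R w \<notin> closure \<Omega>"
proof -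
  obtain e h r L where e: "norm e = 1" and r: "r > 0" and L: "L-lipschitz_on UNIV h"
    and eq: "\<Omega> \<inter> ball x r = {y \<in> ball x r. h (y - (y \<bullet> e) *\<^sub>R e) < y \<bullet> e}"
    using \<Omega> x unfolding lipschitz_domain_def by blast
  have op: "open \<Omega>" using \<Omega> by (simp add: lipschitz_domain_def)
  have L0: "0 \<le> L" and Lh: "\<bar>h y - h z\<bar> \<le> L * norm (y - z)" for y z
    using L by (auto simp: lipschitz_on_def dist_norm)
  define p where "p y = y - (y \<bullet> e) *\<^sub>R e" for y
  have hc: "continuous_on UNIV h" using L by (rule lipschitz_on_continuous_on)
  have pc: "continuous_on UNIV p" unfolding p_def by (intro continuous_intros)
  have hp: "continuous_on UNIV (\<lambda>y. h (p y))" by (rule continuous_on_compose2[OF hc pc]) simp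
  have out: "y \<notin> closure \<Omega>" if y: "y \<in> ball x r" "y \<bullet> e < h (p y)" for y
  proof
    assume "y \<in> closure \<Omega>"
    moreover have "open (ball x r \<inter> {y. y \<bullet> e < h (p y)})"
      by (intro open_Int open_ball open_Collect_less continuous_intros hp)
    ultimately obtain z where z: "z \<in> \<Omega>" "z \<in> ball x r" "z \<bullet> e < h (p z)"
      using y open_Int_closure_eq_empty[of "ball x r \<inter> {y. y \<bullet> e < h (p y)}" \<Omega>] by auto
    then have "z \<in> \<Omega> \<inter> ball x r" by blast
    then have "h (p z) < z \<bullet> e" unfolding eq p_def by blast
    with z show False by simp
  qed
  have "x \<notin> \<Omega>" using x op by (simp add: frontier_def interior_open)
  have "\<not> h (p x) < x \<bullet> e"
  proof
    assume "h (p x) < x \<bullet> e"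
    then have "x \<in> {y \<in> ball x r. h (y - (y \<bullet> e) *\<^sub>R e) < y \<bullet> e}"
      unfolding p_def using centre_in_ball[of x r] r by blast
    with \<open>x \<notin> \<Omega>\<close> show False unfolding eq[symmetric] by blast
  qed
  then have hx: "x \<bullet> e \<le> h (p x)" by simp
  show thesis
  proof (rule that[OF e L0])
    fix w assume w: "w \<bullet> e < - L * norm (w - (w \<bullet> e) *\<^sub>R e)"
    \<comment> \<open>Keeps the ray inside the ball in which the graph describes
      \<open>\<Omega>\<close>; the summand 1 allows \<open>w\<close> to be zero.\<close>
    define T where "T = r / (norm w + 1)"
    have T: "T > 0" using r by (simp add: T_def add_nonneg_pos)
    have "x + t *\<^sub>R w \<notin> closure \<Omega>" if t: "0 < t" "t < T" for t
    proof (rule out)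
      have "t * norm w \<le> t * (norm w + 1)" using t by (intro mult_left_mono) auto
      also have "\<dots> < r"
      proof -
        have "norm w + 1 > 0" by (simp add: add_nonneg_pos)
        then show ?thesis using t by (simp add: T_def field_simps)
      qed
      finally show "x + t *\<^sub>R w \<in> ball x r" using t by (simp add: dist_norm)
      have pt: "p (x + t *\<^sub>R w) - p x = t *\<^sub>R (w - (w \<bullet> e) *\<^sub>R e)"
        by (simp add: p_def inner_add_left algebra_simps)
      have "\<bar>h (p (x + t *\<^sub>R w)) - h (p x)\<bar> \<le> L * (t * norm (w - (w \<bullet> e) *\<^sub>R e))"
        using Lh[of "p (x + t *\<^sub>R w)" "p x"] t by (simp add: pt)
      moreover have "t * (w \<bullet> e) < t * (- L * norm (w - (w \<bullet> e) *\<^sub>R e))"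
        using t w by (intro mult_strict_left_mono) auto
      ultimately show "(x + t *\<^sub>R w) \<bullet> e < h (p (x + t *\<^sub>R w))"
        using hx by (simp add: inner_add_left algebra_simps)
    qed
    with T show "\<exists>T>0. \<forall>t. 0 < t \<and> t < T \<longrightarrow> x + t *\<^sub>R w \<notin> closure \<Omega>" by blast
  qed
qed

text \<open>The obstacle would be a slit, a boundary point interior to the closure. There the
  direction \<open>- e\<close>, which has no horizontal part, leaves the closure at once.\<close>

lemma lipschitz_domain_interior_closure:
  fixes \<Omega> :: "'a::euclidean_space set"
  assumes \<Omega>: "lipschitz_domain \<Omega>"
  shows "interior (closure \<Omega>) \<subseteq> \<Omega>"
proof (rule subsetI, rule ccontr)
  fix x assume x: "x \<in> interior (closure \<Omega>)" "x \<notin> \<Omega>"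
  have op: "open \<Omega>" using \<Omega> by (simp add: lipschitz_domain_def)
  have "x \<in> frontier \<Omega>" using x interior_subset op by (auto simp: frontier_def interior_open)
  then obtain e :: 'a and L where e: "norm e = 1" and L: "0 \<le> L" and
    cone: "\<And>w. w \<bullet> e < - L * norm (w - (w \<bullet> e) *\<^sub>R e) \<Longrightarrow> \<exists>T>0. \<forall>t. 0 < t \<and> t < T \<longrightarrow> x + t *\<^sub>R w \<notin> closure \<Omega>"
    by (rule lipschitz_domain_exterior_cone[OF \<Omega>]) (rule that)
  have ee: "e \<bullet> e = 1" using e by (simp add: dot_square_norm)
  obtain T where T: "T > 0" "\<And>t. 0 < t \<Longrightarrow> t < T \<Longrightarrow> x + t *\<^sub>R (- e) \<notin> closure \<Omega>"
    using cone[of "- e"] ee by auto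
  obtain r where r: "r > 0" "ball x r \<subseteq> closure \<Omega>" using x(1) mem_interior by blast
  define t where "t = min T r / 2"
  have t: "0 < t" "t < T" "t < r" using T(1) r(1) by (auto simp: t_def)
  have "x + t *\<^sub>R (- e) \<in> ball x r" using t e by (simp add: dist_norm)
  then show False using T(2)[OF t(1,2)] r(2) by blast
qed

text \<open>Every direction not orthogonal to \<open>n\<close> points into \<open>D\<close> or into
  \<open>D'\<close>, hence into the closure of \<open>\<Omega>\<close>. The cone of directions
  leaving that closure is open, so it contains one that is not orthogonal to
  \<open>n\<close>.\<close>

lemma lipschitz_domain_no_opposite_normals:
  fixes \<Omega> :: "'a::euclidean_space set"
  assumes \<Omega>: "lipschitz_domain \<Omega>" and x: "x \<in> frontier \<Omega>"
    and D: "is_outward_normal D x n" "D \<subseteq> closure \<Omega>"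
    and D': "is_outward_normal D' x (- n)" "D' \<subseteq> closure \<Omega>"
  shows False
proof -
  obtain e :: 'a and L where e: "norm e = 1" and L: "0 \<le> L" and
    cone: "\<And>w. w \<bullet> e < - L * norm (w - (w \<bullet> e) *\<^sub>R e) \<Longrightarrow> \<exists>T>0. \<forall>t. 0 < t \<and> t < T \<longrightarrow> x + t *\<^sub>R w \<notin> closure \<Omega>"
    by (rule lipschitz_domain_exterior_cone[OF \<Omega> x]) (rule that)
  have ee: "e \<bullet> e = 1" using e by (simp add: dot_square_norm)
  have n1: "norm n = 1" using D(1) by (simp add: is_outward_normal_def)
  then have nn: "n \<bullet> n = 1" by (simp add: dot_square_norm)
  have "\<exists>w. w \<bullet> e < - L * norm (w - (w \<bullet> e) *\<^sub>R e) \<and> w \<bullet> n \<noteq> 0"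
  proof (cases "e \<bullet> n = 0")
    case False
    then show ?thesis using ee by (intro exI[of _ "- e"]) simp
  next
    case True
    \<comment> \<open>Small enough that \<open>L * \<delta> < 1\<close>, so that tilting
      \<open>- e\<close> by \<open>\<delta> *\<^sub>R n\<close> keeps it in the exterior
      cone.\<close>
    define \<delta> where "\<delta> = 1 / (2 * (L + 1))"
    have \<delta>: "\<delta> > 0" "L * \<delta> < 1" using L by (auto simp: \<delta>_def field_simps)
    define w where "w = \<delta> *\<^sub>R n - e"
    have we: "w \<bullet> e = - 1" and wn: "w \<bullet> n = \<delta>"
      using True ee nn by (simp_all add: w_def inner_diff_left inner_commute[of n e])
    have "norm (w - (w \<bullet> e) *\<^sub>R e) = \<delta>" unfolding we using \<delta> n1 by (simp add: w_def)
    then have "w \<bullet> e < - L * norm (w - (w \<bullet> e) *\<^sub>R e)" using we \<delta> by simp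
    with wn \<delta> show ?thesis by (intro exI[of _ w]) simp
  qed
  then obtain w where w: "w \<bullet> e < - L * norm (w - (w \<bullet> e) *\<^sub>R e)" "w \<bullet> n \<noteq> 0" by blast
  obtain T where T: "T > 0" "\<And>t. 0 < t \<Longrightarrow> t < T \<Longrightarrow> x + t *\<^sub>R w \<notin> closure \<Omega>"
    using cone[OF w(1)] by blast
  have "\<exists>T'>0. \<forall>t. 0 < t \<longrightarrow> t < T' \<longrightarrow> x + t *\<^sub>R w \<in> closure \<Omega>"
  proof (cases "w \<bullet> n < 0")
    case True
    show ?thesis by (rule is_outward_normal_ray[OF D(1) True]) (use D(2) interior_subset in blast)
  next
    case False
    then have "w \<bullet> (- n) < 0" using w(2) by simp
    then show ?thesis by (rule is_outward_normal_ray[OF D'(1)]) (use D'(2) interior_subset in blast)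
  qed
  then obtain T' where T': "T' > 0" "\<And>t. 0 < t \<Longrightarrow> t < T' \<Longrightarrow> x + t *\<^sub>R w \<in> closure \<Omega>" by blast
  define t where "t = min T T' / 2"
  have "0 < t" "t < T" "t < T'" using T(1) T'(1) by (auto simp: t_def)
  then show False using T(2)[of t] T'(2)[of t] by blast
qed

text \<open>The relative interior of a face. Taking the union over all parametrizations makes it
  depend on the set only, as is needed when the two adjacent elements bring their own
  parametrizations.\<close>

definition patch_interior :: "'e::finite itself \<Rightarrow> (real^'d::finite) set \<Rightarrow> (real^'d) set" where
  "patch_interior _ f = (\<Union>\<gamma> \<in> {\<gamma> :: real^'e \<Rightarrow> real^'d. smooth_embedding \<gamma> ref_simplex \<and> \<gamma> ` ref_simplex = f}.
     \<gamma> ` interior ref_simplex)"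

lemma patch_interior_eq:
  fixes \<gamma> :: "real^'e::finite \<Rightarrow> real^'d::finite"
  assumes "smooth_embedding \<gamma> ref_simplex" "\<gamma> ` ref_simplex = f"
  shows "patch_interior TYPE('e) f = \<gamma> ` interior ref_simplex"
proof -
  have "\<delta> ` interior ref_simplex = \<gamma> ` interior ref_simplex"
    if "smooth_embedding \<delta> ref_simplex" "\<delta> ` ref_simplex = f" for \<delta> :: "real^'e \<Rightarrow> real^'d"
    by (rule surface_parameter_interior[OF assms(1) that(1)]) (simp add: that assms)
  then show ?thesis using assms unfolding patch_interior_def by blast
qed

lemma ref_simplex_interior_nonempty: "interior (ref_simplex :: (real^'e::finite) set) \<noteq> {}"
  unfolding ref_simplex_def using interior_std_simplex_nonempty by blast

text \<open>The parameters of the excluded points form the boundary of the simplex, a null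
  set.\<close>

lemma surface_integral_cong:
  fixes \<gamma> :: "real^'e::finite \<Rightarrow> real^'d::finite"
  assumes \<gamma>: "smooth_embedding \<gamma> ref_simplex" "\<gamma> ` ref_simplex = f"
    and gh: "\<And>x. x \<in> patch_interior TYPE('e) f \<Longrightarrow> g x = h x"
  shows "surface_integral TYPE('e) f g = surface_integral TYPE('e) f h"
  unfolding surface_integral_eq[OF \<gamma>]
  by (rule set_lebesgue_integral_spike(2)[OF negligible_boundary_ref_simplex])
     (simp add: gh patch_interior_eq[OF \<gamma>])

lemma surface_integral_add_continuous:
  fixes \<gamma> :: "real^'e::finite \<Rightarrow> real^'d::finite"
  assumes \<gamma>: "smooth_embedding \<gamma> ref_simplex" "\<gamma> ` ref_simplex = f"
    and g: "continuous_on f g" and h: "continuous_on f h"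
  shows "surface_integral TYPE('e) f (\<lambda>x. g x + h x) = surface_integral TYPE('e) f g + surface_integral TYPE('e) f h"
proof -
  have c: "set_integrable lebesgue ref_simplex (\<lambda>s. k (\<gamma> s) * area \<gamma> s)" if "continuous_on f k" for k
    by (intro set_integrable_continuous_compact compact_ref_simplex continuous_on_mult continuous_on_area \<gamma>
        continuous_on_compose2[OF that smooth_embeddingD(3)[OF \<gamma>(1)]]) (simp add: \<gamma>)
  show ?thesis
    unfolding surface_integral_eq[OF \<gamma>] distrib_right by (rule set_integral_add(2)[OF c[OF g] c[OF h]])
qed

text \<open>\<open>sqrt\<close> is an odd function on the reals, so the sign of the area element is
  an assumption; for face parametrizations it follows from the expression of the area element as a
  norm times an absolute determinant.\<close>

lemma surface_integral_nonneg:
  fixes \<gamma> :: "real^'e::finite \<Rightarrow> real^'d::finite"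
  assumes \<gamma>: "smooth_embedding \<gamma> ref_simplex" "\<gamma> ` ref_simplex = f"
    and ar: "\<And>s. s \<in> ref_simplex \<Longrightarrow> 0 \<le> area \<gamma> s" and g: "\<And>x. x \<in> f \<Longrightarrow> 0 \<le> g x"
  shows "0 \<le> surface_integral TYPE('e) f g"
  unfolding surface_integral_eq[OF \<gamma>]
  unfolding set_lebesgue_integral_def
  by (rule Bochner_Integration.integral_nonneg) (use ar g \<gamma>(2) in \<open>auto simp: indicator_def\<close>)

section \<open>Faces and normals of mesh elements\<close>

lemma elem_face_param:
  fixes M :: "('k, 'd::finite) dg_mesh"
  assumes card: "CARD('e::finite) + 1 = CARD('d)"
    and \<Phi>: "smooth_embedding (emap M k) ref_simplex" and f: "f \<in> elem_faces M k"
  obtains \<beta> :: "'e::finite \<Rightarrow> 'd::finite" and j \<alpha> L \<nu> where "face_param \<beta> j \<alpha> L \<nu>"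
    "smooth_embedding (\<lambda>s. emap M k (\<alpha> s)) ref_simplex" "(\<lambda>s. emap M k (\<alpha> s)) ` ref_simplex = f"
    "\<And>s. s \<in> ref_simplex \<Longrightarrow> 0 \<le> area (\<lambda>s. emap M k (\<alpha> s)) s"
proof -
  obtain F where F: "F \<in> ref_faces" "f = emap M k ` F" using f by (auto simp: elem_faces_def)
  obtain \<beta> :: "'e \<Rightarrow> 'd" and j \<alpha> L \<nu> where p: "face_param \<beta> j \<alpha> L \<nu>" "\<alpha> ` ref_simplex = F"
    by (rule face_param_ref_faces[OF card F(1)]) (rule that)
  show thesis
    by (rule that[OF p(1) chart_face(1)[OF \<Phi> p(1)]])
       (use p(2) F(2) chart_face(2)[OF \<Phi> p(1)] in \<open>auto simp: image_image\<close>)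
qed

text \<open>The normal is under control only at relatively interior points, but there it coincides
  with a normalized conormal that is continuous on the whole closed face. This is how integrands
  containing the normal become integrable.\<close>

lemma elem_face_normal:
  fixes M :: "('k, 'd::finite) dg_mesh"
  assumes card: "CARD('e::finite) + 1 = CARD('d)"
    and \<Phi>: "smooth_embedding (emap M k) ref_simplex" and f: "f \<in> elem_faces M k"
  shows "x \<in> patch_interior TYPE('e) f \<Longrightarrow> is_outward_normal (elem M k) x (normal M k x)"
    "\<exists>m. continuous_on f m \<and> (\<forall>x\<in>patch_interior TYPE('e) f. normal M k x = m x)"
    "f \<subseteq> elem M k" "patch_interior TYPE('e) f \<subseteq> f" "patch_interior TYPE('e) f \<noteq> {}"
proof -
  let ?\<Phi> = "emap M k"
  obtain \<beta> :: "'e \<Rightarrow> 'd" and j \<alpha> L \<nu> where fp: "face_param \<beta> j \<alpha> L \<nu>" and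
    p: "smooth_embedding (\<lambda>s. ?\<Phi> (\<alpha> s)) ref_simplex" "(\<lambda>s. ?\<Phi> (\<alpha> s)) ` ref_simplex = f"
    by (rule elem_face_param[OF assms]) (rule that)
  note pi = patch_interior_eq[OF p]
  define i where "i = inv_into ref_simplex ?\<Phi>"
  note i = chart_inverse[OF \<Phi> compact_ref_simplex, folded i_def]
  define m where "m x = conormal ?\<Phi> \<nu> (i x) /\<^sub>R norm (conormal ?\<Phi> \<nu> (i x))" for x
  have mem: "\<alpha> s \<in> ref_simplex" if "s \<in> ref_simplex" for s using face_param_mem[OF fp that] .
  show fe: "f \<subseteq> elem M k" unfolding elem_def p(2)[symmetric] using mem by blast
  show "patch_interior TYPE('e) f \<subseteq> f"
    unfolding pi using image_mono[OF interior_subset, of "\<lambda>s. ?\<Phi> (\<alpha> s)" ref_simplex] p(2) by simp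
  show "patch_interior TYPE('e) f \<noteq> {}" unfolding pi using ref_simplex_interior_nonempty by blast
  have key: "is_outward_normal (elem M k) x (m x)" if x: "x \<in> patch_interior TYPE('e) f" for x
  proof -
    obtain s where s: "s \<in> interior ref_simplex" "x = ?\<Phi> (\<alpha> s)" using x unfolding pi by blast
    have "s \<in> ref_simplex" using s(1) interior_subset by blast
    then have "i x = \<alpha> s" using i(1) mem s(2) by simp
    then show ?thesis
      using is_outward_normal_chart[OF \<Phi> fp s(1)] by (simp add: m_def elem_def s(2))
  qed
  have nm: "normal M k x = m x" if "x \<in> patch_interior TYPE('e) f" for x
    unfolding normal_def by (rule outward_normal_eq[OF key[OF that]])
  show "x \<in> patch_interior TYPE('e) f \<Longrightarrow> is_outward_normal (elem M k) x (normal M k x)" for x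
    using key nm by simp
  have ic: "continuous_on f i" using i(2) fe continuous_on_subset unfolding elem_def by blast
  have cc: "continuous_on ref_simplex (conormal ?\<Phi> \<nu>)"
  proof -
    have nth: "conormal ?\<Phi> \<nu> \<xi> $ l = (matrix_inv (jac ?\<Phi> \<xi>) *v axis l 1) \<bullet> \<nu>" for \<xi> l
    proof -
      have "axis l 1 \<bullet> conormal ?\<Phi> \<nu> \<xi> = conormal ?\<Phi> \<nu> \<xi> $ l" by (simp add: inner_axis')
      then show ?thesis by (simp add: conormal_inner)
    qed
    have "continuous_on ref_simplex (\<lambda>\<xi>. \<chi> l. conormal ?\<Phi> \<nu> \<xi> $ l)"
      unfolding nth by (intro continuous_intros continuous_on_jac_inv \<Phi>)
    then show ?thesis by simp
  qed
  have i_range: "i x \<in> \<alpha> ` ref_simplex" if "x \<in> f" for x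
    using that i(1) mem by (auto simp: p(2)[symmetric])
  have i_mem: "i x \<in> ref_simplex" if "x \<in> f" for x
  proof -
    obtain s where "s \<in> ref_simplex" "i x = \<alpha> s" using i_range[OF \<open>x \<in> f\<close>] by (rule imageE)
    then show ?thesis by (simp only: mem)
  qed
  have "continuous_on f (\<lambda>x. conormal ?\<Phi> \<nu> (i x))"
    by (rule continuous_on_compose2[OF cc ic], rule image_subsetI, rule i_mem)
  then have "continuous_on f m"
    unfolding m_def[abs_def]
  proof (intro continuous_intros)
    show "\<forall>x\<in>f. norm (conormal ?\<Phi> \<nu> (i x)) \<noteq> 0"
    proof
      fix x assume "x \<in> f"
      then obtain s where "s \<in> ref_simplex" "i x = \<alpha> s" using i_range[of x] by (auto elim: imageE)
      then show "norm (conormal ?\<Phi> \<nu> (i x)) \<noteq> 0" using chart_face(3)[OF \<Phi> fp] by simp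
    qed
  qed
  with nm show "\<exists>m. continuous_on f m \<and> (\<forall>x\<in>patch_interior TYPE('e) f. normal M k x = m x)" by blast
qed

lemma mesh_normals_opposite:
  fixes M :: "('k, 'd::finite) dg_mesh"
  assumes card: "CARD('e::finite) + 1 = CARD('d)" and M: "conforming_mesh M \<Omega>"
    and k: "k \<in> elems M" "f \<in> elem_faces M k" and l: "l \<in> elems M" "f \<in> elem_faces M l" and kl: "k \<noteq> l"
    and x: "x \<in> patch_interior TYPE('e) f"
  shows "normal M l x = - normal M k x"
proof (rule disjoint_interiors_opposite_normals)
  have se: "smooth_embedding (emap M k) ref_simplex" "smooth_embedding (emap M l) ref_simplex"
    and "interior (elem M k) \<inter> interior (elem M l) = {}"
    using M k l kl by (auto simp: conforming_mesh_def)
  then show "interior (elem M k) \<inter> interior (elem M l) = {}" by simp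
  show "is_outward_normal (elem M k) x (normal M k x)" by (rule elem_face_normal(1)[OF card se(1) k(2) x])
  show "is_outward_normal (elem M l) x (normal M l x)" by (rule elem_face_normal(1)[OF card se(2) l(2) x])
qed

text \<open>Three elements at one face would have pairwise opposite unit normals, forcing a unit
  vector to equal its own negative.\<close>

lemma mesh_at_most_two:
  fixes M :: "('k, 'd::finite) dg_mesh"
  assumes card: "CARD('e::finite) + 1 = CARD('d)" and M: "conforming_mesh M \<Omega>"
    and k: "k \<in> elems M" "f \<in> elem_faces M k" and l: "l \<in> elems M" "f \<in> elem_faces M l"
    and m: "m \<in> elems M" "f \<in> elem_faces M m" and ne: "k \<noteq> l" "k \<noteq> m"
  shows "l = m"
proof (rule ccontr)
  assume lm: "l \<noteq> m"
  have se: "smooth_embedding (emap M k) ref_simplex" using M k by (simp add: conforming_mesh_def)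
  obtain x where x: "x \<in> patch_interior TYPE('e) f" using elem_face_normal(5)[OF card se k(2)] by blast
  have "norm (normal M k x) = 1" using elem_face_normal(1)[OF card se k(2) x] by (simp add: is_outward_normal_def)
  have l': "normal M l x = - normal M k x" by (rule mesh_normals_opposite[OF card M k l ne(1) x])
  have "- normal M k x = normal M m x" by (rule mesh_normals_opposite[OF card M k m ne(2) x, symmetric])
  also have "\<dots> = - normal M l x" by (rule mesh_normals_opposite[OF card M l m lm x])
  also have "\<dots> = normal M k x" by (simp only: l' minus_minus)
  finally have eq: "- normal M k x = normal M k x" .
  have "2 *\<^sub>R normal M k x = - normal M k x + normal M k x" unfolding eq by (rule scaleR_2)
  then have "normal M k x = 0" by simp
  with \<open>norm (normal M k x) = 1\<close> show False by simp
qed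

definition face_elems :: "('k, 'd::finite) dg_mesh \<Rightarrow> (real^'d) set \<Rightarrow> 'k set" where
  "face_elems M f = {k \<in> elems M. f \<in> elem_faces M k}"

text \<open>Uniqueness of the second element gives the definite description in
  \<open>neighbor\<close> its meaning, from either side of the face.\<close>

lemma interior_face_elems:
  fixes M :: "('k, 'd::finite) dg_mesh"
  assumes card: "CARD('e::finite) + 1 = CARD('d)" and M: "conforming_mesh M \<Omega>"
    and f: "f \<in> mesh_faces M - boundary_faces M \<Omega>"
  obtains l where "minus_elem M f \<noteq> l" "face_elems M f = {minus_elem M f, l}"
    "neighbor M (minus_elem M f) f = l" "neighbor M l f = minus_elem M f"
proof -
  let ?k = "minus_elem M f"
  have "\<exists>k. k \<in> elems M \<and> f \<in> elem_faces M k" using f by (auto simp: mesh_faces_def)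
  then have k: "?k \<in> elems M" "f \<in> elem_faces M ?k" unfolding minus_elem_def by (metis (mono_tags, lifting) someI_ex)+
  have "\<not> f \<subseteq> frontier \<Omega>" using f by (simp add: boundary_faces_def)
  then obtain l where l: "l \<in> elems M" "l \<noteq> ?k" "f \<in> elem_faces M l"
    using M k unfolding conforming_mesh_def by blast
  have two: "m = ?k \<or> m = l" if "m \<in> elems M" "f \<in> elem_faces M m" for m
    using mesh_at_most_two[OF card M k l(1,3) that] l(2) by blast
  show thesis
  proof (rule that[of l])
    show "?k \<noteq> l" using l by simp
    show "face_elems M f = {?k, l}" using k l two by (auto simp: face_elems_def)
    show "neighbor M ?k f = l" unfolding neighbor_def by (rule the_equality) (use l two in auto)
    show "neighbor M l f = ?k" unfolding neighbor_def by (rule the_equality) (use k l two in auto)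
  qed
qed

lemma boundary_face_elems:
  fixes M :: "('k, 'd::finite) dg_mesh"
  assumes card: "CARD('e::finite) + 1 = CARD('d)" and M: "conforming_mesh M \<Omega>"
    and \<Omega>: "lipschitz_domain \<Omega>" and f: "f \<in> boundary_faces M \<Omega>"
  shows "face_elems M f = {minus_elem M f}"
proof -
  let ?k = "minus_elem M f"
  have "\<exists>k. k \<in> elems M \<and> f \<in> elem_faces M k" using f by (auto simp: boundary_faces_def mesh_faces_def)
  then have k: "?k \<in> elems M" "f \<in> elem_faces M ?k" unfolding minus_elem_def by (metis (mono_tags, lifting) someI_ex)+
  have "l = ?k" if l: "l \<in> elems M" "f \<in> elem_faces M l" for l
  proof (rule ccontr)
    assume lk: "l \<noteq> ?k"
    have se: "smooth_embedding (emap M ?k) ref_simplex" "smooth_embedding (emap M l) ref_simplex"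
      and sub: "elem M ?k \<subseteq> closure \<Omega>" "elem M l \<subseteq> closure \<Omega>"
      using M k l by (auto simp: conforming_mesh_def)
    obtain x where x: "x \<in> patch_interior TYPE('e) f" using elem_face_normal(5)[OF card se(1) k(2)] by blast
    have "x \<in> frontier \<Omega>" using x elem_face_normal(4)[OF card se(1) k(2)] f by (auto simp: boundary_faces_def)
    moreover have "normal M l x = - normal M ?k x" by (rule mesh_normals_opposite[OF card M k l lk[symmetric] x])
    ultimately show False
      using lipschitz_domain_no_opposite_normals[OF \<Omega> _ elem_face_normal(1)[OF card se(1) k(2) x] sub(1), of "elem M l"]
        elem_face_normal(1)[OF card se(2) l(2) x] sub(2) by simp
  qed
  then show ?thesis unfolding face_elems_def using k by blast
qed

text \<open>Bounds on the coefficients hold on the open set \<open>\<Omega>\<close>, while elements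
  are closed. The image of the open simplex is open and contained in the closure of
  \<open>\<Omega>\<close>, hence in \<open>\<Omega>\<close>; the image of the simplex boundary is
  null because the chart is differentiable.\<close>

lemma negligible_elem_minus_domain:
  fixes M :: "('k, 'd::finite) dg_mesh"
  assumes M: "conforming_mesh M \<Omega>" and \<Omega>: "lipschitz_domain \<Omega>" and k: "k \<in> elems M"
  shows "negligible (elem M k - emap M k ` interior ref_simplex)" "negligible (elem M k - \<Omega>)" "compact (elem M k)"
proof -
  let ?\<Phi> = "emap M k"
  have \<Phi>: "smooth_embedding ?\<Phi> ref_simplex" and sub: "elem M k \<subseteq> closure \<Omega>"
    using M k by (auto simp: conforming_mesh_def)
  note D = smooth_embeddingD[OF \<Phi>]
  show "compact (elem M k)" unfolding elem_def by (rule compact_continuous_image[OF D(3) compact_ref_simplex])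
  have "negligible (?\<Phi> ` (ref_simplex - interior ref_simplex))"
    by (rule negligible_differentiable_image_negligible[OF order_refl negligible_boundary_ref_simplex
          differentiable_on_subset[OF D(6)]]) auto
  then show n: "negligible (elem M k - ?\<Phi> ` interior ref_simplex)"
    by (rule negligible_subset) (auto simp: elem_def)
  have "?\<Phi> ` interior ref_simplex \<subseteq> interior (closure \<Omega>)"
    using open_chart_interior[OF \<Phi>] sub unfolding elem_def by (meson interior_mono order_trans)
  then have "?\<Phi> ` interior ref_simplex \<subseteq> \<Omega>" using lipschitz_domain_interior_closure[OF \<Omega>] by blast
  then show "negligible (elem M k - \<Omega>)" by (intro negligible_subset[OF n]) blast
qed

section \<open>Piecewise polynomials in reference coordinates\<close>

lemma poly_space_derivative:
  assumes "p \<in> poly_space N"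
  shows "\<exists>p'. (\<forall>x. (p has_derivative p' x) (at x)) \<and> (\<forall>h. continuous_on UNIV (\<lambda>x. p' x h))"
proof -
  obtain c where c: "\<And>x. p x = (\<Sum>\<alpha> | (\<Sum>i\<in>UNIV. \<alpha> i) \<le> N. c \<alpha> * (\<Prod>i\<in>UNIV. (x $ i) ^ \<alpha> i))"
    using assms by (auto simp: poly_space_def)
  define p' where "p' x h = (\<Sum>\<alpha> | (\<Sum>i\<in>UNIV. \<alpha> i) \<le> N. c \<alpha> * (\<Sum>i\<in>UNIV.
      (of_nat (\<alpha> i) * (h $ i) * (x $ i) ^ (\<alpha> i - 1)) * (\<Prod>j\<in>UNIV - {i}. (x $ j) ^ \<alpha> j)))" for x h :: "real^'a"
  have "((\<lambda>x. \<Sum>\<alpha> | (\<Sum>i\<in>UNIV. \<alpha> i) \<le> N. c \<alpha> * (\<Prod>i\<in>UNIV. (x $ i) ^ \<alpha> i)) has_derivative p' x) (at x)" for x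
    unfolding p'_def[abs_def]
    by (intro has_derivative_sum has_derivative_mult_right has_derivative_prod has_derivative_power
        bounded_linear_imp_has_derivative bounded_linear_vec_nth)
  moreover have "continuous_on UNIV (\<lambda>x. p' x h)" for h
    unfolding p'_def by (intro continuous_intros)
  ultimately show ?thesis using c by (intro exI[of _ p']) (simp add: c[abs_def])
qed

lemma has_derivative_vec_lambda_nth:
  fixes p :: "'m::finite \<Rightarrow> 'a::real_normed_vector \<Rightarrow> real"
  assumes "\<And>i. (p i has_derivative p' i) (at x)"
  shows "((\<lambda>x. \<chi> i. p i x) has_derivative (\<lambda>h. \<chi> i. p' i h)) (at x)"
proof -
  have "((\<lambda>x. (\<chi> i. p i x) \<bullet> b) has_derivative (\<lambda>h. (\<chi> i. p' i h) \<bullet> b)) (at x)" if "b \<in> Basis" for b :: "real^'m"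
  proof -
    obtain i where "b = axis i 1" using \<open>b \<in> Basis\<close> by (auto simp: Basis_vec_def)
    then show ?thesis using assms[of i] by (simp add: inner_axis)
  qed
  then show ?thesis using has_derivative_componentwise_within by blast
qed

text \<open>The pulled-back function extends to a polynomial map on the whole space, so full
  derivatives exist even at boundary points of the simplex.\<close>

lemma dg_space_representation:
  fixes u :: "'k \<Rightarrow> real^'d::finite \<Rightarrow> real^'m::finite"
  assumes u: "u \<in> dg_space M N" and k: "k \<in> elems M"
  obtains uh uh' where "\<And>\<xi>. \<xi> \<in> ref_simplex \<Longrightarrow> u k (emap M k \<xi>) = uh \<xi>"
    "\<And>\<xi>. (uh has_derivative uh' \<xi>) (at \<xi>)" "\<And>h. continuous_on UNIV (\<lambda>\<xi>. uh' \<xi> h)"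
proof -
  have "\<forall>i. \<exists>p\<in>poly_space N. \<forall>x\<in>ref_simplex. u k (emap M k x) $ i = p x"
    using u k by (auto simp: dg_space_def)
  then obtain p where p: "\<And>i. p i \<in> poly_space N" "\<And>i x. x \<in> ref_simplex \<Longrightarrow> u k (emap M k x) $ i = p i x"
    by metis
  have "\<forall>i. \<exists>p'. (\<forall>x. (p i has_derivative p' x) (at x)) \<and> (\<forall>h. continuous_on UNIV (\<lambda>x. p' x h))"
    using poly_space_derivative[OF p(1)] by blast
  then obtain p' where p': "\<And>i x. (p i has_derivative p' i x) (at x)" "\<And>i h. continuous_on UNIV (\<lambda>x. p' i x h)"
    by metis
  show thesis
  proof (rule that[of "\<lambda>\<xi>. \<chi> i. p i \<xi>" "\<lambda>\<xi> h. \<chi> i. p' i \<xi> h"])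
    show "u k (emap M k \<xi>) = (\<chi> i. p i \<xi>)" if "\<xi> \<in> ref_simplex" for \<xi>
      using p(2)[OF that] by (simp add: vec_eq_iff)
    show "((\<lambda>\<xi>. \<chi> i. p i \<xi>) has_derivative (\<lambda>h. \<chi> i. p' i \<xi> h)) (at \<xi>)" for \<xi>
      by (rule has_derivative_vec_lambda_nth[OF p'(1)])
    show "continuous_on UNIV (\<lambda>\<xi>. \<chi> i. p' i \<xi> h)" for h
      by (intro continuous_on_vec_lambda p'(2))
  qed
qed

lemma dg_space_continuous:
  fixes u :: "'k \<Rightarrow> real^'d::finite \<Rightarrow> real^'m::finite"
  assumes u: "u \<in> dg_space M N" and k: "k \<in> elems M" and \<Phi>: "smooth_embedding (emap M k) ref_simplex"
  shows "continuous_on (elem M k) (u k)"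
proof -
  obtain uh uh' where uh: "\<And>\<xi>. \<xi> \<in> ref_simplex \<Longrightarrow> u k (emap M k \<xi>) = uh \<xi>"
    "\<And>\<xi>. (uh has_derivative uh' \<xi>) (at \<xi>)"
    by (rule dg_space_representation[OF u k]) (rule that)
  note i = chart_inverse[OF \<Phi> compact_ref_simplex]
  have "continuous_on UNIV uh"
    using uh(2) by (intro has_derivative_continuous_on[where f' = uh']) auto
  then have "continuous_on (elem M k) (\<lambda>x. uh (inv_into ref_simplex (emap M k) x))"
    unfolding elem_def by (rule continuous_on_compose2[OF _ i(2)]) auto
  then show ?thesis
    by (rule continuous_on_eq) (auto simp: elem_def i(1) uh(1))
qed

section \<open>Differentiation of the energy\<close>

lemma lincomb_closed_sum:
  assumes "\<And>f g u w. f \<in> W \<Longrightarrow> g \<in> W \<Longrightarrow> (\<lambda>x. u * f x + w * g x) \<in> W" and "(\<lambda>x. 0) \<in> W"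
    and "\<And>a. a < (n::nat) \<Longrightarrow> l a \<in> W"
  shows "(\<lambda>x. \<Sum>a<n. u a * l a x :: real) \<in> W"
  using assms(3)
proof (induction n)
  case 0
  then show ?case using assms(2) by simp
next
  case (Suc n)
  have "(\<lambda>x. 1 * (\<Sum>a<n. u a * l a x) + u n * l n x) \<in> W"
    by (rule assms(1)) (use Suc in auto)
  then show ?case by simp
qed

text \<open>Lagrange interpolation in an arbitrary finite-dimensional space of functions: a new point
  is added whenever the next generator is not yet reproduced.\<close>

lemma interpolation_points:
  fixes \<phi> :: "'i \<Rightarrow> 'x \<Rightarrow> real"
  assumes "finite I" and cl: "\<And>f g u w. f \<in> W \<Longrightarrow> g \<in> W \<Longrightarrow> (\<lambda>x. u * f x + w * g x) \<in> W"
    and zero: "(\<lambda>x. 0) \<in> W" and "\<And>i. i \<in> I \<Longrightarrow> \<phi> i \<in> W"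
  shows "\<exists>(n::nat) X l. (\<forall>a<n. X a \<in> S \<and> l a \<in> W) \<and>
    (\<forall>c. \<forall>x\<in>S. (\<Sum>i\<in>I. c i * \<phi> i x) = (\<Sum>a<n. (\<Sum>i\<in>I. c i * \<phi> i (X a)) * l a x))"
  using assms(1,4)
proof (induction I rule: finite_induct)
  case empty
  show ?case by (rule exI[of _ 0]) simp
next
  case (insert \<beta> I)
  have "\<exists>(n::nat) X l. (\<forall>a<n. X a \<in> S \<and> l a \<in> W) \<and>
    (\<forall>c. \<forall>x\<in>S. (\<Sum>i\<in>I. c i * \<phi> i x) = (\<Sum>a<n. (\<Sum>i\<in>I. c i * \<phi> i (X a)) * l a x))"
    by (rule insert.IH) (rule insert.prems, rule insertI2)
  then obtain n :: nat and X l where nXl: "\<forall>a<n. X a \<in> S \<and> l a \<in> W" and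
    ip0: "\<forall>c. \<forall>x\<in>S. (\<Sum>i\<in>I. c i * \<phi> i x) = (\<Sum>a<n. (\<Sum>i\<in>I. c i * \<phi> i (X a)) * l a x)"
    by (elim exE conjE) (rule that)
  have nXl: "\<And>a. a < n \<Longrightarrow> X a \<in> S" "\<And>a. a < n \<Longrightarrow> l a \<in> W" using nXl by simp_all
  have ip: "(\<Sum>i\<in>I. c i * \<phi> i x) = (\<Sum>a<n. (\<Sum>i\<in>I. c i * \<phi> i (X a)) * l a x)" if "x \<in> S" for c x
    using ip0[rule_format, OF that] .
  \<comment> \<open>The residual of the new generator under the current interpolation. By linearity
    the interpolation error of any combination is its coefficient at \<open>\<beta>\<close> times
    \<open>r\<close>.\<close>
  define r where "r x = \<phi> \<beta> x - (\<Sum>a<n. \<phi> \<beta> (X a) * l a x)" for x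
  define q where "q c x = (\<Sum>i\<in>insert \<beta> I. c i * \<phi> i x)" for c x
  have qr: "q c x - (\<Sum>a<n. q c (X a) * l a x) = c \<beta> * r x" if "x \<in> S" for c x
  proof -
    have q: "q c y = c \<beta> * \<phi> \<beta> y + (\<Sum>i\<in>I. c i * \<phi> i y)" for y
      using insert.hyps by (simp add: q_def)
    have "(\<Sum>a<n. q c (X a) * l a x) = c \<beta> * (\<Sum>a<n. \<phi> \<beta> (X a) * l a x) +
        (\<Sum>a<n. (\<Sum>i\<in>I. c i * \<phi> i (X a)) * l a x)"
      by (simp add: q distrib_right sum.distrib sum_distrib_left mult.assoc)
    then show ?thesis using ip[OF that, of c] by (simp add: q r_def algebra_simps)
  qed
  show ?case
  proof (cases "\<forall>x\<in>S. r x = 0")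
    case True
    have ipq: "q c x = (\<Sum>a<n. q c (X a) * l a x)" if "x \<in> S" for c x
      using qr[OF that, of c] True that by simp
    show ?thesis
    proof (intro exI conjI)
      show "\<forall>a<n. X a \<in> S \<and> l a \<in> W" by (intro allI impI conjI nXl)
      show "\<forall>c. \<forall>x\<in>S. (\<Sum>i\<in>insert \<beta> I. c i * \<phi> i x) =
          (\<Sum>a<n. (\<Sum>i\<in>insert \<beta> I. c i * \<phi> i (X a)) * l a x)"
        by (intro allI ballI) (rule ipq[unfolded q_def])
    qed
  next
    case False
    then obtain x0 where x0: "x0 \<in> S" "r x0 \<noteq> 0" by blast
    \<comment> \<open>The residual normalized to 1 at the new node \<open>x0\<close>; the old
      functions are corrected by multiples of \<open>k\<close> so that they vanish at
      \<open>x0\<close>.\<close>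
    define k where "k x = r x / r x0" for x
    define X' where "X' a = (if a < n then X a else x0)" for a
    define l' where "l' a = (if a < n then (\<lambda>x. 1 * l a x + (- l a x0) * k x) else k)" for a
    have "(\<lambda>x. 1 * \<phi> \<beta> x + (- 1) * (\<Sum>a<n. \<phi> \<beta> (X a) * l a x)) \<in> W"
      by (rule cl[OF insert.prems[OF insertI1] lincomb_closed_sum[OF cl zero nXl(2)]])
    then have rW: "r \<in> W" by (simp add: r_def[abs_def])
    have "(\<lambda>x. inverse (r x0) * r x + 0 * r x) \<in> W" by (rule cl[OF rW rW])
    then have kW: "k \<in> W" by (simp add: k_def[abs_def] field_simps)
    have l'W: "l' a \<in> W" for a unfolding l'_def using cl[OF nXl(2) kW, of a 1 "- l a x0"] kW by simp
    have X'S: "X' a \<in> S" for a unfolding X'_def using nXl(1) x0 by simp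
    have ipq: "q c x = (\<Sum>a<Suc n. q c (X' a) * l' a x)" if x: "x \<in> S" for c x
    proof -
      have "(\<Sum>a<Suc n. q c (X' a) * l' a x) = (\<Sum>a<n. q c (X a) * (l a x - l a x0 * k x)) + q c x0 * k x"
        by (simp add: X'_def l'_def)
      also have "(\<Sum>a<n. q c (X a) * (l a x - l a x0 * k x)) =
          (\<Sum>a<n. q c (X a) * l a x) - (\<Sum>a<n. q c (X a) * l a x0) * k x"
        by (simp add: right_diff_distrib sum_subtractf sum_distrib_right mult.assoc)
      also have "\<dots> + q c x0 * k x = (\<Sum>a<n. q c (X a) * l a x) + (c \<beta> * r x0) * k x"
        by (simp add: qr[OF x0(1), symmetric] algebra_simps)
      also have "(c \<beta> * r x0) * k x = c \<beta> * r x" using x0 by (simp add: k_def)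
      also have "(\<Sum>a<n. q c (X a) * l a x) + c \<beta> * r x = q c x"
        by (simp add: qr[OF x, symmetric])
      finally show ?thesis by simp
    qed
    show ?thesis
    proof (intro exI conjI)
      show "\<forall>a<Suc n. X' a \<in> S \<and> l' a \<in> W" by (intro allI impI conjI X'S l'W)
      show "\<forall>c. \<forall>x\<in>S. (\<Sum>i\<in>insert \<beta> I. c i * \<phi> i x) =
          (\<Sum>a<Suc n. (\<Sum>i\<in>insert \<beta> I. c i * \<phi> i (X' a)) * l' a x)"
        by (intro allI ballI) (rule ipq[unfolded q_def])
    qed
  qed
qed

lemma poly_space_lincomb:
  assumes "p \<in> poly_space N" "q \<in> poly_space N"
  shows "(\<lambda>x. u * p x + w * q x) \<in> poly_space N"
proof -
  obtain c where c: "\<forall>x. p x = (\<Sum>\<alpha> | (\<Sum>i\<in>UNIV. \<alpha> i) \<le> N. c \<alpha> * (\<Prod>i\<in>UNIV. (x $ i) ^ \<alpha> i))"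
    using assms(1) unfolding poly_space_def by blast
  obtain d where d: "\<forall>x. q x = (\<Sum>\<alpha> | (\<Sum>i\<in>UNIV. \<alpha> i) \<le> N. d \<alpha> * (\<Prod>i\<in>UNIV. (x $ i) ^ \<alpha> i))"
    using assms(2) unfolding poly_space_def by blast
  have "u * p x + w * q x = (\<Sum>\<alpha> | (\<Sum>i\<in>UNIV. \<alpha> i) \<le> N. (u * c \<alpha> + w * d \<alpha>) * (\<Prod>i\<in>UNIV. (x $ i) ^ \<alpha> i))" for x
    by (simp only: c d sum_distrib_left distrib_right sum.distrib mult.assoc)
  then show ?thesis unfolding poly_space_def by (intro CollectI exI allI)
qed

lemma finite_multi_indices: "finite {\<alpha> :: 'd::finite \<Rightarrow> nat. (\<Sum>i\<in>UNIV. \<alpha> i) \<le> N}"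
proof (rule finite_subset)
  show "{\<alpha> :: 'd \<Rightarrow> nat. (\<Sum>i\<in>UNIV. \<alpha> i) \<le> N} \<subseteq> PiE UNIV (\<lambda>_. {..N})"
  proof
    fix \<alpha> :: "'d \<Rightarrow> nat" assume "\<alpha> \<in> {\<alpha>. (\<Sum>i\<in>UNIV. \<alpha> i) \<le> N}"
    moreover have "\<alpha> i \<le> (\<Sum>i\<in>UNIV. \<alpha> i)" for i by (rule member_le_sum) auto
    ultimately have "\<alpha> i \<le> N" for i using order_trans by blast
    then show "\<alpha> \<in> PiE UNIV (\<lambda>_. {..N})" by auto
  qed
qed (simp add: finite_PiE)

text \<open>The nodes are taken inside \<open>S\<close> because a discrete function is prescribed
  only on its element; its nodal values then are traces of the function itself.\<close>

lemma poly_space_interpolation: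
  obtains n :: nat and X :: "nat \<Rightarrow> real^'d::finite" and l where
    "\<And>a. a < n \<Longrightarrow> X a \<in> S" "\<And>a. a < n \<Longrightarrow> l a \<in> poly_space N"
    "\<And>p x. p \<in> poly_space N \<Longrightarrow> x \<in> S \<Longrightarrow> p x = (\<Sum>a<n. p (X a) * l a x)"
proof -
  let ?I = "{\<alpha> :: 'd \<Rightarrow> nat. (\<Sum>i\<in>UNIV. \<alpha> i) \<le> N}"
  let ?\<phi> = "\<lambda>\<alpha> (x::real^'d). \<Prod>i\<in>UNIV. (x $ i) ^ \<alpha> i"
  have z: "(\<lambda>x. 0) \<in> poly_space N"
    unfolding poly_space_def by (rule CollectI, rule exI[of _ "\<lambda>_. 0"]) simp
  have m: "?\<phi> \<alpha> \<in> poly_space N" if "\<alpha> \<in> ?I" for \<alpha>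
    unfolding poly_space_def
  proof (rule CollectI, rule exI[of _ "\<lambda>\<beta>. if \<beta> = \<alpha> then 1 else 0"], rule allI)
    fix x :: "real^'d"
    have "(\<Sum>\<beta>\<in>?I. (if \<beta> = \<alpha> then 1 else 0) * ?\<phi> \<beta> x) = (\<Sum>\<beta>\<in>?I. if \<beta> = \<alpha> then ?\<phi> \<beta> x else 0)"
      by (intro sum.cong) auto
    also have "\<dots> = ?\<phi> \<alpha> x" using that finite_multi_indices by (subst sum.delta) auto
    finally show "?\<phi> \<alpha> x = (\<Sum>\<beta>\<in>?I. (if \<beta> = \<alpha> then 1 else 0) * ?\<phi> \<beta> x)" by simp
  qed
  obtain n :: nat and X l where *: "\<forall>a<n. X a \<in> S \<and> l a \<in> poly_space N"
    "\<forall>c. \<forall>x\<in>S. (\<Sum>\<alpha>\<in>?I. c \<alpha> * ?\<phi> \<alpha> x) = (\<Sum>a<n. (\<Sum>\<alpha>\<in>?I. c \<alpha> * ?\<phi> \<alpha> (X a)) * l a x)"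
    using interpolation_points[OF finite_multi_indices, of "poly_space N" N ?\<phi> S, OF poly_space_lincomb z m] by blast
  show thesis
  proof (rule that[of n X l])
    fix p :: "real^'d \<Rightarrow> real" and x assume p: "p \<in> poly_space N" and x: "x \<in> S"
    then obtain c where "\<forall>y. p y = (\<Sum>\<alpha>\<in>?I. c \<alpha> * ?\<phi> \<alpha> y)" unfolding poly_space_def by blast
    then show "p x = (\<Sum>a<n. p (X a) * l a x)" using *(2) x by simp
  qed (use * in auto)
qed

text \<open>Cutting the coefficient off outside \<open>\<Omega>\<close> gives a bounded measurable
  function on the whole space, which differs from it on \<open>D\<close> only in a null set.\<close>

lemma set_integrable_bounded_coefficient:
  fixes k g :: "'a::euclidean_space \<Rightarrow> real"
  assumes k: "set_borel_measurable lebesgue \<Omega> k" "\<And>x. x \<in> \<Omega> \<Longrightarrow> \<bar>k x\<bar> \<le> B"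
    and D: "compact D" "negligible (D - \<Omega>)" and g: "continuous_on D g"
  shows "set_integrable lebesgue D (\<lambda>x. k x * g x)"
proof -
  define h where "h x = indicator \<Omega> x *\<^sub>R k x" for x
  have hm: "h \<in> borel_measurable lebesgue" using k(1) by (simp add: h_def[abs_def] set_borel_measurable_def)
  \<comment> \<open>The bound is known only at points of \<open>\<Omega>\<close> and carries no sign
    by itself; the absolute value covers the points outside, where \<open>h\<close> is 0.\<close>
  have hB: "\<bar>h x\<bar> \<le> \<bar>B\<bar>" for x using k(2)[of x] by (auto simp: h_def indicator_def)
  have gi: "integrable lebesgue (\<lambda>x. indicator D x *\<^sub>R g x)"
    using set_integrable_continuous_compact[OF D(1) g] by (simp add: set_integrable_def)
  have "integrable lebesgue (\<lambda>x. h x * (indicator D x *\<^sub>R g x))"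
  proof (rule Bochner_Integration.integrable_bound)
    show "integrable lebesgue (\<lambda>x. B * (indicator D x *\<^sub>R g x))" using gi by simp
    show "(\<lambda>x. h x * (indicator D x *\<^sub>R g x)) \<in> borel_measurable lebesgue"
      using hm borel_measurable_integrable[OF gi] by (rule borel_measurable_times)
    show "AE x in lebesgue. norm (h x * (indicator D x *\<^sub>R g x)) \<le> norm (B * (indicator D x *\<^sub>R g x))"
      using hB by (intro AE_I2) (simp add: abs_mult mult_right_mono)
  qed
  then have "set_integrable lebesgue D (\<lambda>x. h x * g x)"
    by (simp add: set_integrable_def mult.left_commute)
  moreover have "set_integrable lebesgue D (\<lambda>x. h x * g x) \<longleftrightarrow> set_integrable lebesgue D (\<lambda>x. k x * g x)"
    by (rule set_lebesgue_integral_spike(1)[OF D(2)]) (auto simp: h_def)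
  ultimately show ?thesis by simp
qed

text \<open>Positive definiteness gives invertibility, and symmetry passes to the inverse. The entry
  bound is polarization: the form at \<open>axis i 1 + axis j 1\<close>, of squared norm at most 4,
  lies between 0 and \<open>4 * B\<close>, and the diagonal entries lie between 0 and
  \<open>B\<close>.\<close>

lemma spd_inverse:
  fixes A :: "real^'n::finite^'n"
  assumes sym: "transpose A = A" and pos: "0 < c" "\<And>u. norm u = 1 \<Longrightarrow> c \<le> u \<bullet> (A *v u)"
    and inv: "0 < c'" "\<And>u. norm u = 1 \<Longrightarrow> c' \<le> u \<bullet> (matrix_inv A *v u) \<and> u \<bullet> (matrix_inv A *v u) \<le> B"
  shows "det A \<noteq> 0" "transpose (matrix_inv A) = matrix_inv A" "\<bar>matrix_inv A $ i $ j\<bar> \<le> 2 * B"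
proof -
  let ?I = "matrix_inv A"
  have quad: "x \<bullet> (P *v x) = (norm x)\<^sup>2 * ((x /\<^sub>R norm x) \<bullet> (P *v (x /\<^sub>R norm x)))" if "x \<noteq> 0"
    for x and P :: "real^'n^'n"
    using that by (simp add: matrix_vector_mult_scaleR power2_eq_square field_simps)
  have "inj (\<lambda>x. A *v x)"
  proof (rule linear_injective_0[THEN iffD2, rule_format])
    fix x assume "A *v x = 0"
    show "x = 0"
    proof (rule ccontr)
      assume x: "x \<noteq> 0"
      then have "c \<le> (x /\<^sub>R norm x) \<bullet> (A *v (x /\<^sub>R norm x))" by (intro pos(2)) simp
      then have "0 < x \<bullet> (A *v x)" unfolding quad[OF x] using x pos(1) by (intro mult_pos_pos) auto
      with \<open>A *v x = 0\<close> show False by simp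
    qed
  qed simp
  then show d: "det A \<noteq> 0" using det_nz_iff_inj[of "\<lambda>x. A *v x"] by simp
  note I = matrix_inv_det[OF d]
  have "transpose ?I ** A = mat 1"
    using arg_cong[OF I(1), of transpose] by (simp add: matrix_transpose_mul sym)
  then have "transpose ?I = transpose ?I ** (A ** ?I)" by (simp add: I)
  also have "\<dots> = (transpose ?I ** A) ** ?I" by (rule matrix_mul_assoc)
  also have "\<dots> = ?I" by (simp add: \<open>transpose ?I ** A = mat 1\<close>)
  finally show ts: "transpose ?I = ?I" .
  have ub: "0 \<le> x \<bullet> (?I *v x)" "x \<bullet> (?I *v x) \<le> B * (norm x)\<^sup>2" for x
  proof -
    have "0 \<le> x \<bullet> (?I *v x) \<and> x \<bullet> (?I *v x) \<le> B * (norm x)\<^sup>2"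
    proof (cases "x = 0")
      case False
      have "norm (x /\<^sub>R norm x) = 1" using False by simp
      note b = inv(2)[OF this]
      show ?thesis unfolding quad[OF False] using b inv(1)
        by (auto simp: mult.commute[of B] intro!: mult_nonneg_nonneg mult_left_mono)
    qed simp
    then show "0 \<le> x \<bullet> (?I *v x)" "x \<bullet> (?I *v x) \<le> B * (norm x)\<^sup>2" by auto
  qed
  have e: "axis i 1 \<bullet> (?I *v axis j 1) = ?I $ i $ j" for i j
    by (simp add: inner_axis' matrix_vector_mult_basis column_def)
  have "transpose ?I $ i $ j = ?I $ j $ i" by (simp add: transpose_def)
  then have s: "?I $ j $ i = ?I $ i $ j" by (simp only: ts)
  let ?u = "axis i 1 :: real^'n" and ?v = "axis j 1 :: real^'n"
  have nu: "norm (axis l (1::real)) = 1" for l :: 'n by simp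
  have 1: "(?u + ?v) \<bullet> (?I *v (?u + ?v)) = ?I $ i $ i + 2 * ?I $ i $ j + ?I $ j $ j"
    by (simp add: matrix_vector_right_distrib inner_add e s)
  have 2: "?I $ l $ l \<le> B" "0 \<le> ?I $ l $ l" for l
    using ub[of "axis l 1"] nu[of l] e[of l l] by simp_all
  have n: "(norm (?u + ?v))\<^sup>2 \<le> 4"
  proof -
    have "norm (?u + ?v) \<le> 2" using norm_triangle_ineq[of ?u ?v] by simp
    then have "(norm (?u + ?v))\<^sup>2 \<le> 2\<^sup>2" by (intro power_mono) auto
    then show ?thesis by simp
  qed
  have B0: "0 \<le> B" using 2[of i] by linarith
  have "B * (norm (?u + ?v))\<^sup>2 \<le> B * 4" using n B0 by (rule mult_left_mono)
  then have "?I $ i $ i + 2 * ?I $ i $ j + ?I $ j $ j \<le> 4 * B" "0 \<le> ?I $ i $ i + 2 * ?I $ i $ j + ?I $ j $ j"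
    using ub[of "?u + ?v"] unfolding 1 by linarith+
  then show "\<bar>?I $ i $ j\<bar> \<le> 2 * B" using 2[of i] 2[of j] by linarith
qed

text \<open>Cramer's rule writes the entry as a quotient of polynomials in measurable entries. Only
  the values on \<open>\<Omega>\<close> matter after multiplication by the indicator.\<close>

lemma set_borel_measurable_matrix_inv:
  fixes C :: "'a::euclidean_space \<Rightarrow> real^'n::finite^'n"
  assumes C: "set_borel_measurable lebesgue \<Omega> C" and \<Omega>: "\<Omega> \<in> sets lebesgue"
    and d: "\<And>x. x \<in> \<Omega> \<Longrightarrow> det (C x) \<noteq> 0"
  shows "set_borel_measurable lebesgue \<Omega> (\<lambda>x. matrix_inv (C x) $ i $ j)"
proof -
  define H where "H x = indicator \<Omega> x *\<^sub>R C x" for x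
  have H: "H \<in> borel_measurable lebesgue" using C by (simp add: H_def[abs_def] set_borel_measurable_def)
  have nth: "(\<lambda>x. H x $ a $ b) \<in> borel_measurable lebesgue" for a b
    by (rule borel_measurable_continuous_on[OF _ H]) (intro continuous_intros)
  have m: "(\<lambda>x. rdet (\<lambda>m. b m x)) \<in> borel_measurable lebesgue"
    if "\<And>m l. (\<lambda>x. b m x $ l) \<in> borel_measurable lebesgue" for b :: "'n \<Rightarrow> 'a \<Rightarrow> real^'n"
    unfolding rdet_expand using that by (intro borel_measurable_sum borel_measurable_times borel_measurable_prod borel_measurable_const)
  have "(\<lambda>x. rdet (\<lambda>m. if m = i then axis j 1 else column m (H x)) / rdet (\<lambda>m. column m (H x))) \<in> borel_measurable lebesgue"
  proof (intro borel_measurable_divide m)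
    fix m l
    show "(\<lambda>x. (if m = i then axis j 1 else column m (H x)) $ l) \<in> borel_measurable lebesgue"
      by (cases "m = i") (simp_all add: column_def nth)
  qed (simp add: column_def nth)
  then have "(\<lambda>x. indicator \<Omega> x *\<^sub>R (rdet (\<lambda>m. if m = i then axis j 1 else column m (H x)) / rdet (\<lambda>m. column m (H x))))
      \<in> borel_measurable lebesgue"
    using \<Omega> by (intro borel_measurable_scaleR borel_measurable_indicator)
  moreover have "indicator \<Omega> x *\<^sub>R (rdet (\<lambda>m. if m = i then axis j 1 else column m (H x)) / rdet (\<lambda>m. column m (H x))) =
      indicator \<Omega> x *\<^sub>R matrix_inv (C x) $ i $ j" for x
  proof (cases "x \<in> \<Omega>")
    case True
    have "(\<chi> m. column m (C x)) = transpose (C x)" by (simp add: column_def transpose_def vec_eq_iff)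
    then have "rdet (\<lambda>m. column m (C x)) = det (C x)" by (simp add: rdet_def)
    moreover have "matrix_inv (C x) $ i $ j = (matrix_inv (C x) *v axis j 1) $ i"
      by (simp add: matrix_vector_mult_basis column_def)
    moreover have HC: "H x = C x" using True by (simp add: H_def)
    ultimately show ?thesis using matrix_inv_nth[OF d[OF True], of "axis j 1" i]
      unfolding HC by (simp add: fun_upd_def)
  qed simp
  ultimately show ?thesis by (simp add: set_borel_measurable_def)
qed

text \<open>Makes the weighted inner product a bilinear form in the nodal values; all the analysis
  is absorbed into constant coefficients, which will not depend on time.\<close>

lemma L2_inner_expansion:
  fixes K :: "real^'d::finite \<Rightarrow> real^'m::finite^'m" and u w :: "real^'d \<Rightarrow> real^'m"
  assumes K: "\<And>i j g. continuous_on D g \<Longrightarrow> set_integrable lebesgue D (\<lambda>x. K x $ i $ j * g x)"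
    and l: "\<And>a. a < n \<Longrightarrow> continuous_on D (l a)"
    and u: "\<And>x i. x \<in> D \<Longrightarrow> u x $ i = (\<Sum>a<n. U a i * l a x)"
    and w: "\<And>x i. x \<in> D \<Longrightarrow> w x $ i = (\<Sum>a<n. W a i * l a x)"
  shows "L2_inner D (\<lambda>x. K x *v u x) w =
    (\<Sum>i\<in>UNIV. \<Sum>j\<in>UNIV. \<Sum>a<n. \<Sum>b<n. (U b j * W a i) * (LINT x:D|lebesgue. K x $ i $ j * (l a x * l b x)))"
proof -
  have int: "set_integrable lebesgue D (\<lambda>x. (U b j * W a i) * (K x $ i $ j * (l a x * l b x)))"
    if "a < n" "b < n" for i j a b
    using that by (intro set_integrable_mult_right K continuous_on_mult l)
  have "L2_inner D (\<lambda>x. K x *v u x) w =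
      (LINT x:D|lebesgue. \<Sum>(i, j, a, b)\<in>UNIV \<times> UNIV \<times> {..<n} \<times> {..<n}. (U b j * W a i) * (K x $ i $ j * (l a x * l b x)))"
    unfolding L2_inner_def
  proof (rule set_lebesgue_integral_spike(2)[of "{}"])
    fix x assume "x \<in> D - {}"
    then have x: "x \<in> D" by simp
    have "(K x *v u x) \<bullet> w x = (\<Sum>i\<in>UNIV. \<Sum>j\<in>UNIV. K x $ i $ j * ((\<Sum>b<n. U b j * l b x) * (\<Sum>a<n. W a i * l a x)))"
      by (simp add: inner_vec_def matrix_vector_mult_def u[OF x] w[OF x] sum_distrib_right mult.assoc)
    also have "\<dots> = (\<Sum>i\<in>UNIV. \<Sum>j\<in>UNIV. \<Sum>a<n. \<Sum>b<n. (U b j * W a i) * (K x $ i $ j * (l a x * l b x)))"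
    proof (intro sum.cong refl)
      fix i j
      have "K x $ i $ j * ((\<Sum>b<n. U b j * l b x) * (\<Sum>a<n. W a i * l a x)) =
          (\<Sum>b<n. \<Sum>a<n. K x $ i $ j * ((U b j * l b x) * (W a i * l a x)))"
        by (subst sum_product) (simp only: sum_distrib_left)
      also have "\<dots> = (\<Sum>a<n. \<Sum>b<n. K x $ i $ j * ((U b j * l b x) * (W a i * l a x)))" by (rule sum.swap)
      finally show "K x $ i $ j * ((\<Sum>b<n. U b j * l b x) * (\<Sum>a<n. W a i * l a x)) =
          (\<Sum>a<n. \<Sum>b<n. (U b j * W a i) * (K x $ i $ j * (l a x * l b x)))"
        by (simp add: ac_simps)
    qed
    finally show "(K x *v u x) \<bullet> w x =
        (\<Sum>(i, j, a, b)\<in>UNIV \<times> UNIV \<times> {..<n} \<times> {..<n}. (U b j * W a i) * (K x $ i $ j * (l a x * l b x)))"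
      by (simp add: sum.cartesian_product)
  qed simp
  also have "\<dots> = (\<Sum>p\<in>UNIV \<times> UNIV \<times> {..<n} \<times> {..<n}. LINT x:D|lebesgue.
      (case p of (i, j, a, b) \<Rightarrow> (U b j * W a i) * (K x $ i $ j * (l a x * l b x))))"
    by (rule set_lebesgue_integral_sum) (auto intro: int)
  also have "\<dots> = (\<Sum>(i, j, a, b)\<in>UNIV \<times> UNIV \<times> {..<n} \<times> {..<n}.
      (U b j * W a i) * (LINT x:D|lebesgue. K x $ i $ j * (l a x * l b x)))"
    by (intro sum.cong refl) (auto split: prod.splits)
  finally show ?thesis by (simp add: sum.cartesian_product)
qed

text \<open>In terms of nodal values the energy is a quadratic form with constant coefficients, so
  the product rule replaces differentiation under the integral and pointwise differentiability in
  time suffices. Symmetry of the weight almost everywhere merges the two product rule terms into the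
  factor 2.\<close>

lemma L2_inner_energy_derivative:
  fixes K :: "real^'d::finite \<Rightarrow> real^'m::finite^'m" and u :: "real \<Rightarrow> real^'d \<Rightarrow> real^'m"
  assumes K: "\<And>i j g. continuous_on D g \<Longrightarrow> set_integrable lebesgue D (\<lambda>x. K x $ i $ j * g x)"
    and sym: "negligible Z" "\<And>x. x \<in> D - Z \<Longrightarrow> transpose (K x) = K x"
    and l: "\<And>a. a < n \<Longrightarrow> continuous_on D (l a)" and Y: "\<And>a. a < n \<Longrightarrow> Y a \<in> D"
    and u: "\<And>s x i. s \<in> T \<Longrightarrow> x \<in> D \<Longrightarrow> u s x $ i = (\<Sum>a<n. u s (Y a) $ i * l a x)"
    and t: "t \<in> T" "at t within T \<noteq> bot"
    and diff: "\<And>x. x \<in> D \<Longrightarrow> (\<lambda>s. u s x) differentiable (at t within T)"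
  defines "u' \<equiv> \<lambda>x. vector_derivative (\<lambda>s. u s x) (at t within T)"
  shows "((\<lambda>s. L2_inner D (\<lambda>x. K x *v u s x) (u s)) has_vector_derivative
    2 * L2_inner D (\<lambda>x. K x *v u' x) (u t)) (at t within T)"
proof -
  have du: "((\<lambda>s. u s x $ i) has_real_derivative u' x $ i) (at t within T)" if "x \<in> D" for x i
  proof -
    have "((\<lambda>s. u s x) has_vector_derivative u' x) (at t within T)"
      unfolding u'_def using diff[OF that] by (simp add: vector_derivative_works)
    then have "((\<lambda>s. u s x $ i) has_vector_derivative u' x $ i) (at t within T)"
      by (rule bounded_linear.has_vector_derivative[OF bounded_linear_vec_nth])
    then show ?thesis by (simp add: has_real_derivative_iff_has_vector_derivative)
  qed
  \<comment> \<open>The time derivative is reproduced by its own nodal values: both sides are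
    derivatives at \<open>t\<close> of the same function on \<open>T\<close>, and such derivatives
    are unique because \<open>t\<close> is not isolated.\<close>
  have u': "u' x $ i = (\<Sum>a<n. u' (Y a) $ i * l a x)" if x: "x \<in> D" for x i
  proof -
    have "((\<lambda>s. \<Sum>a<n. u s (Y a) $ i * l a x) has_real_derivative (\<Sum>a<n. u' (Y a) $ i * l a x)) (at t within T)"
      by (intro DERIV_sum DERIV_cmult_right du Y) simp
    then have "((\<lambda>s. \<Sum>a<n. u s (Y a) $ i * l a x) has_vector_derivative (\<Sum>a<n. u' (Y a) $ i * l a x)) (at t within T)"
      by (simp only: has_real_derivative_iff_has_vector_derivative)
    then have d1: "((\<lambda>s. u s x $ i) has_vector_derivative (\<Sum>a<n. u' (Y a) $ i * l a x)) (at t within T)"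
      by (rule has_vector_derivative_transform[OF t(1) u[OF _ x], rotated])
    have d2: "((\<lambda>s. u s x $ i) has_vector_derivative u' x $ i) (at t within T)"
      using du[OF x, of i] by (simp only: has_real_derivative_iff_has_vector_derivative)
    show ?thesis
      using vector_derivative_within[OF t(2) d1] vector_derivative_within[OF t(2) d2] by simp
  qed
  let ?c = "\<lambda>i j a b. LINT x:D|lebesgue. K x $ i $ j * (l a x * l b x)"
  let ?E = "\<lambda>U W. \<Sum>i\<in>UNIV. \<Sum>j\<in>UNIV. \<Sum>a<n. \<Sum>b<n. (U (Y b) $ j * W (Y a) $ i) * ?c i j a b"
  have ex: "L2_inner D (\<lambda>x. K x *v p x) q = ?E p q"
    if "\<And>x i. x \<in> D \<Longrightarrow> p x $ i = (\<Sum>a<n. p (Y a) $ i * l a x)" "\<And>x i. x \<in> D \<Longrightarrow> q x $ i = (\<Sum>a<n. q (Y a) $ i * l a x)"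
    for p q :: "real^'d \<Rightarrow> real^'m"
    by (rule L2_inner_expansion[OF K l that])
  have "((\<lambda>s. ?E (u s) (u s)) has_real_derivative
      (\<Sum>i\<in>UNIV. \<Sum>j\<in>UNIV. \<Sum>a<n. \<Sum>b<n.
        (u' (Y b) $ j * u t (Y a) $ i + u' (Y a) $ i * u t (Y b) $ j) * ?c i j a b)) (at t within T)"
    by (intro DERIV_sum DERIV_cmult_right DERIV_mult du Y) simp_all
  also have "(\<Sum>i\<in>UNIV. \<Sum>j\<in>UNIV. \<Sum>a<n. \<Sum>b<n.
        (u' (Y b) $ j * u t (Y a) $ i + u' (Y a) $ i * u t (Y b) $ j) * ?c i j a b) = ?E u' (u t) + ?E (u t) u'"
    by (simp add: distrib_right sum.distrib mult.commute[of "u' _ $ _" "u t _ $ _"])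
  also have "?E (u t) u' = ?E u' (u t)"
  proof -
    have "?E (u t) u' = L2_inner D (\<lambda>x. K x *v u t x) u'" by (rule ex[symmetric]) (use u[OF t(1)] u' in auto)
    also have "\<dots> = L2_inner D (\<lambda>x. K x *v u' x) (u t)"
      unfolding L2_inner_def
    proof (rule set_lebesgue_integral_spike(2)[OF sym(1)])
      fix x assume "x \<in> D - Z"
      then show "(K x *v u t x) \<bullet> u' x = (K x *v u' x) \<bullet> u t x"
        using inner_transpose_mult[of "K x" "u t x" "u' x"] sym(2) by (simp add: inner_commute)
    qed
    also have "\<dots> = ?E u' (u t)" by (rule ex) (use u[OF t(1)] u' in auto)
    finally show ?thesis .
  qed
  also have "?E u' (u t) + ?E u' (u t) = 2 * L2_inner D (\<lambda>x. K x *v u' x) (u t)"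
    by (subst ex) (use u[OF t(1)] u' in auto)
  finally have "((\<lambda>s. ?E (u s) (u s)) has_vector_derivative 2 * L2_inner D (\<lambda>x. K x *v u' x) (u t)) (at t within T)"
    by (simp add: has_real_derivative_iff_has_vector_derivative)
  then show ?thesis
    by (rule has_vector_derivative_transform[OF t(1), rotated]) (rule ex; use u in auto)
qed

section \<open>Integration by parts on an element\<close>

lemma surface_integral_uminus:
  fixes E :: "'e::finite itself"
  shows "surface_integral E f (\<lambda>x. - g x) = - surface_integral E f g"
proof -
  have neg: "(LINT x:A|M. - h x) = - (LINT x:A|M. h x)" for A M and h :: "real^'e \<Rightarrow> real"
    using set_integral_mult_right[of M A "- 1" h] by simp
  show ?thesis unfolding surface_integral_def Let_def mult_minus_left by (rule neg)
qed

text \<open>The normal may be meaningless on the edges of a face, whereas additivity of surface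
  integrals needs integrability. Agreement on the relative interior with a function continuous on
  the closed face provides it and is stable under the operations used.\<close>

definition patch_continuous ::
  "'e::finite itself \<Rightarrow> (real^'d::finite) set \<Rightarrow> (real^'d \<Rightarrow> 'b::topological_space) \<Rightarrow> bool" where
  "patch_continuous E f g \<longleftrightarrow> (\<exists>h. continuous_on f h \<and> (\<forall>x\<in>patch_interior E f. g x = h x))"

lemma patch_continuousI: "continuous_on f g \<Longrightarrow> patch_continuous E f g"
  unfolding patch_continuous_def by blast

lemma patch_continuous_compose2:
  assumes "patch_continuous E f g" "patch_continuous E f h"
    and "\<And>g h. continuous_on f g \<Longrightarrow> continuous_on f h \<Longrightarrow> continuous_on f (\<lambda>x. F (g x) (h x))"
  shows "patch_continuous E f (\<lambda>x. F (g x) (h x))"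
proof -
  obtain g' h' where g: "continuous_on f g'" "\<And>x. x \<in> patch_interior E f \<Longrightarrow> g x = g' x"
    and h: "continuous_on f h'" "\<And>x. x \<in> patch_interior E f \<Longrightarrow> h x = h' x"
    using assms(1,2) unfolding patch_continuous_def by auto
  show ?thesis
    unfolding patch_continuous_def
    by (rule exI[of _ "\<lambda>x. F (g' x) (h' x)"]) (simp add: assms(3) g h)
qed

lemma patch_continuous_compose:
  assumes "patch_continuous E f g" and "\<And>g. continuous_on f g \<Longrightarrow> continuous_on f (\<lambda>x. F (g x))"
  shows "patch_continuous E f (\<lambda>x. F (g x))"
  by (rule patch_continuous_compose2[OF assms(1,1), of "\<lambda>a b. F a"]) (rule assms(2))

lemma patch_continuous_add:
  fixes g h :: "_ \<Rightarrow> 'b::real_normed_vector"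
  assumes "patch_continuous E f g" "patch_continuous E f h"
  shows "patch_continuous E f (\<lambda>x. g x + h x)"
  by (rule patch_continuous_compose2[OF assms]) (rule continuous_on_add)

lemma patch_continuous_diff:
  fixes g h :: "_ \<Rightarrow> 'b::real_normed_vector"
  assumes "patch_continuous E f g" "patch_continuous E f h"
  shows "patch_continuous E f (\<lambda>x. g x - h x)"
  by (rule patch_continuous_compose2[OF assms]) (rule continuous_on_diff)

lemma patch_continuous_inner:
  fixes g h :: "_ \<Rightarrow> 'b::real_inner"
  assumes "patch_continuous E f g" "patch_continuous E f h"
  shows "patch_continuous E f (\<lambda>x. g x \<bullet> h x)"
  by (rule patch_continuous_compose2[OF assms]) (rule continuous_on_inner)

lemma patch_continuous_scaleR:
  fixes g :: "_ \<Rightarrow> 'b::real_normed_vector"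
  assumes "patch_continuous E f g"
  shows "patch_continuous E f (\<lambda>x. c *\<^sub>R g x)"
  by (rule patch_continuous_compose[OF assms]) (intro continuous_intros)

lemma patch_continuous_minus:
  fixes g :: "_ \<Rightarrow> 'b::real_normed_vector"
  assumes "patch_continuous E f g"
  shows "patch_continuous E f (\<lambda>x. - g x)"
  by (rule patch_continuous_compose[OF assms]) (intro continuous_intros)

lemma surface_integral_add:
  fixes \<gamma> :: "real^'e::finite \<Rightarrow> real^'d::finite"
  assumes \<gamma>: "smooth_embedding \<gamma> ref_simplex" "\<gamma> ` ref_simplex = f"
    and g: "patch_continuous TYPE('e) f g" and h: "patch_continuous TYPE('e) f h"
  shows "surface_integral TYPE('e) f (\<lambda>x. g x + h x) = surface_integral TYPE('e) f g + surface_integral TYPE('e) f h"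
proof -
  obtain g' where g: "continuous_on f g'" "\<And>x. x \<in> patch_interior TYPE('e) f \<Longrightarrow> g x = g' x"
    using g unfolding patch_continuous_def by auto
  obtain h' where h: "continuous_on f h'" "\<And>x. x \<in> patch_interior TYPE('e) f \<Longrightarrow> h x = h' x"
    using h unfolding patch_continuous_def by auto
  have "surface_integral TYPE('e) f (\<lambda>x. g x + h x) = surface_integral TYPE('e) f (\<lambda>x. g' x + h' x)"
    by (rule surface_integral_cong[OF \<gamma>]) (simp add: g h)
  also have "\<dots> = surface_integral TYPE('e) f g' + surface_integral TYPE('e) f h'"
    by (rule surface_integral_add_continuous[OF \<gamma> g(1) h(1)])
  also have "surface_integral TYPE('e) f g' = surface_integral TYPE('e) f g"
    by (rule surface_integral_cong[OF \<gamma>]) (simp add: g)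
  also have "surface_integral TYPE('e) f h' = surface_integral TYPE('e) f h"
    by (rule surface_integral_cong[OF \<gamma>]) (simp add: h)
  finally show ?thesis .
qed

section \<open>The volume terms in divergence form\<close>

lemma continuous_on_matrix_mult:
  "continuous_on S g \<Longrightarrow> continuous_on S (\<lambda>x. (B :: real^'d::finite^'n::finite) *v g x)"
  by (rule bounded_linear.continuous_on[OF matrix_vector_mul_bounded_linear])

lemma matrix_sum_mult:
  fixes A :: "'d::finite \<Rightarrow> real^'c::finite^'n::finite"
  shows "(\<Sum>i\<in>UNIV. a i *\<^sub>R A i) *v x = (\<Sum>i\<in>UNIV. a i *\<^sub>R (A i *v x))"
proof -
  have "((\<Sum>i\<in>UNIV. a i *\<^sub>R A i) *v x) $ r = (\<Sum>i\<in>UNIV. a i *\<^sub>R (A i *v x)) $ r" for r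
  proof -
    have "((\<Sum>i\<in>UNIV. a i *\<^sub>R A i) *v x) $ r = (\<Sum>c\<in>UNIV. \<Sum>i\<in>UNIV. a i * (A i $ r $ c * x $ c))"
      by (simp add: matrix_vector_mult_def sum_distrib_right mult.assoc)
    also have "\<dots> = (\<Sum>i\<in>UNIV. \<Sum>c\<in>UNIV. a i * (A i $ r $ c * x $ c))" by (rule sum.swap)
    finally show ?thesis by (simp add: matrix_vector_mult_def sum_distrib_left)
  qed
  then show ?thesis by (simp add: vec_eq_iff)
qed

lemma transpose_sum_scaleR:
  fixes A :: "'d::finite \<Rightarrow> real^'c::finite^'n::finite"
  shows "transpose (\<Sum>i\<in>UNIV. a i *\<^sub>R A i) = (\<Sum>i\<in>UNIV. a i *\<^sub>R transpose (A i))"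
  by (simp add: vec_eq_iff transpose_def)

lemma patch_continuous_normal_matrix:
  fixes A_i :: "'d::finite \<Rightarrow> real^'c::finite^'n::finite" and n :: "real^'d \<Rightarrow> real^'d"
  assumes A: "\<And>n. A n = (\<Sum>i\<in>UNIV. n $ i *\<^sub>R A_i i)"
    and n: "patch_continuous E f n"
  shows "patch_continuous E f v \<Longrightarrow> patch_continuous E f (\<lambda>x. A (n x) *v v x)"
    "patch_continuous E f s \<Longrightarrow> patch_continuous E f (\<lambda>x. transpose (A (n x)) *v s x)"
  unfolding A transpose_sum_scaleR matrix_sum_mult
  by (rule patch_continuous_compose2[OF n], assumption, intro continuous_intros continuous_on_matrix_mult; assumption)+

text \<open>Linearity in the direction turns continuity for each fixed direction into continuity for
  a continuously varying one.\<close>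

lemma continuous_on_derivative_apply:
  fixes u' :: "real^'d::finite \<Rightarrow> real^'d \<Rightarrow> real^'m::finite"
  assumes lin: "\<And>\<xi>. linear (u' \<xi>)" and u': "\<And>h. continuous_on S (\<lambda>\<xi>. u' \<xi> h)" and w: "continuous_on S w"
  shows "continuous_on S (\<lambda>\<xi>. u' \<xi> (w \<xi>))"
proof -
  have "u' \<xi> (w \<xi>) = (\<Sum>j\<in>UNIV. w \<xi> $ j *\<^sub>R u' \<xi> (axis j 1))" for \<xi>
  proof -
    have "w \<xi> = (\<Sum>j\<in>UNIV. w \<xi> $ j *\<^sub>R axis j 1)"
      by (simp add: vec_eq_iff axis_def if_distrib cong: if_cong)
    then have "u' \<xi> (w \<xi>) = u' \<xi> (\<Sum>j\<in>UNIV. w \<xi> $ j *\<^sub>R axis j 1)" by simp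
    also have "\<dots> = (\<Sum>j\<in>UNIV. w \<xi> $ j *\<^sub>R u' \<xi> (axis j 1))"
      by (simp add: linear_sum[OF lin] linear_cmul[OF lin])
    finally show ?thesis .
  qed
  then show ?thesis by (simp only:) (intro continuous_intros u' w)
qed

text \<open>The product rule for the field with components
  \<open>\<sigma> k x \<bullet> (A_i j *v v k x)\<close> yields both volume integrands, since the
  transpose of \<open>A_i j\<close> moves across the inner product; the flux of this field through a
  face is linear in the normal, which assembles the \<open>A_i\<close> into
  \<open>A\<close>.\<close>

lemma element_integration_by_parts:
  fixes M :: "('k, 'd::finite) dg_mesh" and A_i :: "'d \<Rightarrow> real^'d^'n::finite"
    and v :: "'k \<Rightarrow> real^'d \<Rightarrow> real^'d" and \<sigma> :: "'k \<Rightarrow> real^'d \<Rightarrow> real^'n"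
  assumes card: "CARD('e::finite) + 1 = CARD('d)" and A: "\<And>n. A n = (\<Sum>i\<in>UNIV. n $ i *\<^sub>R A_i i)"
    and M: "conforming_mesh M \<Omega>" and \<Omega>: "lipschitz_domain \<Omega>" and k: "k \<in> elems M"
    and v: "v \<in> dg_space M N" and \<sigma>: "\<sigma> \<in> dg_space M N"
  shows "L2_inner (elem M k) (\<lambda>x. \<Sum>i\<in>UNIV. transpose (A_i i) *v partial (elem M k) i (\<sigma> k) x) (v k) +
      L2_inner (elem M k) (\<lambda>x. \<Sum>i\<in>UNIV. A_i i *v partial (elem M k) i (v k) x) (\<sigma> k) =
    (\<Sum>f\<in>elem_faces M k. surface_integral TYPE('e) f (\<lambda>x. \<sigma> k x \<bullet> (A (normal M k x) *v v k x)))"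
proof -
  let ?\<Phi> = "emap M k" and ?D = "elem M k" and ?S = "ref_simplex :: (real^'d) set"
  have \<Phi>: "smooth_embedding ?\<Phi> ?S" using M k by (simp add: conforming_mesh_def)
  note neg = negligible_elem_minus_domain[OF M \<Omega> k]
  note i = chart_inverse[OF \<Phi> compact_ref_simplex]
  obtain vh vh' where v: "\<And>\<xi>. \<xi> \<in> ?S \<Longrightarrow> v k (?\<Phi> \<xi>) = vh \<xi>"
    and dv: "\<And>\<xi>. (vh has_derivative vh' \<xi>) (at \<xi>)" and cv: "\<And>h. continuous_on UNIV (\<lambda>\<xi>. vh' \<xi> h)"
    by (rule dg_space_representation[OF v k]) (rule that)
  obtain \<sigma>h \<sigma>h' where \<sigma>: "\<And>\<xi>. \<xi> \<in> ?S \<Longrightarrow> \<sigma> k (?\<Phi> \<xi>) = \<sigma>h \<xi>"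
    and d\<sigma>: "\<And>\<xi>. (\<sigma>h has_derivative \<sigma>h' \<xi>) (at \<xi>)" and c\<sigma>: "\<And>h. continuous_on UNIV (\<lambda>\<xi>. \<sigma>h' \<xi> h)"
    by (rule dg_space_representation[OF \<sigma> k]) (rule that)
  have cvh: "continuous_on UNIV vh" and c\<sigma>h: "continuous_on UNIV \<sigma>h"
    using dv d\<sigma> by (auto intro!: has_derivative_continuous_on[where f' = vh'] has_derivative_continuous_on[where f' = \<sigma>h'])
  let ?I = "\<lambda>\<xi>. matrix_inv (jac ?\<Phi> \<xi>)" and ?inv = "inv_into ?S ?\<Phi>"
  have pv: "partial ?D j (v k) (?\<Phi> \<xi>) = vh' \<xi> (?I \<xi> *v axis j 1)"
    and p\<sigma>: "partial ?D j (\<sigma> k) (?\<Phi> \<xi>) = \<sigma>h' \<xi> (?I \<xi> *v axis j 1)" if "\<xi> \<in> interior ?S" for \<xi> j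
    unfolding partial_def elem_def
    by (simp_all add: frechet_derivative_chart[OF \<Phi> compact_ref_simplex that v dv]
        frechet_derivative_chart[OF \<Phi> compact_ref_simplex that \<sigma> d\<sigma>])
  \<comment> \<open>\<open>g1\<close> and \<open>g2\<close> are the volume integrands in reference
    coordinates. They are continuous on the closed simplex and agree with the given ones off a null
    set, which justifies adding the two integrals.\<close>
  define g1 where "g1 \<xi> = (\<Sum>j\<in>UNIV. transpose (A_i j) *v \<sigma>h' \<xi> (?I \<xi> *v axis j 1)) \<bullet> vh \<xi>" for \<xi>
  define g2 where "g2 \<xi> = (\<Sum>j\<in>UNIV. A_i j *v vh' \<xi> (?I \<xi> *v axis j 1)) \<bullet> \<sigma>h \<xi>" for \<xi>
  have cw: "continuous_on ?S (\<lambda>\<xi>. ?I \<xi> *v axis j 1)" for j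
    by (rule continuous_on_jac_inv[OF \<Phi> continuous_on_const])
  have cv1: "continuous_on ?S (\<lambda>\<xi>. vh' \<xi> (?I \<xi> *v axis j 1))" for j
    by (rule continuous_on_derivative_apply[OF has_derivative_linear[OF dv] continuous_on_subset[OF cv subset_UNIV] cw])
  have c\<sigma>1: "continuous_on ?S (\<lambda>\<xi>. \<sigma>h' \<xi> (?I \<xi> *v axis j 1))" for j
    by (rule continuous_on_derivative_apply[OF has_derivative_linear[OF d\<sigma>] continuous_on_subset[OF c\<sigma> subset_UNIV] cw])
  have c1: "continuous_on ?S g1" "continuous_on ?S g2"
    unfolding g1_def g2_def
    by (intro continuous_on_inner continuous_on_sum continuous_on_matrix_mult cv1 c\<sigma>1
        continuous_on_subset[OF cvh subset_UNIV] continuous_on_subset[OF c\<sigma>h subset_UNIV])+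
  have int: "set_integrable lebesgue ?D (\<lambda>x. g (?inv x))" if "continuous_on ?S g" for g :: "real^'d \<Rightarrow> real"
    by (rule set_integrable_continuous_compact[OF neg(3)], unfold elem_def,
        rule continuous_on_compose2[OF that i(2)]) (use i(1) in auto)
  have on: "\<exists>\<xi>\<in>interior ?S. x = ?\<Phi> \<xi> \<and> ?inv x = \<xi> \<and> \<xi> \<in> ?S" if "x \<in> ?D - (?D - ?\<Phi> ` interior ?S)" for x
  proof -
    from that obtain \<xi> where \<xi>: "\<xi> \<in> interior ?S" "x = ?\<Phi> \<xi>" by blast
    have \<xi>S: "\<xi> \<in> ?S" by (rule subsetD[OF interior_subset \<xi>(1)])
    show ?thesis by (rule bexI[OF _ \<xi>(1)]) (use \<xi>(2) \<xi>S i(1)[OF \<xi>S] in simp)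
  qed
  have L1: "L2_inner ?D (\<lambda>x. \<Sum>j\<in>UNIV. transpose (A_i j) *v partial ?D j (\<sigma> k) x) (v k) = (LINT x:?D|lebesgue. g1 (?inv x))"
    unfolding L2_inner_def
  proof (rule set_lebesgue_integral_spike(2)[OF neg(1)])
    fix x assume "x \<in> ?D - (?D - ?\<Phi> ` interior ?S)"
    from on[OF this] obtain \<xi> where \<xi>: "\<xi> \<in> interior ?S" "x = ?\<Phi> \<xi>" "?inv x = \<xi>" "\<xi> \<in> ?S" by blast
    show "(\<Sum>j\<in>UNIV. transpose (A_i j) *v partial ?D j (\<sigma> k) x) \<bullet> v k x = g1 (?inv x)"
      unfolding \<xi>(3) unfolding \<xi>(2) by (simp only: p\<sigma>[OF \<xi>(1)] v[OF \<xi>(4)] g1_def)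
  qed
  have L2: "L2_inner ?D (\<lambda>x. \<Sum>j\<in>UNIV. A_i j *v partial ?D j (v k) x) (\<sigma> k) = (LINT x:?D|lebesgue. g2 (?inv x))"
    unfolding L2_inner_def
  proof (rule set_lebesgue_integral_spike(2)[OF neg(1)])
    fix x assume "x \<in> ?D - (?D - ?\<Phi> ` interior ?S)"
    from on[OF this] obtain \<xi> where \<xi>: "\<xi> \<in> interior ?S" "x = ?\<Phi> \<xi>" "?inv x = \<xi>" "\<xi> \<in> ?S" by blast
    show "(\<Sum>j\<in>UNIV. A_i j *v partial ?D j (v k) x) \<bullet> \<sigma> k x = g2 (?inv x)"
      unfolding \<xi>(3) unfolding \<xi>(2) by (simp only: pv[OF \<xi>(1)] \<sigma>[OF \<xi>(4)] g2_def)
  qed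
  define F where "F x = (\<chi> j. \<sigma> k x \<bullet> (A_i j *v v k x))" for x
  define Fh where "Fh \<xi> = (\<chi> j. \<sigma>h \<xi> \<bullet> (A_i j *v vh \<xi>))" for \<xi>
  define Fh' where "Fh' \<xi> h = (\<chi> j. \<sigma>h \<xi> \<bullet> (A_i j *v vh' \<xi> h) + \<sigma>h' \<xi> h \<bullet> (A_i j *v vh \<xi>))" for \<xi> h
  have F: "F (?\<Phi> \<xi>) = Fh \<xi>" if "\<xi> \<in> ?S" for \<xi> using that by (simp add: F_def Fh_def v \<sigma>)
  have dF: "(Fh has_derivative Fh' \<xi>) (at \<xi>)" for \<xi>
    unfolding Fh_def[abs_def] Fh'_def[abs_def]
    by (intro has_derivative_vec_lambda_nth has_derivative_inner d\<sigma>
        bounded_linear.has_derivative[OF matrix_vector_mul_bounded_linear] dv)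
  have cF: "continuous_on UNIV (\<lambda>\<xi>. Fh' \<xi> h)" for h
    unfolding Fh'_def by (intro continuous_on_vec_lambda continuous_intros continuous_on_matrix_mult cv c\<sigma> cvh c\<sigma>h)
  have sum: "g1 \<xi> + g2 \<xi> = (\<Sum>j\<in>UNIV. Fh' \<xi> (?I \<xi> *v axis j 1) $ j)" for \<xi>
    by (simp only: g1_def g2_def Fh'_def inner_sum_left inner_transpose_mult sum.distrib vec_lambda_beta)
       (simp add: inner_commute add.commute)
  have "L2_inner ?D (\<lambda>x. \<Sum>i\<in>UNIV. transpose (A_i i) *v partial ?D i (\<sigma> k) x) (v k) +
      L2_inner ?D (\<lambda>x. \<Sum>i\<in>UNIV. A_i i *v partial ?D i (v k) x) (\<sigma> k) =
      (LINT x:?D|lebesgue. g1 (?inv x) + g2 (?inv x))"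
    unfolding L1 L2 by (rule set_integral_add(2)[OF int[OF c1(1)] int[OF c1(2)], symmetric])
  also have "\<dots> = (LINT x:?\<Phi> ` ?S|lebesgue. \<Sum>j\<in>UNIV. frechet_derivative F (at x within ?\<Phi> ` ?S) (axis j 1) $ j)"
    unfolding elem_def[symmetric]
  proof (rule set_lebesgue_integral_spike(2)[OF neg(1)])
    fix x assume "x \<in> ?D - (?D - ?\<Phi> ` interior ?S)"
    from on[OF this] obtain \<xi> where \<xi>: "\<xi> \<in> interior ?S" "x = ?\<Phi> \<xi>" "?inv x = \<xi>" "\<xi> \<in> ?S" by blast
    show "g1 (?inv x) + g2 (?inv x) = (\<Sum>j\<in>UNIV. frechet_derivative F (at x within ?D) (axis j 1) $ j)"
      unfolding \<xi>(3) sum unfolding \<xi>(2) elem_def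
      by (simp only: frechet_derivative_chart[OF \<Phi> compact_ref_simplex \<xi>(1) F dF])
  qed
  also have "\<dots> = (\<Sum>f\<in>(`) ?\<Phi> ` ref_faces. surface_integral TYPE('e) f (\<lambda>x. F x \<bullet> outward_normal (?\<Phi> ` ?S) x))"
    by (rule element_divergence[OF card \<Phi> F dF cF])
  also have "\<dots> = (\<Sum>f\<in>elem_faces M k. surface_integral TYPE('e) f (\<lambda>x. \<sigma> k x \<bullet> (A (normal M k x) *v v k x)))"
  proof -
    have "F x \<bullet> outward_normal (?\<Phi> ` ?S) x = \<sigma> k x \<bullet> (A (normal M k x) *v v k x)" for x
      unfolding A matrix_sum_mult normal_def elem_def
      by (simp add: F_def inner_vec_def[of "vec_lambda _"] inner_sum_right mult.commute)
    then show ?thesis by (simp add: elem_faces_def)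
  qed
  finally show ?thesis .
qed

text \<open>The integrand on one side of a face once all boundary terms are collected; \<open>jv\<close> and \<open>jt\<close>
  are the velocity and the traction jump.\<close>

definition face_term ::
  "real^'d::finite^'n::finite \<Rightarrow> real^'d \<Rightarrow> real^'d \<Rightarrow> real^'d \<Rightarrow> real^'n \<Rightarrow> real \<Rightarrow> real \<Rightarrow> real" where
  "face_term B jv jt v s tv ts = s \<bullet> (B *v v) +
     (((1/2) *\<^sub>R jt + (tv / 2) *\<^sub>R (transpose B *v (B *v jv))) \<bullet> v +
      ((1/2) *\<^sub>R (B *v jv) + (ts / 2) *\<^sub>R (B *v jt)) \<bullet> s)"

lemma face_term_eq:
  "face_term B jv jt v s tv ts = s \<bullet> (B *v v) + (jt \<bullet> v) / 2 + tv / 2 * ((B *v jv) \<bullet> (B *v v)) +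
     ((B *v jv) \<bullet> s) / 2 + ts / 2 * (jt \<bullet> (transpose B *v s))"
proof -
  have e: "(B *v jt) \<bullet> s = jt \<bullet> (transpose B *v s)"
    using inner_transpose_mult[of B s jt] by (simp only: inner_commute)
  show ?thesis
    by (simp only: face_term_def inner_add_left inner_scaleR_left inner_transpose_mult e)
qed

text \<open>The opposite normal and the reversed jump change sign together, so both sides see the
  same traction jump and the same matrix-weighted velocity jump. The central parts leave half of
  \<open>s' \<bullet> (B *v v) + s \<bullet> (B *v v')\<close> on one side and its negative on the
  other; the penalty parts pair the jump with minus itself.\<close>

lemma face_term_interior:
  fixes B :: "real^'d::finite^'n::finite"
  shows "face_term B (v' - v) (transpose B *v (s' - s)) v s tv ts +
      face_term (- B) (v - v') (transpose (- B) *v (s - s')) v' s' tv ts =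
    - (tv / 2 * (norm (B *v (v' - v)))\<^sup>2 + ts / 2 * (norm (transpose B *v (s' - s)))\<^sup>2)"
proof -
  define b where "b = B *v v" define b' where "b' = B *v v'"
  define a where "a = transpose B *v s" define a' where "a' = transpose B *v s'"
  have mB: "(- B) *v x = - (B *v x)" for x by (simp add: vec_eq_iff matrix_vector_mult_def sum_negf)
  have mT: "transpose (- B) *v x = - (transpose B *v x)" for x
    by (simp add: vec_eq_iff matrix_vector_mult_def transpose_def sum_negf)
  have d: "B *v (x - y) = B *v x - B *v y" "transpose B *v (p - q) = transpose B *v p - transpose B *v q" for x y p q
    by (simp_all add: matrix_vector_mult_diff_distrib)
  have ab: "a \<bullet> v = s \<bullet> b" "a' \<bullet> v = s' \<bullet> b" "a \<bullet> v' = s \<bullet> b'" "a' \<bullet> v' = s' \<bullet> b'"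
    by (simp_all only: a_def a'_def b_def b'_def inner_transpose_mult)
  show ?thesis
    unfolding face_term_eq mB mT d power2_norm_eq_inner a_def[symmetric] a'_def[symmetric] b_def[symmetric] b'_def[symmetric]
    by (simp add: inner_diff_left inner_diff_right ab inner_commute algebra_simps) (simp add: inner_commute field_simps)
qed

text \<open>Half of each jump enters the flux. One doubled jump, or two simple ones, therefore
  removes \<open>s \<bullet> (B *v v)\<close> exactly; this also explains the full penalty on the
  first two kinds of faces and the halved one on absorbing faces.\<close>

lemma face_term_boundary:
  fixes B :: "real^'d::finite^'n::finite"
  shows "face_term B (- 2 *\<^sub>R v) 0 v s tv ts = - (tv * (norm (B *v v))\<^sup>2)"
    "face_term B 0 (- 2 *\<^sub>R (transpose B *v s)) v s tv ts = - (ts * (norm (transpose B *v s))\<^sup>2)"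
    "face_term B (- v) (- (transpose B *v s)) v s tv ts =
      - (tv / 2 * (norm (B *v v))\<^sup>2 + ts / 2 * (norm (transpose B *v s))\<^sup>2)"
proof -
  have m: "B *v (- v) = - (B *v v)" "B *v (- 2 *\<^sub>R v) = - 2 *\<^sub>R (B *v v)"
    by (simp_all add: matrix_vector_mult_scaleR vec.neg)
  define a where "a = transpose B *v s"
  have t: "a \<bullet> v = s \<bullet> (B *v v)" unfolding a_def by (rule inner_transpose_mult)
  show "face_term B (- 2 *\<^sub>R v) 0 v s tv ts = - (tv * (norm (B *v v))\<^sup>2)"
    "face_term B 0 (- 2 *\<^sub>R (transpose B *v s)) v s tv ts = - (ts * (norm (transpose B *v s))\<^sup>2)"
    "face_term B (- v) (- (transpose B *v s)) v s tv ts =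
      - (tv / 2 * (norm (B *v v))\<^sup>2 + ts / 2 * (norm (transpose B *v s))\<^sup>2)"
    unfolding face_term_eq m power2_norm_eq_inner a_def[symmetric]
    by (simp_all add: t inner_commute[of "B *v v" s])
qed

text \<open>Nodes and interpolating functions are carried over from the reference simplex by the
  chart, and the null set on which the coefficient is uncontrolled is the part of the element
  outside \<open>\<Omega>\<close>.\<close>

lemma dg_element_energy_derivative:
  fixes M :: "('k, 'd::finite) dg_mesh" and u :: "real \<Rightarrow> 'k \<Rightarrow> real^'d \<Rightarrow> real^'m::finite"
    and K :: "real^'d \<Rightarrow> real^'m^'m"
  assumes M: "conforming_mesh M \<Omega>" and \<Omega>: "lipschitz_domain \<Omega>" and k: "k \<in> elems M"
    and K: "\<And>i j. set_borel_measurable lebesgue \<Omega> (\<lambda>x. K x $ i $ j)" "\<And>x i j. x \<in> \<Omega> \<Longrightarrow> \<bar>K x $ i $ j\<bar> \<le> B"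
      "\<And>x. x \<in> \<Omega> \<Longrightarrow> transpose (K x) = K x"
    and u: "\<And>s. s \<in> T \<Longrightarrow> u s \<in> dg_space M N" and t: "t \<in> T" "at t within T \<noteq> bot"
    and diff: "\<And>x. x \<in> elem M k \<Longrightarrow> (\<lambda>s. u s k x) differentiable (at t within T)"
  shows "((\<lambda>s. L2_inner (elem M k) (\<lambda>x. K x *v u s k x) (u s k)) has_vector_derivative
    2 * L2_inner (elem M k) (\<lambda>x. K x *v vector_derivative (\<lambda>s. u s k x) (at t within T)) (u t k)) (at t within T)"
proof -
  let ?\<Phi> = "emap M k" and ?D = "elem M k" and ?S = "ref_simplex :: (real^'d) set"
  have \<Phi>: "smooth_embedding ?\<Phi> ?S" using M k by (simp add: conforming_mesh_def)
  note neg = negligible_elem_minus_domain[OF M \<Omega> k]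
  note i = chart_inverse[OF \<Phi> compact_ref_simplex]
  obtain n :: nat and X :: "nat \<Rightarrow> real^'d" and l where X: "\<And>a. a < n \<Longrightarrow> X a \<in> ?S"
    and l: "\<And>a. a < n \<Longrightarrow> l a \<in> poly_space N"
    and ip: "\<And>p x. p \<in> poly_space N \<Longrightarrow> x \<in> ?S \<Longrightarrow> p x = (\<Sum>a<n. p (X a) * l a x)"
    by (rule poly_space_interpolation) (rule that)
  show ?thesis
  proof (rule L2_inner_energy_derivative[where n = n and l = "\<lambda>a x. l a (inv_into ?S ?\<Phi> x)" and Y = "\<lambda>a. ?\<Phi> (X a)"
        and Z = "?D - \<Omega>" and u = "\<lambda>s. u s k"])
    show "set_integrable lebesgue ?D (\<lambda>x. K x $ i $ j * g x)" if "continuous_on ?D g" for i j g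
      by (rule set_integrable_bounded_coefficient[OF K(1,2) neg(3,2) that])
    show "negligible (?D - \<Omega>)" by (rule neg(2))
    show "transpose (K x) = K x" if "x \<in> ?D - (?D - \<Omega>)" for x using that by (intro K(3)) blast
    show "continuous_on ?D (\<lambda>x. l a (inv_into ?S ?\<Phi> x))" if a: "a < n" for a
    proof -
      obtain l' where "\<forall>x. (l a has_derivative l' x) (at x)" using poly_space_derivative[OF l[OF a]] by blast
      then have "continuous_on UNIV (l a)" by (intro has_derivative_continuous_on[where f' = l']) auto
      then show ?thesis unfolding elem_def by (rule continuous_on_compose2[OF _ i(2)]) auto
    qed
    show "?\<Phi> (X a) \<in> ?D" if "a < n" for a using X[OF that] by (simp add: elem_def)
    show "u s k x $ j = (\<Sum>a<n. u s k (?\<Phi> (X a)) $ j * l a (inv_into ?S ?\<Phi> x))" if s: "s \<in> T" and x: "x \<in> ?D" for s x j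
    proof -
      obtain \<xi> where \<xi>: "\<xi> \<in> ?S" "x = ?\<Phi> \<xi>" using x by (auto simp: elem_def)
      obtain p where p: "p \<in> poly_space N" "\<forall>x\<in>?S. u s k (?\<Phi> x) $ j = p x"
        using u[OF s] k unfolding dg_space_def by blast
      have "u s k x $ j = p \<xi>" using p(2) \<xi> by simp
      also have "\<dots> = (\<Sum>a<n. p (X a) * l a \<xi>)" by (rule ip[OF p(1) \<xi>(1)])
      also have "\<dots> = (\<Sum>a<n. u s k (?\<Phi> (X a)) $ j * l a (inv_into ?S ?\<Phi> x))"
        using p(2) X by (intro sum.cong refl) (simp add: \<xi>(2) i(1)[OF \<xi>(1)])
      finally show ?thesis .
    qed
  qed (use t diff in auto)
qed

section \<open>Energy balance\<close>

text \<open>Every integrand on a face is built from these five functions, so this is the source of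
  integrability on the faces.\<close>

lemma patch_continuous_jumps:
  fixes M :: "('k, 'd::finite) dg_mesh" and A_i :: "'d \<Rightarrow> real^'d^'n::finite"
  assumes card: "CARD('e::finite) + 1 = CARD('d)" and A: "\<And>n. A n = (\<Sum>i\<in>UNIV. n $ i *\<^sub>R A_i i)"
    and M: "conforming_mesh M \<Omega>" and bd: "boundary_partition M \<Omega>"
    and k: "k \<in> elems M" "f \<in> elem_faces M k"
    and v: "v \<in> dg_space M N" and \<sigma>: "\<sigma> \<in> dg_space M N"
  shows "patch_continuous TYPE('e) f (normal M k)" "patch_continuous TYPE('e) f (v k)"
    "patch_continuous TYPE('e) f (\<sigma> k)"
    "patch_continuous TYPE('e) f (\<lambda>x. vel_jump M v k f x)"
    "patch_continuous TYPE('e) f (\<lambda>x. trac_jump M A \<sigma> k f x)"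
proof -
  have se: "smooth_embedding (emap M l) ref_simplex" if "l \<in> elems M" for l
    using M that by (simp add: conforming_mesh_def)
  show n: "patch_continuous TYPE('e) f (normal M k)"
    using elem_face_normal(2)[OF card se[OF k(1)] k(2)] by (simp add: patch_continuous_def)
  have cv: "patch_continuous TYPE('e) f (v l)" and c\<sigma>: "patch_continuous TYPE('e) f (\<sigma> l)"
    if l: "l \<in> elems M" "f \<in> elem_faces M l" for l
    by (rule patch_continuousI, rule continuous_on_subset[OF dg_space_continuous[OF _ l(1) se[OF l(1)]]
          elem_face_normal(3)[OF card se[OF l(1)] l(2)]], rule v \<sigma>)+
  show v: "patch_continuous TYPE('e) f (v k)" by (rule cv[OF k])
  show \<sigma>: "patch_continuous TYPE('e) f (\<sigma> k)" by (rule c\<sigma>[OF k])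
  \<comment> \<open>The trace from the neighbour is continuous on \<open>f\<close> only once the
    neighbour is known to be an element having \<open>f\<close> as a face.\<close>
  have nb: "neighbor M k f \<in> elems M \<and> f \<in> elem_faces M (neighbor M k f)"
    if "f \<notin> vel_faces M" "f \<notin> trac_faces M" "f \<notin> abc_faces M"
  proof -
    have "f \<in> mesh_faces M" using k by (auto simp: mesh_faces_def)
    then have f: "f \<in> mesh_faces M - boundary_faces M \<Omega>"
      using bd that unfolding boundary_partition_def by blast
    obtain l where l: "face_elems M f = {minus_elem M f, l}"
      "neighbor M (minus_elem M f) f = l" "neighbor M l f = minus_elem M f"
      by (rule interior_face_elems[OF card M f]) (rule that)
    have "k \<in> face_elems M f" using k by (simp add: face_elems_def)
    then have "neighbor M k f \<in> face_elems M f" using l by auto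
    then show ?thesis by (simp add: face_elems_def)
  qed
  have z: "patch_continuous TYPE('e) f (\<lambda>x. 0 :: real^'d)"
    by (rule patch_continuousI) (rule continuous_on_const)
  have T: "patch_continuous TYPE('e) f (\<lambda>x. transpose (A (normal M k x)) *v s x)"
    if "patch_continuous TYPE('e) f s" for s
    by (rule patch_continuous_normal_matrix(2)[OF A n that])
  have "patch_continuous TYPE('e) f (\<lambda>x. - 2 *\<^sub>R v k x)" "patch_continuous TYPE('e) f (\<lambda>x. - v k x)"
    by (intro patch_continuous_scaleR patch_continuous_minus v)+
  moreover have "patch_continuous TYPE('e) f (\<lambda>x. v (neighbor M k f) x - v k x)"
    if "f \<notin> vel_faces M" "f \<notin> trac_faces M" "f \<notin> abc_faces M"
    using nb[OF that] by (intro patch_continuous_diff v cv) auto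
  ultimately show "patch_continuous TYPE('e) f (\<lambda>x. vel_jump M v k f x)"
    unfolding vel_jump_def using z
    by (cases "f \<in> vel_faces M"; cases "f \<in> trac_faces M"; cases "f \<in> abc_faces M") simp_all
  have "patch_continuous TYPE('e) f (\<lambda>x. - 2 *\<^sub>R (transpose (A (normal M k x)) *v \<sigma> k x))"
    "patch_continuous TYPE('e) f (\<lambda>x. - (transpose (A (normal M k x)) *v \<sigma> k x))"
    by (intro patch_continuous_scaleR patch_continuous_minus T \<sigma>)+
  moreover have "patch_continuous TYPE('e) f (\<lambda>x. transpose (A (normal M k x)) *v (\<sigma> (neighbor M k f) x - \<sigma> k x))"
    if "f \<notin> vel_faces M" "f \<notin> trac_faces M" "f \<notin> abc_faces M"
    using nb[OF that] by (intro T patch_continuous_diff \<sigma> c\<sigma>) auto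
  ultimately show "patch_continuous TYPE('e) f (\<lambda>x. trac_jump M A \<sigma> k f x)"
    unfolding trac_jump_def Let_def using z
    by (cases "f \<in> vel_faces M"; cases "f \<in> trac_faces M"; cases "f \<in> abc_faces M") simp_all
qed

definition face_flux ::
  "('k, 'd::finite) dg_mesh \<Rightarrow> (real^'d \<Rightarrow> real^'d^'n::finite) \<Rightarrow> ((real^'d) set \<Rightarrow> real) \<Rightarrow> ((real^'d) set \<Rightarrow> real) \<Rightarrow>
    ('k \<Rightarrow> real^'d \<Rightarrow> real^'d) \<Rightarrow> ('k \<Rightarrow> real^'d \<Rightarrow> real^'n) \<Rightarrow> 'k \<Rightarrow> (real^'d) set \<Rightarrow> real^'d \<Rightarrow> real" where
  "face_flux M A \<tau>v \<tau>\<sigma> v \<sigma> k f x = face_term (A (normal M k x)) (vel_jump M v k f x) (trac_jump M A \<sigma> k f x)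
     (v k x) (\<sigma> k x) (\<tau>v f) (\<tau>\<sigma> f)"

text \<open>The three integrals stem from the integrated volume terms and from the two boundary
  inner products; the continuity statements permit merging them into one.\<close>

lemma patch_continuous_face_flux:
  fixes M :: "('k, 'd::finite) dg_mesh" and A_i :: "'d \<Rightarrow> real^'d^'n::finite"
    and \<tau>v \<tau>\<sigma> :: "(real^'d) set \<Rightarrow> real"
  assumes card: "CARD('e::finite) + 1 = CARD('d)" and A: "\<And>n. A n = (\<Sum>i\<in>UNIV. n $ i *\<^sub>R A_i i)"
    and M: "conforming_mesh M \<Omega>" and bd: "boundary_partition M \<Omega>"
    and k: "k \<in> elems M" "f \<in> elem_faces M k"
    and v: "v \<in> dg_space M N" and \<sigma>: "\<sigma> \<in> dg_space M N"
  defines "I0 \<equiv> \<lambda>x. \<sigma> k x \<bullet> (A (normal M k x) *v v k x)"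
    and "I1 \<equiv> \<lambda>x. ((1/2) *\<^sub>R trac_jump M A \<sigma> k f x + (\<tau>v f / 2) *\<^sub>R (transpose (A (normal M k x)) *v
                         (A (normal M k x) *v vel_jump M v k f x))) \<bullet> v k x"
    and "I2 \<equiv> \<lambda>x. ((1/2) *\<^sub>R (A (normal M k x) *v vel_jump M v k f x) +
                      (\<tau>\<sigma> f / 2) *\<^sub>R (A (normal M k x) *v trac_jump M A \<sigma> k f x)) \<bullet> \<sigma> k x"
  shows "patch_continuous TYPE('e) f (face_flux M A \<tau>v \<tau>\<sigma> v \<sigma> k f)"
    "surface_integral TYPE('e) f I0 + (surface_integral TYPE('e) f I1 + surface_integral TYPE('e) f I2) =
      surface_integral TYPE('e) f (face_flux M A \<tau>v \<tau>\<sigma> v \<sigma> k f)"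
proof -
  note pc = patch_continuous_jumps[OF card A M bd k v \<sigma>]
  note AN = patch_continuous_normal_matrix[OF A pc(1)]
  have c: "patch_continuous TYPE('e) f I0" "patch_continuous TYPE('e) f I1" "patch_continuous TYPE('e) f I2"
    unfolding I0_def I1_def I2_def
    by (intro patch_continuous_inner patch_continuous_add patch_continuous_scaleR AN pc)+
  have eq: "face_flux M A \<tau>v \<tau>\<sigma> v \<sigma> k f = (\<lambda>x. I0 x + (I1 x + I2 x))"
    by (simp add: fun_eq_iff face_flux_def face_term_def I0_def I1_def I2_def)
  have c12: "patch_continuous TYPE('e) f (\<lambda>x. I1 x + I2 x)" by (rule patch_continuous_add[OF c(2,3)])
  show "patch_continuous TYPE('e) f (face_flux M A \<tau>v \<tau>\<sigma> v \<sigma> k f)"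
    unfolding eq by (rule patch_continuous_add[OF c(1) c12])
  have "smooth_embedding (emap M k) ref_simplex" using M k by (simp add: conforming_mesh_def)
  then obtain \<gamma> :: "real^'e \<Rightarrow> real^'d" where \<gamma>: "smooth_embedding \<gamma> ref_simplex" "\<gamma> ` ref_simplex = f"
    by (rule elem_face_param[OF card _ k(2)]) blast
  show "surface_integral TYPE('e) f I0 + (surface_integral TYPE('e) f I1 + surface_integral TYPE('e) f I2) =
      surface_integral TYPE('e) f (face_flux M A \<tau>v \<tau>\<sigma> v \<sigma> k f)"
    unfolding eq by (simp only: surface_integral_add[OF \<gamma> c(1) c12] surface_integral_add[OF \<gamma> c(2,3)])
qed

lemma face_flux_interior:
  fixes M :: "('k, 'd::finite) dg_mesh" and A_i :: "'d \<Rightarrow> real^'d^'n::finite"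
  assumes card: "CARD('e::finite) + 1 = CARD('d)" and A: "\<And>n. A n = (\<Sum>i\<in>UNIV. n $ i *\<^sub>R A_i i)"
    and M: "conforming_mesh M \<Omega>" and bd: "boundary_partition M \<Omega>"
    and f: "f \<in> mesh_faces M - boundary_faces M \<Omega>"
    and v: "v \<in> dg_space M N" and \<sigma>: "\<sigma> \<in> dg_space M N"
  shows "(\<Sum>k\<in>face_elems M f. surface_integral TYPE('e) f (face_flux M A \<tau>v \<tau>\<sigma> v \<sigma> k f)) =
    - surface_integral TYPE('e) f (\<lambda>x. let k = minus_elem M f in
                \<tau>v f / 2 * (norm (A (normal M k x) *v vel_jump M v k f x))\<^sup>2 +
                \<tau>\<sigma> f / 2 * (norm (trac_jump M A \<sigma> k f x))\<^sup>2)"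
proof -
  define k where "k = minus_elem M f"
  obtain l where "minus_elem M f \<noteq> l" "face_elems M f = {minus_elem M f, l}"
    "neighbor M (minus_elem M f) f = l" "neighbor M l f = minus_elem M f"
    by (rule interior_face_elems[OF card M f]) (rule that)
  note l = this[folded k_def]
  have kl: "k \<in> elems M" "f \<in> elem_faces M k" "l \<in> elems M" "f \<in> elem_faces M l"
    using l(2) by (auto simp: face_elems_def)
  have nb: "f \<notin> vel_faces M" "f \<notin> trac_faces M" "f \<notin> abc_faces M"
    using f bd unfolding boundary_partition_def by blast+
  have "smooth_embedding (emap M k) ref_simplex" using M kl by (simp add: conforming_mesh_def)
  then obtain \<gamma> :: "real^'e \<Rightarrow> real^'d" where \<gamma>: "smooth_embedding \<gamma> ref_simplex" "\<gamma> ` ref_simplex = f"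
    by (rule elem_face_param[OF card _ kl(2)]) blast
  have c: "patch_continuous TYPE('e) f (face_flux M A \<tau>v \<tau>\<sigma> v \<sigma> k f)"
    "patch_continuous TYPE('e) f (face_flux M A \<tau>v \<tau>\<sigma> v \<sigma> l f)"
    by (rule patch_continuous_face_flux(1)[OF card A M bd _ _ v \<sigma>]; rule kl)+
  let ?g = "\<lambda>x. \<tau>v f / 2 * (norm (A (normal M k x) *v vel_jump M v k f x))\<^sup>2 + \<tau>\<sigma> f / 2 * (norm (trac_jump M A \<sigma> k f x))\<^sup>2"
  have "(\<Sum>k\<in>face_elems M f. surface_integral TYPE('e) f (face_flux M A \<tau>v \<tau>\<sigma> v \<sigma> k f)) =
      surface_integral TYPE('e) f (\<lambda>x. face_flux M A \<tau>v \<tau>\<sigma> v \<sigma> k f x + face_flux M A \<tau>v \<tau>\<sigma> v \<sigma> l f x)"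
    using l(1) by (simp add: l(2) surface_integral_add[OF \<gamma> c])
  also have "\<dots> = surface_integral TYPE('e) f (\<lambda>x. - ?g x)"
  proof (rule surface_integral_cong[OF \<gamma>])
    fix x assume x: "x \<in> patch_interior TYPE('e) f"
    have n: "normal M l x = - normal M k x" by (rule mesh_normals_opposite[OF card M kl l(1) x])
    have An: "A (normal M l x) = - A (normal M k x)" unfolding A n by (simp add: sum_negf)
    show "face_flux M A \<tau>v \<tau>\<sigma> v \<sigma> k f x + face_flux M A \<tau>v \<tau>\<sigma> v \<sigma> l f x = - ?g x"
      unfolding face_flux_def vel_jump_def trac_jump_def Let_def An
      by (simp only: nb l(3,4) if_False face_term_interior)
  qed
  also have "\<dots> = - surface_integral TYPE('e) f ?g" by (rule surface_integral_uminus)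
  finally show ?thesis by (simp add: k_def Let_def)
qed

lemma face_flux_boundary:
  fixes M :: "('k, 'd::finite) dg_mesh" and A :: "real^'d \<Rightarrow> real^'d^'n::finite"
  assumes card: "CARD('e::finite) + 1 = CARD('d)" and M: "conforming_mesh M \<Omega>" and \<Omega>: "lipschitz_domain \<Omega>"
    and bd: "boundary_partition M \<Omega>"
  shows "f \<in> vel_faces M \<Longrightarrow> (\<Sum>k\<in>face_elems M f. surface_integral TYPE('e) f (face_flux M A \<tau>v \<tau>\<sigma> v \<sigma> k f)) =
      - surface_integral TYPE('e) f (\<lambda>x. let k = minus_elem M f in \<tau>v f * (norm (A (normal M k x) *v v k x))\<^sup>2)"
    "f \<in> trac_faces M \<Longrightarrow> (\<Sum>k\<in>face_elems M f. surface_integral TYPE('e) f (face_flux M A \<tau>v \<tau>\<sigma> v \<sigma> k f)) =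
      - surface_integral TYPE('e) f (\<lambda>x. let k = minus_elem M f in
          \<tau>\<sigma> f * (norm (transpose (A (normal M k x)) *v \<sigma> k x))\<^sup>2)"
    "f \<in> abc_faces M \<Longrightarrow> (\<Sum>k\<in>face_elems M f. surface_integral TYPE('e) f (face_flux M A \<tau>v \<tau>\<sigma> v \<sigma> k f)) =
      - surface_integral TYPE('e) f (\<lambda>x. let k = minus_elem M f in
          \<tau>v f / 2 * (norm (A (normal M k x) *v v k x))\<^sup>2 +
          \<tau>\<sigma> f / 2 * (norm (transpose (A (normal M k x)) *v \<sigma> k x))\<^sup>2)"
proof -
  have one: "face_elems M f = {minus_elem M f}" if "f \<in> vel_faces M \<union> trac_faces M \<union> abc_faces M"
  proof (rule boundary_face_elems[OF card M \<Omega>])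
    have "vel_faces M \<union> trac_faces M \<union> abc_faces M = boundary_faces M \<Omega>"
      using bd by (simp add: boundary_partition_def)
    with that show "f \<in> boundary_faces M \<Omega>" by (simp only:)
  qed
  let ?k = "minus_elem M f"
  have red: "(\<Sum>k\<in>face_elems M f. surface_integral TYPE('e) f (face_flux M A \<tau>v \<tau>\<sigma> v \<sigma> k f)) = - surface_integral TYPE('e) f g"
    if "f \<in> vel_faces M \<union> trac_faces M \<union> abc_faces M" "\<And>x. face_flux M A \<tau>v \<tau>\<sigma> v \<sigma> ?k f x = - g x" for g
  proof -
    have "face_flux M A \<tau>v \<tau>\<sigma> v \<sigma> ?k f = (\<lambda>x. - g x)" by (rule ext) (rule that(2))
    then show ?thesis by (simp add: one[OF that(1)] surface_integral_uminus)
  qed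
  { assume f: "f \<in> vel_faces M"
    show "(\<Sum>k\<in>face_elems M f. surface_integral TYPE('e) f (face_flux M A \<tau>v \<tau>\<sigma> v \<sigma> k f)) =
      - surface_integral TYPE('e) f (\<lambda>x. let k = minus_elem M f in \<tau>v f * (norm (A (normal M k x) *v v k x))\<^sup>2)"
      by (rule red) (use f in \<open>simp_all only: face_flux_def vel_jump_def trac_jump_def Let_def if_True face_term_boundary(1) Un_iff simp_thms\<close>) }
  { assume f: "f \<in> trac_faces M"
    then have n: "f \<notin> vel_faces M" using bd by (auto simp: boundary_partition_def)
    show "(\<Sum>k\<in>face_elems M f. surface_integral TYPE('e) f (face_flux M A \<tau>v \<tau>\<sigma> v \<sigma> k f)) =
      - surface_integral TYPE('e) f (\<lambda>x. let k = minus_elem M f in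
          \<tau>\<sigma> f * (norm (transpose (A (normal M k x)) *v \<sigma> k x))\<^sup>2)"
      by (rule red) (use f n in \<open>simp_all only: face_flux_def vel_jump_def trac_jump_def Let_def if_True if_False face_term_boundary(2) Un_iff simp_thms\<close>) }
  { assume f: "f \<in> abc_faces M"
    then have n: "f \<notin> vel_faces M" "f \<notin> trac_faces M" using bd by (auto simp: boundary_partition_def)
    show "(\<Sum>k\<in>face_elems M f. surface_integral TYPE('e) f (face_flux M A \<tau>v \<tau>\<sigma> v \<sigma> k f)) =
      - surface_integral TYPE('e) f (\<lambda>x. let k = minus_elem M f in
          \<tau>v f / 2 * (norm (A (normal M k x) *v v k x))\<^sup>2 +
          \<tau>\<sigma> f / 2 * (norm (transpose (A (normal M k x)) *v \<sigma> k x))\<^sup>2)"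
      by (rule red) (use f n in \<open>simp_all only: face_flux_def vel_jump_def trac_jump_def Let_def if_True if_False face_term_boundary(3) Un_iff simp_thms\<close>) }
qed

text \<open>Double counting of the incident pairs of an element and a face, followed by the
  partition of the faces.\<close>

lemma face_sum_split:
  fixes M :: "('k, 'd::finite) dg_mesh" and G :: "'k \<Rightarrow> (real^'d) set \<Rightarrow> real"
  assumes card: "CARD('e::finite) + 1 = CARD('d)" and M: "conforming_mesh M \<Omega>" and bd: "boundary_partition M \<Omega>"
  shows "(\<Sum>k\<in>elems M. \<Sum>f\<in>elem_faces M k. G k f) =
    (\<Sum>f\<in>mesh_faces M - boundary_faces M \<Omega>. \<Sum>k\<in>face_elems M f. G k f) +
    (\<Sum>f\<in>vel_faces M. \<Sum>k\<in>face_elems M f. G k f) + (\<Sum>f\<in>trac_faces M. \<Sum>k\<in>face_elems M f. G k f) +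
    (\<Sum>f\<in>abc_faces M. \<Sum>k\<in>face_elems M f. G k f)"
proof -
  let ?g = "\<lambda>f. \<Sum>k\<in>face_elems M f. G k f"
  have fin: "finite (elems M)" using M by (simp add: conforming_mesh_def)
  have "finite (elem_faces M k)" for k
    unfolding elem_faces_def by (intro finite_imageI facet_distinct(3)[OF card])
  then have fm: "finite (mesh_faces M)" unfolding mesh_faces_def using fin by (intro finite_UN_I)
  have sub: "vel_faces M \<union> trac_faces M \<union> abc_faces M = boundary_faces M \<Omega>" "boundary_faces M \<Omega> \<subseteq> mesh_faces M"
    and dj: "vel_faces M \<inter> trac_faces M = {}" "vel_faces M \<inter> abc_faces M = {}" "trac_faces M \<inter> abc_faces M = {}"
    using bd by (auto simp: boundary_partition_def boundary_faces_def)
  have fb: "finite (boundary_faces M \<Omega>)" by (rule finite_subset[OF sub(2) fm])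
  have "(\<Sum>k\<in>elems M. \<Sum>f\<in>elem_faces M k. G k f) = (\<Sum>k\<in>elems M. \<Sum>f\<in>{f\<in>mesh_faces M. f \<in> elem_faces M k}. G k f)"
    by (intro sum.cong refl) (auto simp: mesh_faces_def)
  also have "\<dots> = (\<Sum>f\<in>mesh_faces M. \<Sum>k\<in>{k\<in>elems M. f \<in> elem_faces M k}. G k f)"
    by (rule sum.swap_restrict[OF fin fm])
  also have "\<dots> = (\<Sum>f\<in>mesh_faces M. ?g f)" by (simp add: face_elems_def)
  also have "\<dots> = (\<Sum>f\<in>mesh_faces M - boundary_faces M \<Omega>. ?g f) + (\<Sum>f\<in>boundary_faces M \<Omega>. ?g f)"
    by (rule sum.subset_diff[OF sub(2) fm])
  also have "(\<Sum>f\<in>boundary_faces M \<Omega>. ?g f) = (\<Sum>f\<in>vel_faces M \<union> trac_faces M. ?g f) + (\<Sum>f\<in>abc_faces M. ?g f)"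
    unfolding sub(1)[symmetric] by (rule sum.union_disjoint) (use fb dj sub(1) in \<open>auto intro: finite_subset\<close>)
  also have "(\<Sum>f\<in>vel_faces M \<union> trac_faces M. ?g f) = (\<Sum>f\<in>vel_faces M. ?g f) + (\<Sum>f\<in>trac_faces M. ?g f)"
    by (rule sum.union_disjoint) (use fb dj sub(1) in \<open>auto intro: finite_subset\<close>)
  finally show ?thesis by simp
qed

lemma mesh_surface_integral_nonneg:
  fixes M :: "('k, 'd::finite) dg_mesh"
  assumes card: "CARD('e::finite) + 1 = CARD('d)" and M: "conforming_mesh M \<Omega>" and f: "f \<in> mesh_faces M"
    and g: "\<And>x. 0 \<le> g x"
  shows "0 \<le> surface_integral TYPE('e) f g"
proof -
  obtain k where k: "k \<in> elems M" "f \<in> elem_faces M k" using f by (auto simp: mesh_faces_def)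
  have "smooth_embedding (emap M k) ref_simplex" using M k by (simp add: conforming_mesh_def)
  then show ?thesis
    by (rule elem_face_param[OF card _ k(2)]) (rule surface_integral_nonneg, assumption+, rule g)
qed

theorem theorem3p1:
  fixes ax :: "'d::finite \<Rightarrow> nat" and vg :: "'n::finite \<Rightarrow> nat"
    and A :: "real^'d \<Rightarrow> real^'d^'n" and A_i :: "'d \<Rightarrow> real^'d^'n"
    and \<Omega> :: "(real^'d) set" and M :: "('k, 'd) dg_mesh" and N :: nat
    and \<rho> :: "real^'d \<Rightarrow> real" and \<rho>min \<rho>max :: real
    and C :: "real^'d \<Rightarrow> real^'n^'n" and cmin cmax c'min c'max :: real
    and \<tau>v \<tau>\<sigma> :: "(real^'d) set \<Rightarrow> real"
    and T :: "real set"
    and v :: "real \<Rightarrow> 'k \<Rightarrow> real^'d \<Rightarrow> real^'d"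
    and \<sigma> :: "real \<Rightarrow> 'k \<Rightarrow> real^'d \<Rightarrow> real^'n"
    and energy :: "'k \<Rightarrow> real \<Rightarrow> real"
  assumes dim_d: "CARD('d) = 2 \<or> CARD('d) = 3"
    and dim_Nd: "CARD('n) = CARD('d) * (CARD('d) + 1) div 2"
    and dim_face: "CARD('e::finite) + 1 = CARD('d)"
    and ax: "bij_betw ax UNIV {..<CARD('d)}"
    and vg: "bij_betw vg UNIV {..<CARD('n)}"
    and A_def: "A = A_normal ax vg"
    and A_i_def: "A_i = A_coord ax vg"
    and domain: "lipschitz_domain \<Omega>"
    and mesh: "conforming_mesh M \<Omega>"
    and bdry: "boundary_partition M \<Omega>"
    and \<rho>_meas: "set_borel_measurable lebesgue \<Omega> \<rho>"
    and \<rho>_pos: "0 < \<rho>min"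
    and \<rho>_bounds: "\<forall>x\<in>\<Omega>. \<rho>min \<le> \<rho> x \<and> \<rho> x \<le> \<rho>max"
    and C_meas: "set_borel_measurable lebesgue \<Omega> C"
    and C_sym: "\<forall>x\<in>\<Omega>. transpose (C x) = C x"
    and C_pos: "0 < cmin" "0 < c'min"
    and C_bounds: "\<forall>x\<in>\<Omega>. \<forall>u. norm u = 1 \<longrightarrow> cmin \<le> u \<bullet> (C x *v u) \<and> u \<bullet> (C x *v u) \<le> cmax"
    and Cinv_bounds: "\<forall>x\<in>\<Omega>. \<forall>u. norm u = 1 \<longrightarrow>
          c'min \<le> u \<bullet> (matrix_inv (C x) *v u) \<and> u \<bullet> (matrix_inv (C x) *v u) \<le> c'max"
    and \<tau>_nonneg: "\<forall>f\<in>mesh_faces M. 0 \<le> \<tau>v f \<and> 0 \<le> \<tau>\<sigma> f"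
    and T: "is_interval T" "\<exists>a\<in>T. \<exists>b\<in>T. a < b"
    and space: "\<forall>t\<in>T. v t \<in> dg_space M N \<and> \<sigma> t \<in> dg_space M N"
    and diff: "\<forall>t\<in>T. \<forall>k\<in>elems M. \<forall>x\<in>elem M k.
          (\<lambda>s. v s k x) differentiable (at t within T) \<and>
          (\<lambda>s. \<sigma> s k x) differentiable (at t within T)"
    and momentum_eq: "\<forall>t\<in>T. \<forall>w\<in>dg_space M N.
          (\<Sum>k\<in>elems M.
             L2_inner (elem M k)
               (\<lambda>x. \<rho> x *\<^sub>R vector_derivative (\<lambda>s. v s k x) (at t within T)) (w k)) =
          (\<Sum>k\<in>elems M.
             L2_inner (elem M k)
               (\<lambda>x. \<Sum>i\<in>UNIV. transpose (A_i i) *v partial (elem M k) i (\<sigma> t k) x) (w k) +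
             bdry_inner TYPE('e) M k
               (\<lambda>f x. (1/2) *\<^sub>R trac_jump M A (\<sigma> t) k f x +
                      (\<tau>v f / 2) *\<^sub>R (transpose (A (normal M k x)) *v
                         (A (normal M k x) *v vel_jump M (v t) k f x))) (w k))"
    and stress_eq: "\<forall>t\<in>T. \<forall>q\<in>dg_space M N.
          (\<Sum>k\<in>elems M.
             L2_inner (elem M k)
               (\<lambda>x. matrix_inv (C x) *v vector_derivative (\<lambda>s. \<sigma> s k x) (at t within T)) (q k)) =
          (\<Sum>k\<in>elems M.
             L2_inner (elem M k)
               (\<lambda>x. \<Sum>i\<in>UNIV. A_i i *v partial (elem M k) i (v t k) x) (q k) +
             bdry_inner TYPE('e) M k
               (\<lambda>f x. (1/2) *\<^sub>R (A (normal M k x) *v vel_jump M (v t) k f x) +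
                      (\<tau>\<sigma> f / 2) *\<^sub>R (A (normal M k x) *v trac_jump M A (\<sigma> t) k f x)) (q k))"
    and energy_def: "energy = (\<lambda>k t.
          L2_inner (elem M k) (\<lambda>x. \<rho> x *\<^sub>R v t k x) (v t k) +
          L2_inner (elem M k) (\<lambda>x. matrix_inv (C x) *v \<sigma> t k x) (\<sigma> t k))"
  shows "\<forall>t\<in>T.
     (\<forall>k\<in>elems M. energy k differentiable (at t within T)) \<and>
     (let R =
        - (\<Sum>f\<in>mesh_faces M - boundary_faces M \<Omega>. surface_integral TYPE('e) f
             (\<lambda>x. let k = minus_elem M f in
                \<tau>v f / 2 * (norm (A (normal M k x) *v vel_jump M (v t) k f x))\<^sup>2 +
                \<tau>\<sigma> f / 2 * (norm (trac_jump M A (\<sigma> t) k f x))\<^sup>2))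
        - (\<Sum>f\<in>vel_faces M. surface_integral TYPE('e) f
             (\<lambda>x. let k = minus_elem M f in
                \<tau>v f * (norm (A (normal M k x) *v v t k x))\<^sup>2))
        - (\<Sum>f\<in>trac_faces M. surface_integral TYPE('e) f
             (\<lambda>x. let k = minus_elem M f in
                \<tau>\<sigma> f * (norm (transpose (A (normal M k x)) *v \<sigma> t k x))\<^sup>2))
        - (\<Sum>f\<in>abc_faces M. surface_integral TYPE('e) f
             (\<lambda>x. let k = minus_elem M f in
                \<tau>v f / 2 * (norm (A (normal M k x) *v v t k x))\<^sup>2 +
                \<tau>\<sigma> f / 2 * (norm (transpose (A (normal M k x)) *v \<sigma> t k x))\<^sup>2))
      in (\<Sum>k\<in>elems M. 1/2 * vector_derivative (energy k) (at t within T)) = R \<and> R \<le> 0)"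
proof (intro ballI)
  fix t assume t: "t \<in> T"
  have M: "conforming_mesh M \<Omega>" and \<Omega>: "lipschitz_domain \<Omega>" using mesh domain by auto
  have vt: "v s \<in> dg_space M N" and \<sigma>t: "\<sigma> s \<in> dg_space M N" if "s \<in> T" for s using space that by auto
  have A: "A n = (\<Sum>i\<in>UNIV. n $ i *\<^sub>R A_i i)" for n
    unfolding A_def A_i_def by (rule A_normal_eq_sum[OF dim_d dim_Nd ax vg])
  \<comment> \<open>A nondegenerate interval has no isolated points; this makes the one-sided
    derivatives at its end points unique as well.\<close>
  have nb: "at t within T \<noteq> bot"
  proof -
    have "T \<noteq> {x}" for x using T(2) by auto
    then have "t islimpt T" by (intro connected_imp_perfect is_interval_connected T(1) t)
    then show ?thesis by (simp add: trivial_limit_within)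
  qed
  define v' where "v' k x = vector_derivative (\<lambda>s. v s k x) (at t within T)" for k x
  define \<sigma>' where "\<sigma>' k x = vector_derivative (\<lambda>s. \<sigma> s k x) (at t within T)" for k x
  have \<Omega>_meas: "\<Omega> \<in> sets lebesgue" using \<Omega> by (simp add: lipschitz_domain_def borel_open)
  define E1 where "E1 k = L2_inner (elem M k) (\<lambda>x. \<rho> x *\<^sub>R v' k x) (v t k)" for k
  define E2 where "E2 k = L2_inner (elem M k) (\<lambda>x. matrix_inv (C x) *v \<sigma>' k x) (\<sigma> t k)" for k
  have dE: "(energy k has_vector_derivative 2 * E1 k + 2 * E2 k) (at t within T)" if k: "k \<in> elems M" for k
  proof -
    \<comment> \<open>Written as a multiple of the identity, the density becomes a matrix weight,
      and one lemma differentiates both parts of the energy.\<close>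
    let ?K = "\<lambda>x. \<rho> x *\<^sub>R (mat 1 :: real^'d^'d)"
    have \<rho>K: "?K x *v w = \<rho> x *\<^sub>R w" for x w by (simp add: scaleR_matrix_vector_assoc[symmetric])
    have "((\<lambda>s. L2_inner (elem M k) (\<lambda>x. ?K x *v v s k x) (v s k)) has_vector_derivative
      2 * L2_inner (elem M k) (\<lambda>x. ?K x *v vector_derivative (\<lambda>s. v s k x) (at t within T)) (v t k)) (at t within T)"
    proof (rule dg_element_energy_derivative[OF M \<Omega> k])
      show "set_borel_measurable lebesgue \<Omega> (\<lambda>x. ?K x $ i $ j)" for i j
        using \<rho>_meas by (cases "i = j") (simp_all add: mat_def set_borel_measurable_def)
      show "\<bar>?K x $ i $ j\<bar> \<le> \<rho>max" if "x \<in> \<Omega>" for x i j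
        using \<rho>_bounds \<rho>_pos that by (force simp: mat_def)
      show "transpose (?K x) = ?K x" for x by (simp add: transpose_def mat_def vec_eq_iff eq_commute)
    qed (use t nb vt diff k in auto)
    moreover have "((\<lambda>s. L2_inner (elem M k) (\<lambda>x. matrix_inv (C x) *v \<sigma> s k x) (\<sigma> s k)) has_vector_derivative
      2 * L2_inner (elem M k) (\<lambda>x. matrix_inv (C x) *v vector_derivative (\<lambda>s. \<sigma> s k x) (at t within T)) (\<sigma> t k)) (at t within T)"
    proof (rule dg_element_energy_derivative[OF M \<Omega> k])
      have spd: "det (C x) \<noteq> 0" "transpose (matrix_inv (C x)) = matrix_inv (C x)" "\<bar>matrix_inv (C x) $ i $ j\<bar> \<le> 2 * c'max"
        if "x \<in> \<Omega>" for x i j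
        using spd_inverse[of "C x" cmin c'min c'max] C_sym C_pos C_bounds Cinv_bounds that by blast+
      show "set_borel_measurable lebesgue \<Omega> (\<lambda>x. matrix_inv (C x) $ i $ j)" for i j
        by (rule set_borel_measurable_matrix_inv[OF C_meas \<Omega>_meas spd(1)])
      show "\<bar>matrix_inv (C x) $ i $ j\<bar> \<le> 2 * c'max" if "x \<in> \<Omega>" for x i j by (rule spd(3)[OF that])
      show "transpose (matrix_inv (C x)) = matrix_inv (C x)" if "x \<in> \<Omega>" for x by (rule spd(2)[OF that])
    qed (use t nb \<sigma>t diff k in auto)
    ultimately show ?thesis
      unfolding energy_def E1_def E2_def v'_def \<sigma>'_def \<rho>K by (rule has_vector_derivative_add)
  qed
  define Q where "Q = face_flux M A \<tau>v \<tau>\<sigma> (v t) (\<sigma> t)"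
  let ?b1 = "\<lambda>k. bdry_inner TYPE('e) M k (\<lambda>f x. (1/2) *\<^sub>R trac_jump M A (\<sigma> t) k f x +
      (\<tau>v f / 2) *\<^sub>R (transpose (A (normal M k x)) *v (A (normal M k x) *v vel_jump M (v t) k f x))) (v t k)"
  let ?b2 = "\<lambda>k. bdry_inner TYPE('e) M k (\<lambda>f x. (1/2) *\<^sub>R (A (normal M k x) *v vel_jump M (v t) k f x) +
      (\<tau>\<sigma> f / 2) *\<^sub>R (A (normal M k x) *v trac_jump M A (\<sigma> t) k f x)) (\<sigma> t k)"
  let ?w1 = "\<lambda>k. L2_inner (elem M k) (\<lambda>x. \<Sum>i\<in>UNIV. transpose (A_i i) *v partial (elem M k) i (\<sigma> t k) x) (v t k)"
  let ?w2 = "\<lambda>k. L2_inner (elem M k) (\<lambda>x. \<Sum>i\<in>UNIV. A_i i *v partial (elem M k) i (v t k) x) (\<sigma> t k)"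
  have el: "(?w1 k + ?b1 k) + (?w2 k + ?b2 k) = (\<Sum>f\<in>elem_faces M k. surface_integral TYPE('e) f (Q k f))"
    if k: "k \<in> elems M" for k
  proof -
    have "(?w1 k + ?b1 k) + (?w2 k + ?b2 k) = (?w1 k + ?w2 k) + (?b1 k + ?b2 k)" by simp
    also have "?w1 k + ?w2 k = (\<Sum>f\<in>elem_faces M k. surface_integral TYPE('e) f (\<lambda>x. \<sigma> t k x \<bullet> (A (normal M k x) *v v t k x)))"
      by (rule element_integration_by_parts[OF dim_face A M \<Omega> k vt[OF t] \<sigma>t[OF t]])
    finally show ?thesis
      unfolding bdry_inner_def sum.distrib[symmetric] Q_def
      by (simp only: patch_continuous_face_flux(2)[OF dim_face A M bdry k _ vt[OF t] \<sigma>t[OF t]] cong: sum.cong)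
  qed
  have m: "(\<Sum>k\<in>elems M. E1 k) = (\<Sum>k\<in>elems M. ?w1 k + ?b1 k)"
    unfolding E1_def v'_def using momentum_eq t vt[OF t] by blast
  have s: "(\<Sum>k\<in>elems M. E2 k) = (\<Sum>k\<in>elems M. ?w2 k + ?b2 k)"
    unfolding E2_def \<sigma>'_def using stress_eq t \<sigma>t[OF t] by blast
  have sum: "(\<Sum>k\<in>elems M. E1 k + E2 k) = (\<Sum>k\<in>elems M. \<Sum>f\<in>elem_faces M k. surface_integral TYPE('e) f (Q k f))"
    unfolding sum.distrib m s by (simp only: sum.distrib[symmetric] el cong: sum.cong)
  have vd: "(\<Sum>k\<in>elems M. 1/2 * vector_derivative (energy k) (at t within T)) = (\<Sum>k\<in>elems M. E1 k + E2 k)"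
    by (intro sum.cong refl) (simp add: vector_derivative_within[OF nb dE])
  have sub: "vel_faces M \<subseteq> mesh_faces M" "trac_faces M \<subseteq> mesh_faces M" "abc_faces M \<subseteq> mesh_faces M"
    using bdry by (auto simp: boundary_partition_def boundary_faces_def)
  have \<tau>: "0 \<le> \<tau>v f" "0 \<le> \<tau>\<sigma> f" if "f \<in> mesh_faces M" for f using \<tau>_nonneg that by auto
  show "(\<forall>k\<in>elems M. energy k differentiable (at t within T)) \<and>
     (let R =
        - (\<Sum>f\<in>mesh_faces M - boundary_faces M \<Omega>. surface_integral TYPE('e) f
             (\<lambda>x. let k = minus_elem M f in
                \<tau>v f / 2 * (norm (A (normal M k x) *v vel_jump M (v t) k f x))\<^sup>2 +
                \<tau>\<sigma> f / 2 * (norm (trac_jump M A (\<sigma> t) k f x))\<^sup>2))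
        - (\<Sum>f\<in>vel_faces M. surface_integral TYPE('e) f
             (\<lambda>x. let k = minus_elem M f in
                \<tau>v f * (norm (A (normal M k x) *v v t k x))\<^sup>2))
        - (\<Sum>f\<in>trac_faces M. surface_integral TYPE('e) f
             (\<lambda>x. let k = minus_elem M f in
                \<tau>\<sigma> f * (norm (transpose (A (normal M k x)) *v \<sigma> t k x))\<^sup>2))
        - (\<Sum>f\<in>abc_faces M. surface_integral TYPE('e) f
             (\<lambda>x. let k = minus_elem M f in
                \<tau>v f / 2 * (norm (A (normal M k x) *v v t k x))\<^sup>2 +
                \<tau>\<sigma> f / 2 * (norm (transpose (A (normal M k x)) *v \<sigma> t k x))\<^sup>2))
      in (\<Sum>k\<in>elems M. 1/2 * vector_derivative (energy k) (at t within T)) = R \<and> R \<le> 0)"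
    (is "_ \<and> (let R = - sum ?i _ - sum ?v _ - sum ?t _ - sum ?a _ in _)")
  proof (intro conjI ballI)
    show "energy k differentiable (at t within T)" if "k \<in> elems M" for k
      using dE[OF that] by (auto simp: has_vector_derivative_def differentiable_def)
    have i: "0 \<le> sum ?i (mesh_faces M - boundary_faces M \<Omega>)"
      by (intro sum_nonneg mesh_surface_integral_nonneg[OF dim_face M]) (auto simp: Let_def \<tau>)
    have v: "0 \<le> sum ?v (vel_faces M)"
      by (intro sum_nonneg mesh_surface_integral_nonneg[OF dim_face M]) (use sub \<tau> in \<open>auto simp: Let_def\<close>)
    have t': "0 \<le> sum ?t (trac_faces M)"
      by (intro sum_nonneg mesh_surface_integral_nonneg[OF dim_face M]) (use sub \<tau> in \<open>auto simp: Let_def\<close>)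
    have a: "0 \<le> sum ?a (abc_faces M)"
      by (intro sum_nonneg mesh_surface_integral_nonneg[OF dim_face M]) (use sub \<tau> in \<open>auto simp: Let_def\<close>)
    have "(\<Sum>k\<in>elems M. E1 k + E2 k) = (\<Sum>f\<in>mesh_faces M - boundary_faces M \<Omega>. - ?i f) + (\<Sum>f\<in>vel_faces M. - ?v f) +
        (\<Sum>f\<in>trac_faces M. - ?t f) + (\<Sum>f\<in>abc_faces M. - ?a f)"
      unfolding sum face_sum_split[OF dim_face M bdry] Q_def
      by (intro arg_cong2[where f = "(+)"] sum.cong refl
          face_flux_interior[OF dim_face A M bdry _ vt[OF t] \<sigma>t[OF t]] face_flux_boundary[OF dim_face M \<Omega> bdry])
    then have "(\<Sum>k\<in>elems M. 1/2 * vector_derivative (energy k) (at t within T)) =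
        - sum ?i (mesh_faces M - boundary_faces M \<Omega>) - sum ?v (vel_faces M) - sum ?t (trac_faces M) - sum ?a (abc_faces M)"
      unfolding vd by (simp only: sum_negf)
    with i v t' a show "let R = - sum ?i (mesh_faces M - boundary_faces M \<Omega>) - sum ?v (vel_faces M) - sum ?t (trac_faces M) - sum ?a (abc_faces M)
      in (\<Sum>k\<in>elems M. 1/2 * vector_derivative (energy k) (at t within T)) = R \<and> R \<le> 0"
      unfolding Let_def[of "- _ - _ - _ - _"] by linarith
  qed
qed

end
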